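(* Let $\mu$ be a measure on the Borel subsets of $(0,\infty)$ such that $$0 < \int_0^{\infty} \frac{\lambda}{\lambda+1}\, d\mu(\lambda) < \infty .$$ With $f_\mu$, $H_\mu$, $M(\lambda,z)$ and $\widehat M(\lambda,t)$ as defined in the context, the following hold. (i) The real entire function $H_\mu(z)$ has exponential type at most $2\pi$. (ii) For all real $x$ the function $\lambda\mapsto M(\lambda,x)-e^{-\lambda|x|}$ is nonnegative and integrable on $(0,\infty)$ with respect to $\mu$. (iii) For all real $x$, $$0\le H_\mu(x)-f_\mu(x)=\int_0^\infty \{M(\lambda,x)-e^{-\lambda|x|}\}\,d\mu(\lambda).$$ (iv) The nonnegative function $x\mapsto H_\mu(x)-f_\mu(x)$ is integrable on $\mathbb{R}$, and $$\int_{-\infty}^\infty \{H_\mu(x)-f_\mu(x)\}\,dx=\int_0^\infty\left\{\coth\left(\tfrac{\lambda}{2}\right)-\tfrac{2}{\lambda}\right\}d\mu(\lambda).$$ (v) If $t\ne 0$ then $$\int_{-\infty}^\infty\{H_\mu(x)-f_\mu(x)\}e(-tx)\,dx=\int_0^\infty\widehat M(\lambda,t)\,d\mu(\lambda)-\int_0^\infty\frac{2\lambda}{\lambda^2+4\pi^2t^2}\,d\mu(\lambda).$$ (vi) If $\widetilde H(z)$ is a real entire function of exponential type at most $2\pi$ such that $f_\mu(x)\le \widetilde H(x)$ for all real $x$, then $$\int_{-\infty}^\infty\{H_\mu(x)-f_\mu(x)\}\,dx\le\int_{-\infty}^\infty\{\widetilde H(x)-f_\mu(x)\}\,dx.$$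 (vii) There is equality in the inequality of (vi) if and only if $\widetilde H(z)=H_\mu(z)$.
   Context: Conventions: a real entire function is an entire function taking real values on $\mathbb{R}$. An entire function $F$ has exponential type at most $\tau$ if for every $\varepsilon>0$ there is $C_\varepsilon$ with $|F(z)|\le C_\varepsilon e^{(\tau+\varepsilon)|z|}$ for all $z\in\mathbb{C}$. Write $e(z)=e^{2\pi i z}$, and $\operatorname{sgn}(x)=1,0,-1$ according as $x>0$, $x=0$, $x<0$. Integrals of nonnegative functions take values in $[0,\infty]$. For $\lambda>0$ define the entire function (with removable singularities removed) $$M(\lambda,z)=\left(\frac{\sin\pi z}{\pi}\right)^2\left\{\sum_{k\in\mathbb{Z}}\frac{e^{-\lambda|k|}}{(z-k)^2}-\lambda\sum_{l\in\mathbb{Z}}\frac{\operatorname{sgn}(l)e^{-\lambda|l|}}{z-l}\right\}.$$ It is real entire of exponential type $2\pi$, bounded and integrable on $\mathbb{R}$, and $\widehat M(\lambda,t)=\int_{-\infty}^\infty M(\lambda,x)e(-tx)\,dx$, which is continuous in $t$ and supported on $[-1,1]$. Define $f_\mu:\mathbb{R}\to\mathbb{R}$ by $$f_\mu(x)=\int_0^\infty\{e^{-\lambda|x|}-e^{-\lambda}\}\,d\mu(\lambda)$$ (finite for all real $x$ under the hypothesis on $\mu$). For $x\ne0$, $f_\mu$ is smooth and $f_\mu'(x)=-\operatorname{sgn}(x)\int_0^\infty\lambda e^{-\lambda|x|}\,d\mu(\lambda)$. Define $H_\mu:\mathbb{C}\to\mathbb{C}$ by $$H_\mu(z)=\lim_{N\to\infty}\left(\frac{\sin\pi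 z}{\pi}\right)^2\left\{\sum_{|n|\le N}\frac{f_\mu(n)}{(z-n)^2}+\sum_{1\le|n|\le N}\frac{f_\mu'(n)}{z-n}\right\};$$ the limit converges uniformly on compact subsets of $\mathbb{C}$ and defines a real entire function. *)

theory Defs
  imports "HOL-Complex_Analysis.Complex_Analysis"
begin

definition real_entire :: "(complex \<Rightarrow> complex) \<Rightarrow> bool" where
  "real_entire F \<longleftrightarrow> F holomorphic_on UNIV \<and> (\<forall>x::real. F (of_real x) \<in> \<real>)"

definition exp_type_at_most :: "real \<Rightarrow> (complex \<Rightarrow> complex) \<Rightarrow> bool" where
  "exp_type_at_most \<tau> F \<longleftrightarrow>
     (\<forall>\<epsilon>>0. \<exists>C::real. \<forall>z. norm (F z) \<le> C * exp ((\<tau> + \<epsilon>) * norm z))"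

definition e2pi :: "complex \<Rightarrow> complex" where
  "e2pi z = exp (2 * of_real pi * \<i> * z)"

definition coth :: "real \<Rightarrow> real" where
  "coth x = cosh x / sinh x"

(* The closed formula has removable singularities at the integers, where a term of the
   form a / 0 would be evaluated as 0; remove_sings replaces its values by its limits. *)
definition M :: "real \<Rightarrow> complex \<Rightarrow> complex" where
  "M lam = remove_sings (\<lambda>z. (sin (of_real pi * z) / of_real pi)\<^sup>2 *
     ((\<Sum>\<^sub>\<infinity>k::int. of_real (exp (- lam * \<bar>of_int k\<bar>)) / (z - of_int k)\<^sup>2)
      - of_real lam *
        (\<Sum>\<^sub>\<infinity>l::int. of_int (sgn l) * of_real (exp (- lam * \<bar>of_int l\<bar>)) / (z - of_int l))))"

definition M_hat :: "real \<Rightarrow> real \<Rightarrow> complex" where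
  "M_hat lam t = (LINT x|lborel. M lam (of_real x) * e2pi (of_real (- t * x)))"

definition f_mu :: "real measure \<Rightarrow> real \<Rightarrow> real" where
  "f_mu \<mu> x = (LINT lam|\<mu>. exp (- lam * \<bar>x\<bar>) - exp (- lam))"

definition H_partial :: "real measure \<Rightarrow> nat \<Rightarrow> complex \<Rightarrow> complex" where
  "H_partial \<mu> N = remove_sings (\<lambda>z. (sin (of_real pi * z) / of_real pi)\<^sup>2 *
     ((\<Sum>n\<in>{- int N..int N}. of_real (f_mu \<mu> (of_int n)) / (z - of_int n)\<^sup>2)
      + (\<Sum>n\<in>{- int N..int N} - {0}. of_real (deriv (f_mu \<mu>) (of_int n)) / (z - of_int n))))"

definition H_mu :: "real measure \<Rightarrow> complex \<Rightarrow> complex" where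
  "H_mu \<mu> z = lim (\<lambda>N. H_partial \<mu> N z)"

end

theory Submission
  imports Defs "HOL-Real_Asymp.Real_Asymp" "HOL-Probability.Sinc_Integral"
begin

text \<open>
  For integrable functions of exponential type \<open>2 * pi\<close>, Poisson summation holds at the critical type:
  the integral over the real line is the limit of the symmetric sums over the integers, because the
  Fourier transform is continuous and vanishes outside \<open>{-1<..<1}\<close>. Applied to the difference of a
  competitor and \<open>H\<close>, whose values at the integers are those of \<open>f_mu\<close>, it expresses the difference
  of the two integrals as a sum of nonnegative terms. In the case of equality the competitor touches
  \<open>f_mu\<close> at every integer, hence also has the derivative of \<open>f_mu\<close> at every nonzero integer; \<open>z\<close> times the
  difference is then \<open>sin\<^sup>2 (\<pi> z)\<close> times an entire function, which turns out to be affine and which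
  integrability forces to vanish.

  The gap \<open>M(\<lambda>, x) - exp (- \<lambda> \<bar>x\<bar>)\<close> is a multiple of \<open>sin\<^sup>2 (\<pi> x)\<close> times a Laplace transform
  whose kernel lies between \<open>0\<close> and \<open>w * min 1 \<lambda>\<close>. This yields nonnegativity, integrability
  in both variables, and Fubini. The series defining \<open>H\<close> may be integrated termwise because its
  symmetric partial sums are bounded by a multiple of \<open>min 1 \<lambda>\<close>.
\<close>

section \<open>Holomorphic integrals depending on a parameter\<close>

text \<open>The weight \<open>min 1 lam\<close> lies between \<open>lam / (lam + 1)\<close> and
  twice that quantity, so estimates by a multiple of it are what the hypothesis on the measure can
  integrate. The total mass may be infinite near 0, and for this reason \<open>exp (- lam)\<close>
  is subtracted from the majorant before anything is integrated in \<open>lam\<close>. A competitor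
  is known only on the real line and through its type. The Phragmen-Lindeloef principle and the
  Plancherel-Polya inequality carry integrability to every horizontal line, after which contours can
  be moved. Poisson summation is used three times: for a squared sinc function, where it yields the
  partition of unity behind the Laplace formula; for the majorant, where it evaluates the integral;
  and for the difference of a competitor and \<open>H\<close>. The origin is exceptional because
  \<open>f_mu\<close> has a corner or cusp there, so that touching \<open>f_mu\<close> at 0 says
  nothing about the derivative; the factor \<open>z\<close> in the uniqueness argument compensates
  for this.\<close>

lemma has_field_derivative_parametric_integral:
  fixes f :: "'a \<Rightarrow> complex \<Rightarrow> complex"
  assumes S: "open S" "z \<in> S"
    and hol: "\<And>t. t \<in> space N \<Longrightarrow> f t holomorphic_on S"
    and meas: "\<And>w. w \<in> S \<Longrightarrow> (\<lambda>t. f t w) \<in> borel_measurable N"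
    and r: "r > 0" and g: "integrable N g"
    and dom: "\<And>w t. w \<in> S \<Longrightarrow> dist z w < r \<Longrightarrow> t \<in> space N \<Longrightarrow> norm (f t w) \<le> g t"
  shows "((\<lambda>w. LINT t|N. f t w) has_field_derivative (LINT t|N. deriv (f t) z)) (at z)"
proof -
  obtain e where e: "e > 0" "cball z e \<subseteq> S" using S open_contains_cball by blast
  \<comment> \<open>One radius is spent on the increment and another on the circle in Cauchy's
    inequality, so \<open>2 * \<rho>\<close> has to fit both into \<open>S\<close> and into the ball
    where the bound by \<open>g\<close> holds.\<close>
  define \<rho> where "\<rho> = min e (r/2) / 2"
  have \<rho>: "\<rho> > 0" "2 * \<rho> \<le> e" "2 * \<rho> < r" using e r by (auto simp: \<rho>_def)
  have inS: "w \<in> S" if "dist z w \<le> 2 * \<rho>" for w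
    using e \<rho> that by (auto simp: subset_iff)
  have int: "integrable N (\<lambda>t. f t w)" if "dist z w \<le> 2 * \<rho>" for w
    by (rule Bochner_Integration.integrable_bound[OF g])
      (use inS meas dom that \<rho> in \<open>auto intro!: AE_I2 order_trans[OF dom]\<close>)
  \<comment> \<open>Cauchy's inequality turns the bound on the functions into one on their
    derivatives, and the mean value inequality then dominates the difference quotients. No separate
    bound on the derivative has to be supplied by users of the lemma.\<close>
  have der: "norm (deriv (f t) w) \<le> g t / \<rho>" if t: "t \<in> space N" and w: "dist z w \<le> \<rho>" for t w
  proof -
    have sub: "dist z x \<le> 2 * \<rho>" if "dist w x \<le> \<rho>" for x
      using dist_triangle[of z x w] w that by simp
    have "cball w \<rho> \<subseteq> S" using sub inS by auto
    then have h: "f t holomorphic_on cball w \<rho>" using hol[OF t] holomorphic_on_subset by blast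
    have "norm ((deriv ^^ 1) (f t) w) \<le> fact 1 * g t / \<rho> ^ 1"
    proof (rule Cauchy_inequality)
      show "f t holomorphic_on ball w \<rho>" using h by (meson ball_subset_cball holomorphic_on_subset)
      show "continuous_on (cball w \<rho>) (f t)" by (rule holomorphic_on_imp_continuous_on[OF h])
      show "norm (f t x) \<le> g t" if "norm (w - x) = \<rho>" for x
        using dom[of x t] inS[OF sub, of x] sub[of x] that t \<rho> by (auto simp: dist_norm)
    qed (use \<rho> in auto)
    then show ?thesis by simp
  qed
  have quot: "norm ((f t (z + h) - f t z) / h) \<le> g t / \<rho>"
    if t: "t \<in> space N" and h: "norm h \<le> \<rho>" "h \<noteq> 0" for t h
  proof -
    have "norm (f t (z + h) - f t z) \<le> (g t / \<rho>) * norm (z + h - z)"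
    proof (rule field_differentiable_bound[where S = "cball z \<rho>" and f' = "deriv (f t)"])
      show "(f t has_field_derivative deriv (f t) x) (at x within cball z \<rho>)" if "x \<in> cball z \<rho>" for x
        using hol[OF t] S(1) inS[of x] that \<rho>
        by (intro has_field_derivative_at_within[OF holomorphic_derivI[of _ S]]) auto
    qed (use der t h \<rho> in \<open>auto simp: dist_norm\<close>)
    then show ?thesis using h by (simp add: norm_divide field_simps)
  qed
  have lim: "(\<lambda>n. (f t (z + h n) - f t z) / h n) \<longlonglongrightarrow> deriv (f t) z"
    if t: "t \<in> space N" and h: "h \<longlonglongrightarrow> 0" "\<And>n. h n \<noteq> 0" for t h
  proof -
    have "(f t has_field_derivative deriv (f t) z) (at z)"
      using hol[OF t] S by (intro holomorphic_derivI[of _ S]) auto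
    then have "((\<lambda>h. (f t (z + h) - f t z) / h) \<longlongrightarrow> deriv (f t) z) (at 0)"
      by (simp add: DERIV_def)
    moreover have "filterlim h (at 0) sequentially"
      using h by (auto simp: filterlim_at)
    ultimately show ?thesis by (rule filterlim_compose)
  qed
  have ex: "(\<lambda>t. deriv (f t) z) \<in> borel_measurable N"
  proof -
    define h where "h = (\<lambda>n. complex_of_real (\<rho> / real (Suc n)))"
    have "h \<longlonglongrightarrow> of_real 0"
      unfolding h_def by (intro tendsto_of_real LIMSEQ_Suc[OF lim_const_over_n])
    then have h: "h \<longlonglongrightarrow> 0" "\<And>n. h n \<noteq> 0" using \<rho> by (auto simp: h_def simp del: of_nat_Suc)
    have hn: "norm (h n) \<le> \<rho>" for n
      using \<rho> by (simp add: h_def norm_divide field_simps del: of_nat_Suc)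
    show ?thesis
    proof (rule borel_measurable_LIMSEQ_metric[where f = "\<lambda>n t. (f t (z + h n) - f t z) / h n"])
      show "(\<lambda>t. (f t (z + h n) - f t z) / h n) \<in> borel_measurable N" for n
        using meas[of "z + h n"] meas[OF S(2)] inS[of "z + h n"] hn[of n] \<rho>
        by (auto simp: dist_norm)
    qed (use lim h in auto)
  qed
  show "((\<lambda>w. LINT t|N. f t w) has_field_derivative (LINT t|N. deriv (f t) z)) (at z)"
    unfolding DERIV_def tendsto_at_iff_sequentially
  proof (intro allI impI, unfold comp_def)
    fix h :: "nat \<Rightarrow> complex" assume h: "\<forall>i. h i \<in> UNIV - {0}" "h \<longlonglongrightarrow> 0"
    have "\<forall>\<^sub>F n in sequentially. dist (h n) 0 < \<rho>" using h \<rho> tendstoD by blast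
    then obtain n0 where n0: "\<And>n. n \<ge> n0 \<Longrightarrow> norm (h n) < \<rho>"
      by (auto simp: eventually_sequentially)
    have *: "(\<lambda>n. LINT t|N. (f t (z + h (n + n0)) - f t z) / h (n + n0)) \<longlonglongrightarrow> (LINT t|N. deriv (f t) z)"
    proof (rule integral_dominated_convergence[where w = "\<lambda>t. g t / \<rho>"])
      show "(\<lambda>t. (f t (z + h (n + n0)) - f t z) / h (n + n0)) \<in> borel_measurable N" for n
        using meas[of "z + h (n + n0)"] meas[OF S(2)] inS[of "z + h (n+n0)"] n0[of "n+n0"] \<rho>
        by (auto simp: dist_norm)
      show "AE t in N. (\<lambda>n. (f t (z + h (n + n0)) - f t z) / h (n + n0)) \<longlonglongrightarrow> deriv (f t) z"
        using h by (intro AE_I2 lim LIMSEQ_ignore_initial_segment) auto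
      show "AE t in N. norm ((f t (z + h (n + n0)) - f t z) / h (n + n0)) \<le> g t / \<rho>" for n
        using h n0[of "n+n0"] by (intro AE_I2 quot) auto
    qed (use ex g in auto)
    have "(\<lambda>n. ((LINT t|N. f t (z + h (n+n0))) - (LINT t|N. f t z)) / h (n+n0)) \<longlonglongrightarrow> (LINT t|N. deriv (f t) z)"
    proof (rule Lim_transform_eventually[OF *], rule always_eventually, rule allI)
      fix n
      have "integrable N (\<lambda>t. f t (z + h (n+n0)))" "integrable N (\<lambda>t. f t z)"
        using int[of "z + h (n+n0)"] int[of z] n0[of "n+n0"] \<rho> by (auto simp: dist_norm)
      then show "(LINT t|N. (f t (z + h (n + n0)) - f t z) / h (n + n0)) =
          ((LINT t|N. f t (z + h (n+n0))) - (LINT t|N. f t z)) / h (n+n0)" by simp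
    qed
    then show "(\<lambda>n. ((LINT t|N. f t (z + h n)) - (LINT t|N. f t z)) / h n) \<longlonglongrightarrow> (LINT t|N. deriv (f t) z)"
      by (rule LIMSEQ_offset)
  qed
qed

lemma holomorphic_parametric_integral:
  fixes f :: "'a \<Rightarrow> complex \<Rightarrow> complex"
  assumes S: "open S"
    and hol: "\<And>t. t \<in> space N \<Longrightarrow> f t holomorphic_on S"
    and meas: "\<And>w. w \<in> S \<Longrightarrow> (\<lambda>t. f t w) \<in> borel_measurable N"
    and dom: "\<And>z. z \<in> S \<Longrightarrow> \<exists>r>0. \<exists>g. integrable N g \<and>
        (\<forall>w\<in>S. dist z w < r \<longrightarrow> (\<forall>t\<in>space N. norm (f t w) \<le> g t))"
  shows "(\<lambda>w. LINT t|N. f t w) holomorphic_on S"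
proof (unfold holomorphic_on_open[OF S], intro ballI)
  fix z assume z: "z \<in> S"
  obtain r g where rg: "r > 0" "integrable N g"
    "\<And>w t. w \<in> S \<Longrightarrow> dist z w < r \<Longrightarrow> t \<in> space N \<Longrightarrow> norm (f t w) \<le> g t"
    using dom[OF z] by blast
  show "\<exists>f'. ((\<lambda>w. LINT t|N. f t w) has_field_derivative f') (at z)"
    by (intro exI, rule has_field_derivative_parametric_integral[OF S z hol meas rg])
qed

section \<open>The Phragmen--Lindeloef principle for functions of exponential type\<close>

text \<open>The hypothesis says that \<open>q\<^sup>2\<close> lies in the sector of arguments at
  most \<pi>/4 in modulus. Then \<open>q\<close> has argument at most \<pi>/8 and its cube at most
  3\<pi>/8, which stays strictly inside the right half-plane.\<close>

lemma Re_cube_ge: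
  assumes "Re q \<ge> 0" "2 * Re q * \<bar>Im q\<bar> \<le> (Re q)\<^sup>2 - (Im q)\<^sup>2"
  shows "Re (q ^ 3) \<ge> (Re q)^3 / 4"
proof -
  define a b where "a = Re q" and "b = \<bar>Im q\<bar>"
  have ab: "a \<ge> 0" "b \<ge> 0" "2 * a * b \<le> a\<^sup>2 - b\<^sup>2" using assms by (auto simp: a_def b_def)
  have "2 * b \<le> a"
  proof (rule ccontr)
    assume "\<not> 2 * b \<le> a"
    then have "a < 2 * b" by simp
    then have "a * a \<le> 2 * b * a" using ab by (intro mult_right_mono) auto
    with ab have "b\<^sup>2 \<le> 0" by (auto simp: power2_eq_square algebra_simps)
    then show False using ab \<open>a < 2 * b\<close> by auto
  qed
  then have "4 * b\<^sup>2 \<le> a\<^sup>2" using power_mono[of "2*b" a 2] ab by (auto simp: power_mult_distrib)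
  then have "a * (a\<^sup>2 - 3 * b\<^sup>2) \<ge> a * (a\<^sup>2 / 4)" using ab by (intro mult_left_mono) auto
  moreover have "Re (q ^ 3) = a * (a\<^sup>2 - 3 * b\<^sup>2)"
    by (simp add: a_def b_def power2_eq_square power3_eq_cube algebra_simps)
  ultimately show ?thesis by (simp add: a_def power2_eq_square power3_eq_cube)
qed

text \<open>The damping factor \<open>exp (- \<delta> * q z ^ 3)\<close> decays like an exponential
  of the power 3/2 of the modulus. This order lies strictly between 1, the growth of
  \<open>f\<close>, and 2, the critical order of a quadrant. The maximum principle on large quarter
  discs gives the bound for each \<delta>, and \<delta> then tends to 0.\<close>

lemma phragmen_lindelof_quadrant:
  assumes hol: "f holomorphic_on UNIV"
    and growth: "\<And>z. norm (f z) \<le> C * exp (B * norm z)" and "C > 0" "B \<ge> 0"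
    and re: "\<And>x::real. x \<ge> 0 \<Longrightarrow> norm (f (of_real x)) \<le> K"
    and im: "\<And>y::real. y \<ge> 0 \<Longrightarrow> norm (f (\<i> * of_real y)) \<le> K"
    and z: "Re z \<ge> 0" "Im z \<ge> 0"
  shows "norm (f z) \<le> K"
proof -
  \<comment> \<open>The factor \<open>1 - \<i>\<close> turns the quadrant into the sector around the
    positive axis, and the shift by 2 keeps it off the branch cut of \<open>csqrt\<close>, so
    \<open>q\<close> is holomorphic up to the boundary.\<close>
  define \<zeta> where "\<zeta> = (\<lambda>z. (1 - \<i>) * z + 2)"
  define q where "q = (\<lambda>z. csqrt (\<zeta> z))"
  define D where "D = {z::complex. Re z \<ge> 0 \<and> Im z \<ge> 0}"
  have \<zeta>: "Re (\<zeta> z) \<ge> 2" "\<bar>Im (\<zeta> z)\<bar> \<le> Re (\<zeta> z)" "Re (\<zeta> z) \<ge> norm z"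
    if "z \<in> D" for z
  proof -
    show "Re (\<zeta> z) \<ge> 2" "\<bar>Im (\<zeta> z)\<bar> \<le> Re (\<zeta> z)" using that by (auto simp: \<zeta>_def D_def)
    have "Re (\<zeta> z) \<ge> Re z + Im z" by (simp add: \<zeta>_def)
    moreover have "norm z \<le> Re z + Im z" using cmod_le[of z] that by (auto simp: D_def)
    ultimately show "Re (\<zeta> z) \<ge> norm z" by simp
  qed
  have q2: "q z ^ 2 = \<zeta> z" for z by (simp add: q_def)
  have q: "Re (q z ^ 3) \<ge> Re (q z) ^ 3 / 4" "Re (q z) \<ge> 0" "Re (q z) ^ 2 \<ge> norm z" if "z \<in> D" for z
  proof -
    show 0: "Re (q z) \<ge> 0" unfolding q_def using csqrt_principal[of "\<zeta> z"] by linarith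
    have 1: "Re (\<zeta> z) = (Re (q z))\<^sup>2 - (Im (q z))\<^sup>2" "Im (\<zeta> z) = 2 * Re (q z) * Im (q z)"
      by (simp_all add: q2[symmetric] power2_eq_square)
    have "2 * Re (q z) * \<bar>Im (q z)\<bar> = \<bar>Im (\<zeta> z)\<bar>" using 0 by (simp add: 1 abs_mult)
    then show "Re (q z ^ 3) \<ge> Re (q z) ^ 3 / 4"
      by (intro Re_cube_ge) (use \<zeta>(2)[OF that] 0 1 in auto)
    show "Re (q z) ^ 2 \<ge> norm z" using \<zeta>(3)[OF that] zero_le_power2[of "Im (q z)"] unfolding 1 by linarith
  qed
  have qhol: "q holomorphic_on D"
    unfolding q_def
    by (intro holomorphic_on_csqrt' holomorphic_intros) (use \<zeta>(1) in \<open>fastforce simp: \<zeta>_def complex_nonpos_Reals_iff intro!: holomorphic_intros\<close>)+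
  have zD: "z \<in> D" using z by (simp add: D_def)
  have K: "K \<ge> 0" using re[of 0] norm_ge_zero order_trans by blast
  have main: "norm (f z * exp (- of_real \<delta> * q z ^ 3)) \<le> K" if \<delta>: "\<delta> > 0" for \<delta> :: real
  proof -
    define h where "h = (\<lambda>z. f z * exp (- of_real \<delta> * q z ^ 3))"
    have hb: "norm (h w) \<le> norm (f w)" "norm (h w) \<le> C * exp (B * norm w - \<delta> * sqrt (norm w) ^ 3 / 4)" if w: "w \<in> D" for w
    proof -
      have e: "norm (exp (- of_real \<delta> * q w ^ 3)) = exp (- \<delta> * Re (q w ^ 3))" by simp
      have s: "sqrt (norm w) \<le> Re (q w)" using q[OF w] by (simp add: real_le_lsqrt)
      have "sqrt (norm w) ^ 3 \<le> Re (q w) ^ 3" by (intro power_mono s) auto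
      then have r: "Re (q w ^ 3) \<ge> sqrt (norm w) ^ 3 / 4" using q(1)[OF w] by linarith
      moreover have "sqrt (norm w) ^ 3 \<ge> 0" by simp
      ultimately have "Re (q w ^ 3) \<ge> 0" by linarith
      then have "norm (exp (- of_real \<delta> * q w ^ 3)) \<le> 1" using \<delta> unfolding e by simp
      then show "norm (h w) \<le> norm (f w)" unfolding h_def norm_mult
        by (metis mult.right_neutral mult_left_mono norm_ge_zero)
      have "norm (h w) \<le> C * (exp (B * norm w) * exp (- (\<delta> * sqrt (norm w) ^ 3 / 4)))"
        unfolding h_def norm_mult e mult.assoc[symmetric] using growth[of w] r \<delta> \<open>C > 0\<close>
        by (intro mult_mono) (auto intro!: mult_left_mono)
      then show "norm (h w) \<le> C * exp (B * norm w - \<delta> * sqrt (norm w) ^ 3 / 4)"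
        by (simp flip: exp_add)
    qed
    show ?thesis
    proof (rule field_le_epsilon)
      fix e :: real assume e: "e > 0"
      have "((\<lambda>R. C * exp (B * R - \<delta> * sqrt R ^ 3 / 4)) \<longlongrightarrow> 0) at_top"
        using \<open>\<delta> > 0\<close> by real_asymp
      then have "\<forall>\<^sub>F R in at_top. C * exp (B * R - \<delta> * sqrt R ^ 3 / 4) < e"
        using e by (simp add: order_tendstoD)
      then have "\<forall>\<^sub>F R in at_top. C * exp (B * R - \<delta> * sqrt R ^ 3 / 4) < e \<and> R > norm z + 1"
        using eventually_gt_at_top by (rule eventually_conj)
      then obtain R where R: "C * exp (B * R - \<delta> * sqrt R ^ 3 / 4) < e" "R > norm z + 1"
        by (auto simp: eventually_at_top_linorder)
      define S where "S = D \<inter> cball 0 R"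
      have cD: "closed D" unfolding D_def
        by (intro closed_Collect_conj closed_Collect_le continuous_intros)
      then have cS: "closed S" by (simp add: S_def closed_Int)
      have hholD: "h holomorphic_on D"
        unfolding h_def using holomorphic_on_subset[OF hol] qhol by (intro holomorphic_intros) auto
      have "norm (h z) \<le> K + e"
      proof (rule maximum_modulus_frontier[where f = h and S = S])
        have "interior S \<subseteq> D" using interior_subset by (auto simp: S_def)
        then show "h holomorphic_on interior S" using hholD holomorphic_on_subset by blast
        have "closure S \<subseteq> D" using cS by (auto simp: S_def)
        then show "continuous_on (closure S) h"
          using hholD holomorphic_on_imp_continuous_on continuous_on_subset by blast
        show "bounded S" by (simp add: S_def bounded_Int)
        show "z \<in> S" using zD R by (auto simp: S_def)
        fix w assume w: "w \<in> frontier S"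
        have wS: "w \<in> D" "norm w \<le> R" using subsetD[OF frontier_subset_closed[OF cS] w] by (auto simp: S_def)
        consider "Re w = 0" | "Im w = 0" | "norm w = R" | "Re w > 0" "Im w > 0" "norm w < R"
          using wS by (force simp: D_def)
        then show "norm (h w) \<le> K + e"
        proof cases
          case 1
          then have "w = \<i> * of_real (Im w)" "Im w \<ge> 0" using wS by (auto simp: complex_eq_iff D_def)
          then have "norm (f w) \<le> K" using im by metis
          then show ?thesis using hb(1)[OF wS(1)] e by linarith
        next
          case 2
          then have "w = of_real (Re w)" "Re w \<ge> 0" using wS by (auto simp: complex_eq_iff D_def)
          then have "norm (f w) \<le> K" using re by metis
          then show ?thesis using hb(1)[OF wS(1)] e by linarith
        next
          case 3
          then show ?thesis using hb(2)[OF wS(1)] R K by simp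
        next
          case 4
          have "open ({w. Re w > 0} \<inter> {w. Im w > 0} \<inter> ball 0 R)"
            by (intro open_Int open_halfspace_Re_gt open_halfspace_Im_gt open_ball)
          moreover have "{w. Re w > 0} \<inter> {w. Im w > 0} \<inter> ball 0 R \<subseteq> S"
            by (auto simp: S_def D_def)
          ultimately have "w \<in> interior S" using 4 by (intro interiorI[where T = "{w. Re w > 0} \<inter> {w. Im w > 0} \<inter> ball 0 R"]) auto
          then show ?thesis using w by (simp add: frontier_def)
        qed
      qed
      then show "norm (f z * exp (- of_real \<delta> * q z ^ 3)) \<le> K + e" by (simp add: h_def)
    qed
  qed
  have "((\<lambda>\<delta>::real. norm (f z * exp (- of_real \<delta> * q z ^ 3))) \<longlongrightarrow> norm (f z * exp (- of_real 0 * q z ^ 3))) (at_right 0)"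
    by (intro tendsto_intros)
  then have "norm (f z * exp (- of_real 0 * q z ^ 3)) \<le> K"
    by (rule tendsto_upperbound) (use main in \<open>auto simp: eventually_at_filter\<close>)
  then show ?thesis by simp
qed

text \<open>Division by \<open>1 - \<i> * \<delta> * z\<close>, whose modulus is at least 1 in the
  closed upper half-plane and tends to infinity, makes a bounded function small on large arcs. Only
  the bound on the real line survives as \<delta> tends to 0.\<close>

lemma bounded_half_plane_bound:
  assumes hol: "f holomorphic_on UNIV"
    and bdd: "\<And>z. Im z \<ge> 0 \<Longrightarrow> norm (f z) \<le> L"
    and re: "\<And>x::real. norm (f (of_real x)) \<le> K"
    and z: "Im z \<ge> 0"
  shows "norm (f z) \<le> K"
proof -
  have L: "L \<ge> 0" by (rule order_trans[OF norm_ge_zero bdd[of 0]]) simp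
  have K: "K \<ge> 0" using re[of 0] norm_ge_zero order_trans by blast
  have main: "norm (f z) \<le> (K + e) * norm (1 - \<i> * of_real \<delta> * z)" if \<delta>: "\<delta> > 0" and e: "e > 0" for \<delta> e :: real
  proof -
    define h where "h = (\<lambda>z. f z / (1 - \<i> * of_real \<delta> * z))"
    have den: "norm (1 - \<i> * of_real \<delta> * w) \<ge> 1" "norm (1 - \<i> * of_real \<delta> * w) \<ge> \<delta> * norm w - 1" if "Im w \<ge> 0" for w
    proof -
      have "1 \<le> Re (1 - \<i> * of_real \<delta> * w)" using \<delta> that by simp
      then show "norm (1 - \<i> * of_real \<delta> * w) \<ge> 1" using complex_Re_le_cmod order_trans by blast
      have "norm (\<i> * of_real \<delta> * w) \<le> norm (1 - \<i> * of_real \<delta> * w) + norm (1::complex)"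
        by (metis norm_minus_commute norm_triangle_sub add.commute)
      then show "norm (1 - \<i> * of_real \<delta> * w) \<ge> \<delta> * norm w - 1" using \<delta> by (simp add: norm_mult)
    qed
    define D where "D = {w. Im w \<ge> 0}"
    \<comment> \<open>On the arc of radius \<open>R\<close> the denominator is at least
      \<open>L / e\<close>, so that the quotient there is at most \<open>e\<close>.\<close>
    define R where "R = max (norm z + 1) ((L / e + 1) / \<delta>)"
    have R: "R > norm z" "\<delta> * R - 1 \<ge> L / e" using \<delta> by (auto simp: R_def field_simps max_def)
    have nz: "1 - \<i> * of_real \<delta> * w \<noteq> 0" if "w \<in> D" for w
    proof
      assume "1 - \<i> * of_real \<delta> * w = 0" then show False using den(1)[of w] that by (simp add: D_def)
    qed
    have hhol: "h holomorphic_on D" unfolding h_def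
      by (intro holomorphic_intros holomorphic_on_subset[OF hol]) (use nz in auto)
    define S where "S = D \<inter> cball 0 R"
    have cS: "closed S" unfolding S_def D_def
      by (intro closed_Int closed_cball closed_Collect_le continuous_intros)
    have "norm (h z) \<le> K + e"
    proof (rule maximum_modulus_frontier[where f = h and S = S])
      have "interior S \<subseteq> D" using interior_subset by (auto simp: S_def)
      then show "h holomorphic_on interior S" using hhol holomorphic_on_subset by blast
      have "closure S \<subseteq> D" using cS by (auto simp: S_def)
      then show "continuous_on (closure S) h"
        using hhol holomorphic_on_imp_continuous_on continuous_on_subset by blast
      show "bounded S" by (simp add: S_def bounded_Int)
      show "z \<in> S" using z R by (auto simp: S_def D_def)
      fix w assume w: "w \<in> frontier S"
      have wS: "Im w \<ge> 0" "norm w \<le> R" using subsetD[OF frontier_subset_closed[OF cS] w] by (auto simp: S_def D_def)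
      have hw: "norm (h w) = norm (f w) / norm (1 - \<i> * of_real \<delta> * w)" by (simp add: h_def norm_divide)
      consider "Im w = 0" | "norm w = R" | "Im w > 0" "norm w < R" using wS by force
      then show "norm (h w) \<le> K + e"
      proof cases
        case 1
        then have "w = of_real (Re w)" by (auto simp: complex_eq_iff)
        then have "norm (f w) \<le> K" using re by metis
        moreover have "norm (h w) \<le> norm (f w)" unfolding hw
          using den(1)[OF wS(1)] by (simp add: divide_le_eq mult_le_cancel_left1)
        ultimately show ?thesis using e by linarith
      next
        case 2
        have "norm (f w) \<le> e * (L / e)" using bdd[OF wS(1)] e by simp
        also have "\<dots> \<le> e * norm (1 - \<i> * of_real \<delta> * w)" using den(2)[OF wS(1)] R 2 e by (intro mult_left_mono) auto
        finally have "norm (h w) \<le> e" unfolding hw using den(1)[OF wS(1)] e by (simp add: divide_le_eq)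
        then show ?thesis using K by linarith
      next
        case 3
        have "open ({w. Im w > 0} \<inter> ball 0 R)"
          by (intro open_Int open_halfspace_Im_gt open_ball)
        moreover have "{w. Im w > 0} \<inter> ball 0 R \<subseteq> S" by (auto simp: S_def D_def)
        ultimately have "w \<in> interior S" using 3 by (intro interiorI[where T = "{w. Im w > 0} \<inter> ball 0 R"]) auto
        then show ?thesis using w by (simp add: frontier_def)
      qed
    qed
    moreover have "norm (1 - \<i> * of_real \<delta> * z) > 0" using den(1)[OF z] by linarith
    ultimately show ?thesis unfolding h_def norm_divide by (simp only: pos_divide_le_eq)
  qed
  have m2: "norm (f z) \<le> K * norm (1 - \<i> * of_real \<delta> * z)" if \<delta>: "\<delta> > 0" for \<delta> :: real
  proof -
    have "((\<lambda>e. (K + e) * norm (1 - \<i> * of_real \<delta> * z)) \<longlongrightarrow> (K + 0) * norm (1 - \<i> * of_real \<delta> * z)) (at_right 0)"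
      by (intro tendsto_intros)
    then have "norm (f z) \<le> (K + 0) * norm (1 - \<i> * of_real \<delta> * z)"
      by (rule tendsto_lowerbound) (use main[OF \<delta>] in \<open>auto simp: eventually_at_filter\<close>)
    then show ?thesis by simp
  qed
  have "((\<lambda>\<delta>::real. K * norm (1 - \<i> * of_real \<delta> * z)) \<longlongrightarrow> K * norm (1 - \<i> * of_real 0 * z)) (at_right 0)"
    by (intro tendsto_intros)
  then have "norm (f z) \<le> K * norm (1 - \<i> * of_real 0 * z)"
    by (rule tendsto_lowerbound) (use m2 in \<open>auto simp: eventually_at_filter\<close>)
  then show ?thesis by simp
qed

lemma norm_exp_mult_i: "norm (exp (\<i> * of_real B * z)) = exp (- B * Im z)"
  by simp

text \<open>Multiplication by \<open>exp (\<i> * B * z)\<close> cancels the growth along the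
  positive imaginary axis and leaves the real axis untouched. The two quadrants then give
  boundedness by some \<open>L\<close> that still depends on \<open>C\<close>; a second application
  of the maximum principle, now in the half-plane, replaces \<open>L\<close> by
  \<open>K\<close>.\<close>

lemma phragmen_lindelof_half_plane:
  assumes hol: "f holomorphic_on UNIV"
    and growth: "\<And>z. norm (f z) \<le> C * exp (B * norm z)" and "B \<ge> 0"
    and re: "\<And>x::real. norm (f (of_real x)) \<le> K"
    and z: "Im z \<ge> 0"
  shows "norm (f z) \<le> K * exp (B * Im z)"
proof -
  define C' where "C' = max C 1"
  have gr: "norm (f z) \<le> C' * exp (B * norm z)" for z
    by (rule order_trans[OF growth]) (auto simp: C'_def intro!: mult_right_mono)
  define g where "g = (\<lambda>z. f z * exp (\<i> * of_real B * z))"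
  have ng: "norm (g z) = norm (f z) * exp (- B * Im z)" for z
    unfolding g_def norm_mult norm_exp_mult_i ..
  have ghol: "g holomorphic_on UNIV" unfolding g_def by (intro holomorphic_intros hol)
  have ggr: "norm (g z) \<le> C' * exp (2 * B * norm z)" for z
  proof -
    have "B * (- Im z) \<le> B * norm z"
      using \<open>B \<ge> 0\<close> abs_Im_le_cmod[of z] by (intro mult_left_mono) linarith+
    then have "exp (- B * Im z) \<le> exp (B * norm z)" by simp
    then have "norm (g z) \<le> C' * exp (B * norm z) * exp (B * norm z)" unfolding ng
      using gr[of z] by (intro mult_mono) (auto simp: C'_def)
    also have "\<dots> = C' * exp (2 * B * norm z)"
      by (simp add: mult.assoc flip: exp_add)
    finally show ?thesis .
  qed
  have gre: "norm (g (of_real x)) \<le> K" for x :: real using re[of x] by (simp add: ng)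
  have gim: "norm (g (\<i> * of_real y)) \<le> C'" if "y \<ge> 0" for y :: real
  proof -
    have "norm (g (\<i> * of_real y)) \<le> C' * exp (B * y) * exp (- B * y)"
      unfolding ng using gr[of "\<i> * of_real y"] that by (intro mult_mono) (auto simp: norm_mult C'_def)
    then show ?thesis by (simp add: exp_minus mult.assoc)
  qed
  define L where "L = max K C'"
  have q1: "norm (g w) \<le> L" if "Re w \<ge> 0" "Im w \<ge> 0" for w
    by (rule phragmen_lindelof_quadrant[OF ghol ggr _ _ _ _ that])
      (use gre gim \<open>B \<ge> 0\<close> in \<open>auto simp: L_def C'_def le_max_iff_disj\<close>)
  have q2: "norm (g w) \<le> L" if "Re w \<le> 0" "Im w \<ge> 0" for w
  proof -
    have "norm (g (\<i> * (- \<i> * w))) \<le> L"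
    proof (rule phragmen_lindelof_quadrant[where f = "\<lambda>w. g (\<i> * w)" and C = C' and B = "2 * B"])
      show "(\<lambda>w. g (\<i> * w)) holomorphic_on UNIV"
        by (rule holomorphic_on_compose[of "\<lambda>w. \<i> * w" UNIV g, unfolded o_def])
          (auto intro!: holomorphic_intros holomorphic_on_subset[OF ghol])
      show "norm (g (\<i> * w)) \<le> C' * exp (2 * B * norm w)" for w
        using ggr[of "\<i> * w"] by (simp add: norm_mult)
      show "norm (g (\<i> * of_real x)) \<le> L" if "x \<ge> 0" for x :: real using gim[OF that] by (simp add: L_def)
      show "norm (g (\<i> * (\<i> * of_real y))) \<le> L" if "y \<ge> 0" for y :: real
        using gre[of "- y"] by (simp add: L_def mult.assoc[symmetric])
    qed (use \<open>B \<ge> 0\<close> that in \<open>auto simp: C'_def\<close>)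
    then show ?thesis by (simp add: mult.assoc[symmetric])
  qed
  have "norm (g w) \<le> L" if "Im w \<ge> 0" for w using q1[of w] q2[of w] that by linarith
  then have "norm (g z) \<le> K" using bounded_half_plane_bound[OF ghol _ gre z] by blast
  then show ?thesis by (simp add: ng exp_minus field_simps)
qed

text \<open>The constant belonging to \<open>\<tau> + \<epsilon>\<close> is of no control as
  \<epsilon> shrinks, but it does not enter the half-plane bound, so \<epsilon> can be sent to 0
  with \<open>K\<close> fixed. The lower half-plane follows by the reflection through the
  origin.\<close>

lemma exp_type_bound_horizontal:
  assumes hol: "f holomorphic_on UNIV"
    and type: "exp_type_at_most \<tau> f" and "\<tau> \<ge> 0"
    and re: "\<And>x::real. norm (f (of_real x)) \<le> K"
  shows "norm (f z) \<le> K * exp (\<tau> * \<bar>Im z\<bar>)"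
proof -
  have K: "K \<ge> 0" using re[of 0] norm_ge_zero order_trans by blast
  have main: "norm (f z) \<le> K * exp ((\<tau> + \<epsilon>) * \<bar>Im z\<bar>)" if \<epsilon>: "\<epsilon> > 0" for \<epsilon>
  proof -
    obtain C where C: "\<And>z. norm (f z) \<le> C * exp ((\<tau> + \<epsilon>) * norm z)"
      using type \<epsilon> unfolding exp_type_at_most_def by blast
    show ?thesis
    proof (cases "Im z \<ge> 0")
      case True
      then show ?thesis
        using phragmen_lindelof_half_plane[OF hol C _ re True] \<open>\<tau> \<ge> 0\<close> \<epsilon> by simp
    next
      case False
      have "norm (f (- (- z))) \<le> K * exp ((\<tau> + \<epsilon>) * Im (- z))"
      proof (rule phragmen_lindelof_half_plane[where f = "\<lambda>z. f (- z)" and C = C])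
        show "(\<lambda>z. f (- z)) holomorphic_on UNIV"
          by (rule holomorphic_on_compose[of uminus UNIV f, unfolded o_def])
            (auto intro!: holomorphic_intros holomorphic_on_subset[OF hol])
        show "norm (f (- z)) \<le> C * exp ((\<tau> + \<epsilon>) * norm z)" for z using C[of "- z"] by simp
        show "norm (f (- of_real x)) \<le> K" for x using re[of "- x"] by simp
      qed (use False \<open>\<tau> \<ge> 0\<close> \<epsilon> in auto)
      then show ?thesis using False by simp
    qed
  qed
  have "((\<lambda>\<epsilon>. K * exp ((\<tau> + \<epsilon>) * \<bar>Im z\<bar>)) \<longlongrightarrow> K * exp ((\<tau> + 0) * \<bar>Im z\<bar>)) (at_right 0)"
    by (intro tendsto_intros)
  then have "norm (f z) \<le> K * exp ((\<tau> + 0) * \<bar>Im z\<bar>)"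
    by (rule tendsto_lowerbound) (use main in \<open>auto simp: eventually_at_filter\<close>)
  then show ?thesis by simp
qed

section \<open>Integrable functions of exponential type\<close>

lemma linepath_has_contour_integral_horizontal:
  assumes "a < b" "((\<lambda>x. f (of_real x + \<i> * of_real y)) has_integral I) {a..b}"
  shows "(f has_contour_integral I) (linepath (Complex a y) (Complex b y))"
proof -
  have e: "f (linepath (Complex a y) (Complex b y) x) * (Complex b y - Complex a y)
     = of_real (b - a) * f (linepath (of_real a) (of_real b) x + \<i> * of_real y)" for x
    by (simp add: linepath_def complex_eq_iff scaleR_conv_of_real Complex_eq algebra_simps)
  have "((\<lambda>z. f (z + \<i> * of_real y)) has_contour_integral I) (linepath (of_real a) (of_real b))"
    using assms by (subst has_contour_integral_linepath_Reals_iff) auto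
  then show ?thesis
    unfolding has_contour_integral_linepath e by (simp add: mult.commute)
qed

text \<open>The vertical sides have fixed length and the integrand on them is at most
  \<open>v n\<close>, so only the horizontal integrals remain. The widths form a sequence in order
  that they can later be placed between the poles of the cotangent.\<close>

lemma contour_integral_rectpath_tendsto:
  fixes f :: "complex \<Rightarrow> complex" and R v :: "nat \<Rightarrow> real"
  assumes y: "y1 < y2" and R: "filterlim R at_top sequentially" "\<And>n. R n > 0"
    and cont: "\<And>n. continuous_on (path_image (rectpath (Complex (- R n) y1) (Complex (R n) y2))) f"
    and int1: "integrable lborel (\<lambda>x. f (of_real x + \<i> * of_real y1))"
    and int2: "integrable lborel (\<lambda>x. f (of_real x + \<i> * of_real y2))"
    and vert: "\<And>n y. y1 \<le> y \<Longrightarrow> y \<le> y2 \<Longrightarrow> norm (f (of_real (R n) + \<i> * of_real y)) \<le> v n"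
      "\<And>n y. y1 \<le> y \<Longrightarrow> y \<le> y2 \<Longrightarrow> norm (f (- of_real (R n) + \<i> * of_real y)) \<le> v n"
    and v: "v \<longlonglongrightarrow> 0"
  shows "(\<lambda>n. contour_integral (rectpath (Complex (- R n) y1) (Complex (R n) y2)) f)
    \<longlonglongrightarrow> (LINT x|lborel. f (of_real x + \<i> * of_real y1)) - (LINT x|lborel. f (of_real x + \<i> * of_real y2))"
proof -
  define T where "T = (\<lambda>y n. contour_integral (linepath (Complex (- R n) y) (Complex (R n) y)) f)"
  define V where "V = (\<lambda>n. contour_integral (linepath (Complex (R n) y1) (Complex (R n) y2)) f)"
  define W where "W = (\<lambda>n. contour_integral (linepath (Complex (- R n) y2) (Complex (- R n) y1)) f)"
  have pieces: "contour_integral (rectpath (Complex (- R n) y1) (Complex (R n) y2)) f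
      = T y1 n + V n - T y2 n + W n"
    and intV: "f contour_integrable_on linepath (Complex (R n) y1) (Complex (R n) y2)"
    and intW: "f contour_integrable_on linepath (Complex (- R n) y2) (Complex (- R n) y1)" for n
  proof -
    have pi: "path_image (rectpath (Complex (- R n) y1) (Complex (R n) y2)) =
      closed_segment (Complex (- R n) y1) (Complex (R n) y1) \<union> closed_segment (Complex (R n) y1) (Complex (R n) y2)
      \<union> closed_segment (Complex (R n) y2) (Complex (- R n) y2) \<union> closed_segment (Complex (- R n) y2) (Complex (- R n) y1)"
      by (simp add: rectpath_def Let_def path_image_join Un_assoc)
    have c: "f contour_integrable_on linepath (Complex (- R n) y1) (Complex (R n) y1)"
      "f contour_integrable_on linepath (Complex (R n) y1) (Complex (R n) y2)"
      "f contour_integrable_on linepath (Complex (R n) y2) (Complex (- R n) y2)"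
      "f contour_integrable_on linepath (Complex (- R n) y2) (Complex (- R n) y1)"
      using cont[of n] unfolding pi
      by (auto intro!: contour_integrable_continuous_linepath intro: continuous_on_subset)
    have r: "contour_integral (linepath (Complex (R n) y2) (Complex (- R n) y2)) f = - T y2 n"
      unfolding T_def by (subst contour_integral_reversepath[symmetric]) auto
    show "contour_integral (rectpath (Complex (- R n) y1) (Complex (R n) y2)) f
      = T y1 n + V n - T y2 n + W n"
      using c r unfolding rectpath_def Let_def T_def V_def W_def
      by (simp add: contour_integrable_joinI)
    show "f contour_integrable_on linepath (Complex (R n) y1) (Complex (R n) y2)"
      "f contour_integrable_on linepath (Complex (- R n) y2) (Complex (- R n) y1)" using c by auto
  qed
  have Tlim: "T y \<longlonglongrightarrow> (LINT x|lborel. f (of_real x + \<i> * of_real y))"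
    if int: "integrable lborel (\<lambda>x. f (of_real x + \<i> * of_real y))" for y
  proof -
    have "T y n = (LINT x|lborel. indicator {- R n..R n} x *\<^sub>R f (of_real x + \<i> * of_real y))" for n
    proof -
      have s: "set_integrable lborel {- R n..R n} (\<lambda>x. f (of_real x + \<i> * of_real y))"
        unfolding set_integrable_def by (intro integrable_mult_indicator int) auto
      have "((\<lambda>x. f (of_real x + \<i> * of_real y)) has_integral
          (LINT x:{- R n..R n}|lborel. f (of_real x + \<i> * of_real y))) {- R n..R n}"
        using set_borel_integral_eq_integral[OF s] by (simp add: has_integral_iff)
      then show ?thesis using R(2)[of n] unfolding T_def set_lebesgue_integral_def
        by (intro contour_integral_unique linepath_has_contour_integral_horizontal) auto
    qed
    moreover have "(\<lambda>n. LINT x|lborel. indicator {- R n..R n} x *\<^sub>R f (of_real x + \<i> * of_real y))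
       \<longlonglongrightarrow> (LINT x|lborel. f (of_real x + \<i> * of_real y))"
    proof (rule integral_dominated_convergence[where w = "\<lambda>x. norm (f (of_real x + \<i> * of_real y))"])
      show "(\<lambda>x. indicator {- R n..R n} x *\<^sub>R f (of_real x + \<i> * of_real y)) \<in> borel_measurable lborel" for n
        using borel_measurable_integrable[OF int] by measurable
      show "AE x in lborel. (\<lambda>n. indicator {- R n..R n} x *\<^sub>R f (of_real x + \<i> * of_real y))
          \<longlonglongrightarrow> f (of_real x + \<i> * of_real y)"
      proof (rule AE_I2)
        fix x :: real
        have "\<forall>\<^sub>F n in sequentially. R n \<ge> \<bar>x\<bar>" using R(1) by (auto simp: filterlim_at_top)
        then have "\<forall>\<^sub>F n in sequentially. f (of_real x + \<i> * of_real y) = indicator {- R n..R n} x *\<^sub>R f (of_real x + \<i> * of_real y)"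
          by eventually_elim (auto simp: indicator_def)
        then show "(\<lambda>n. indicator {- R n..R n} x *\<^sub>R f (of_real x + \<i> * of_real y))
          \<longlonglongrightarrow> f (of_real x + \<i> * of_real y)" by (rule Lim_transform_eventually[rotated]) simp
      qed
    qed (use int in \<open>auto simp: indicator_def\<close>)
    ultimately have "(\<lambda>n. T y n) \<longlonglongrightarrow> (LINT x|lborel. f (of_real x + \<i> * of_real y))" by presburger
    then show ?thesis .
  qed
  have v0: "v n \<ge> 0" for n using vert(1)[of y1 n] y norm_ge_zero order_trans by (meson order_refl less_imp_le)
  have V: "norm (V n) \<le> v n * (y2 - y1)" "norm (W n) \<le> v n * (y2 - y1)" for n
  proof -
    have 1: "norm (Complex (R n) y2 - Complex (R n) y1) = y2 - y1"
      "norm (Complex (- R n) y1 - Complex (- R n) y2) = y2 - y1"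
      using y by (simp_all add: cmod_def)
    have "norm (f x) \<le> v n" if "x \<in> closed_segment (Complex (R n) y1) (Complex (R n) y2)" for x
    proof -
      have "x = of_real (R n) + \<i> * of_real (Im x)" "y1 \<le> Im x" "Im x \<le> y2"
        using that y by (auto simp: closed_segment_same_Re complex_eq_iff closed_segment_eq_real_ivl)
      then show ?thesis using vert(1)[of "Im x" n] by metis
    qed
    from contour_integral_bound_linepath[OF intV[of n] v0[of n] this]
    show "norm (V n) \<le> v n * (y2 - y1)" by (simp add: 1 V_def)
    have "norm (f x) \<le> v n" if "x \<in> closed_segment (Complex (- R n) y2) (Complex (- R n) y1)" for x
    proof -
      have "x = - of_real (R n) + \<i> * of_real (Im x)" "y1 \<le> Im x" "Im x \<le> y2"
        using that y by (auto simp: closed_segment_same_Re complex_eq_iff closed_segment_eq_real_ivl)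
      then show ?thesis using vert(2)[of "Im x" n] by metis
    qed
    from contour_integral_bound_linepath[OF intW[of n] v0[of n] this]
    show "norm (W n) \<le> v n * (y2 - y1)" by (simp add: 1 W_def)
  qed
  have v': "(\<lambda>n. v n * (y2 - y1)) \<longlonglongrightarrow> 0" using v by (auto intro: tendsto_eq_intros)
  have "V \<longlonglongrightarrow> 0" "W \<longlonglongrightarrow> 0"
    using V by (auto intro: Lim_null_comparison[OF _ v'])
  then have "(\<lambda>n. T y1 n + V n - T y2 n + W n) \<longlonglongrightarrow>
     (LINT x|lborel. f (of_real x + \<i> * of_real y1)) + 0 - (LINT x|lborel. f (of_real x + \<i> * of_real y2)) + 0"
    by (intro tendsto_intros Tlim int1 int2)
  then show ?thesis unfolding pieces by simp
qed

text \<open>The Paley-Wiener class of integrable functions. Integrability is asked for on the real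
  axis alone, since this is all that is known about the difference of a competitor and the extremal
  function.\<close>

locale exp_type_L1 =
  fixes G :: "complex \<Rightarrow> complex" and \<tau> :: real
  assumes hol: "G holomorphic_on UNIV"
    and type: "exp_type_at_most \<tau> G" and \<tau>: "\<tau> \<ge> 0"
    and integrable_real: "integrable lborel (\<lambda>x. G (of_real x))"
begin

definition "K = (LINT x|lborel. norm (G (of_real x)))"

lemma K_nonneg: "K \<ge> 0" unfolding K_def by (intro integral_nonneg_AE) auto

lemma cont: "continuous_on A G"
  using holomorphic_on_imp_continuous_on[OF hol] continuous_on_subset by blast

lemma cont_line: "continuous_on A (\<lambda>x::real. G (of_real x + c))"
  by (rule continuous_on_compose2[OF cont[of UNIV]]) (auto intro!: continuous_intros)

lemma meas_line[measurable]: "(\<lambda>x::real. G (of_real x + c)) \<in> borel_measurable borel"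
  by (rule borel_measurable_continuous_onI[OF cont_line])

text \<open>Boundedness of \<open>G\<close> on the real line is not yet available. A windowed
  average of its translates against a bounded weight has the same type and is bounded on the real
  line by the L1 norm \<open>K\<close>, so the Phragmen-Lindeloef bound applies to it. Neither
  \<phi> nor \<open>R\<close> enters the result.\<close>

lemma smoothed_bound:
  assumes \<phi>: "continuous_on UNIV \<phi>" "\<And>s. norm (\<phi> s) \<le> 1" and R: "R \<ge> 0"
  shows "norm (LINT s|lborel. indicator {-R..R} s *\<^sub>R (G (z + of_real s) * \<phi> s)) \<le> K * exp (\<tau> * \<bar>Im z\<bar>)"
proof -
  define F where "F = (\<lambda>z. LINT s|lborel. indicator {-R..R} s *\<^sub>R (G (z + of_real s) * \<phi> s))"
  have [measurable]: "\<phi> \<in> borel_measurable borel" using \<phi>(1) by (rule borel_measurable_continuous_onI)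
  have meas[measurable]: "(\<lambda>s. indicator {-R..R} s *\<^sub>R (G (z + of_real s) * \<phi> s)) \<in> borel_measurable borel" for z
    using meas_line[of z] by (simp add: add.commute)
  have bnd: "norm (indicator {-R..R} s *\<^sub>R (G (z + of_real s) * \<phi> s)) \<le>
      indicator {-R..R} s * (C * exp (B * (norm z + R)))"
    if C: "\<And>z. norm (G z) \<le> C * exp (B * norm z)" and B: "B \<ge> 0" for C B z s
  proof (cases "s \<in> {-R..R}")
    case True
    have C0: "C \<ge> 0" using order_trans[OF norm_ge_zero C[of 0]] by simp
    have "norm (G (z + of_real s) * \<phi> s) \<le> norm (G (z + of_real s)) * 1"
      unfolding norm_mult by (intro mult_left_mono \<phi>) auto
    also have "\<dots> \<le> C * exp (B * norm (z + of_real s))" using C by simp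
    also have "norm (z + of_real s) \<le> norm z + R"
      using True norm_triangle_ineq[of z "of_real s"] by (auto simp: abs_le_iff)
    then have "C * exp (B * norm (z + of_real s)) \<le> C * exp (B * (norm z + R))"
      using C0 B by (intro mult_left_mono) (auto intro: mult_left_mono)
    finally show ?thesis using True by simp
  qed auto
  have intI: "integrable lborel (\<lambda>s. indicator {-R..R} s * c)" for c :: real
    using R by (auto intro!: integrable_real_indicator)
  obtain C1 where C1: "\<And>z. norm (G z) \<le> C1 * exp ((\<tau> + 1) * norm z)"
    using type unfolding exp_type_at_most_def by (meson zero_less_one)
  have C10: "C1 \<ge> 0" using order_trans[OF norm_ge_zero C1[of 0]] by simp
  have Fhol: "F holomorphic_on UNIV" unfolding F_def
  proof (rule holomorphic_parametric_integral)
    fix s :: real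
    show "(\<lambda>z. indicator {-R..R} s *\<^sub>R (G (z + of_real s) * \<phi> s)) holomorphic_on UNIV"
      unfolding scaleR_conv_of_real
      by (intro holomorphic_intros holomorphic_on_compose[of "\<lambda>z. z + of_real s" UNIV G, unfolded o_def]
        holomorphic_on_subset[OF hol]) auto
  next
    fix z :: complex
    show "\<exists>r>0. \<exists>g. integrable lborel g \<and> (\<forall>w\<in>UNIV. dist z w < r \<longrightarrow> (\<forall>t\<in>space lborel.
        norm (indicator {-R..R} t *\<^sub>R (G (w + of_real t) * \<phi> t)) \<le> g t))"
    proof (intro exI[of _ 1] conjI exI[of _ "\<lambda>s. indicator {-R..R} s * (C1 * exp ((\<tau>+1) * (norm z + 1 + R)))"] ballI impI)
      fix w s assume "dist z w < 1"
      then have "norm w \<le> norm z + 1" using norm_triangle_ineq2[of w z] by (simp add: dist_norm norm_minus_commute)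
      then have "C1 * exp ((\<tau>+1) * (norm w + R)) \<le> C1 * exp ((\<tau>+1) * (norm z + 1 + R))"
        using C10 \<tau> by (intro mult_left_mono) auto
      then have "indicator {-R..R} s * (C1 * exp ((\<tau>+1) * (norm w + R))) \<le> indicator {-R..R} s * (C1 * exp ((\<tau>+1) * (norm z + 1 + R)))"
        by (rule mult_left_mono) auto
      with bnd[OF C1, of s w] \<tau>
      show "norm (indicator {-R..R} s *\<^sub>R (G (w + of_real s) * \<phi> s)) \<le> indicator {-R..R} s * (C1 * exp ((\<tau>+1) * (norm z + 1 + R)))"
        by linarith
    next
      show "integrable lborel (\<lambda>s. indicator {-R..R} s * (C1 * exp ((\<tau>+1) * (norm z + 1 + R))))" by (rule intI)
    qed auto
  qed auto
  have Ftype: "exp_type_at_most \<tau> F" unfolding exp_type_at_most_def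
  proof (intro allI impI)
    fix \<epsilon> :: real assume \<epsilon>: "\<epsilon> > 0"
    obtain C where C: "\<And>z. norm (G z) \<le> C * exp ((\<tau> + \<epsilon>) * norm z)"
      using type \<epsilon> unfolding exp_type_at_most_def by blast
    show "\<exists>C. \<forall>z. norm (F z) \<le> C * exp ((\<tau> + \<epsilon>) * norm z)"
    proof (intro exI allI)
      fix z
      have "norm (F z) \<le> (LINT s|lborel. norm (indicator {-R..R} s *\<^sub>R (G (z + of_real s) * \<phi> s)))"
        unfolding F_def by (rule integral_norm_bound)
      also have "\<dots> \<le> (LINT s|lborel. indicator {-R..R} s * (C * exp ((\<tau>+\<epsilon>) * (norm z + R))))"
        using bnd[OF C] \<tau> \<epsilon> order_trans[OF norm_ge_zero bnd[OF C]] by (intro integral_mono' intI) auto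
      also have "\<dots> = 2 * R * (C * exp ((\<tau>+\<epsilon>) * (norm z + R)))" using R by simp
      also have "\<dots> = (2 * R * C * exp ((\<tau>+\<epsilon>) * R)) * exp ((\<tau>+\<epsilon>) * norm z)"
        by (simp add: distrib_left exp_add)
      finally show "norm (F z) \<le> (2 * R * C * exp ((\<tau>+\<epsilon>) * R)) * exp ((\<tau>+\<epsilon>) * norm z)" .
    qed
  qed
  have Freal: "norm (F (of_real x)) \<le> K" for x
  proof -
    have tr: "integrable lborel (\<lambda>s. norm (G (of_real (x + 1 * s))))"
      using lborel_integrable_real_affine[of "\<lambda>s. norm (G (of_real s))" 1 x] integrable_real by simp
    have "norm (F (of_real x)) \<le> (LINT s|lborel. norm (indicator {-R..R} s *\<^sub>R (G (of_real x + of_real s) * \<phi> s)))"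
      unfolding F_def by (rule integral_norm_bound)
    also have "\<dots> \<le> (LINT s|lborel. norm (G (of_real (x + 1 * s))))"
    proof (intro integral_mono' tr)
      fix s :: real
      have "norm (G (of_real x + of_real s) * \<phi> s) \<le> norm (G (of_real x + of_real s)) * 1"
        unfolding norm_mult by (intro mult_left_mono \<phi>) auto
      then show "norm (indicator {-R..R} s *\<^sub>R (G (of_real x + of_real s) * \<phi> s)) \<le> norm (G (of_real (x + 1 * s)))"
        by (auto simp: indicator_def)
    qed auto
    also have "\<dots> = K" unfolding K_def
      using lborel_integral_real_affine[of 1 "\<lambda>s. norm (G (of_real s))" x] by simp
    finally show ?thesis .
  qed
  show ?thesis using exp_type_bound_horizontal[OF Fhol Ftype \<tau> Freal] unfolding F_def .
qed

text \<open>Testing against a unimodular multiplier of the function itself turns the pointwise bound of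
  Phragmen--Lindeloef into the Plancherel--Polya inequality.\<close>

lemma plancherel_polya:
  shows integrable_line: "integrable lborel (\<lambda>x. G (of_real x + \<i> * of_real y))"
    and norm_line_le: "(LINT x|lborel. norm (G (of_real x + \<i> * of_real y))) \<le> K * exp (\<tau> * \<bar>y\<bar>)"
proof -
  define g where "g = (\<lambda>s::real. G (of_real s + \<i> * of_real y))"
  have gc: "continuous_on A g" for A unfolding g_def by (rule cont_line)
  have gm[measurable]: "g \<in> borel_measurable borel" unfolding g_def by (rule meas_line)
  have gi: "integrable lborel (\<lambda>s. indicator {-R..R} s * norm (g s))" for R
    using borel_integrable_compact[of "{-R..R}" "\<lambda>s. norm (g s)"] gc
    by (auto intro: continuous_intros)
  have step: "(LINT s|lborel. indicator {-R..R} s * norm (g s)) \<le> K * exp (\<tau> * \<bar>y\<bar>)"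
    if R: "R \<ge> 0" for R
  proof (rule field_le_epsilon)
    fix e :: real assume e: "e > 0"
    \<comment> \<open>The weight that would produce the modulus is the conjugate of \<open>g\<close>
      divided by its norm, which breaks down at zeros of \<open>g\<close>. Adding \<open>d\<close>
      to the denominator keeps it continuous and costs at most \<open>d\<close> per unit of length,
      hence at most \<open>e\<close> on the window.\<close>
    define d where "d = e / (2 * R + 1)"
    have d: "d > 0" "2 * R * d \<le> e" using R e by (auto simp: d_def field_simps)
    define \<phi> where "\<phi> = (\<lambda>s. cnj (g s) / (norm (g s) + d))"
    have dn: "norm (g s) + d > 0" for s using d norm_ge_zero[of "g s"] by linarith
    have dn': "complex_of_real (norm (g s)) + of_real d \<noteq> 0" for s
      using dn[of s] by (metis of_real_add of_real_eq_0_iff less_irrefl)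
    have n\<phi>: "norm (\<phi> s) \<le> 1" for s
    proof -
      have "norm (\<phi> s) = norm (g s) / (norm (g s) + d)" using dn[of s]
        by (simp add: \<phi>_def norm_divide flip: of_real_add)
      then show ?thesis using dn[of s] d by (simp only: divide_le_eq_1_pos)
    qed
    have c\<phi>: "continuous_on UNIV \<phi>" unfolding \<phi>_def using dn' gc by (auto intro!: continuous_intros)
    define h where "h = (\<lambda>s. indicator {-R..R} s * ((norm (g s))\<^sup>2 / (norm (g s) + d)))"
    have hb: "h s \<le> indicator {-R..R} s * norm (g s)" "h s \<ge> 0"
        "indicator {-R..R} s * norm (g s) - indicator {-R..R} s * d \<le> h s" for s
    proof -
      have "(norm (g s))\<^sup>2 / (norm (g s) + d) \<le> norm (g s)" "norm (g s) - d \<le> (norm (g s))\<^sup>2 / (norm (g s) + d)"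
        using dn[of s] d by (auto simp: field_simps power2_eq_square)
      then show "h s \<le> indicator {-R..R} s * norm (g s)" "indicator {-R..R} s * norm (g s) - indicator {-R..R} s * d \<le> h s"
        unfolding h_def by (auto simp: indicator_def)
      show "h s \<ge> 0" unfolding h_def using dn[of s] by auto
    qed
    have hi: "integrable lborel h"
    proof (rule Bochner_Integration.integrable_bound[OF gi[of R]])
      show "AE s in lborel. norm (h s) \<le> norm (indicator {-R..R} s * norm (g s))"
        using hb by (intro AE_I2) (metis abs_of_nonneg order_trans real_norm_def)
    qed (auto simp: h_def)
    have eq: "indicator {-R..R} s *\<^sub>R (G (\<i> * of_real y + of_real s) * \<phi> s) = of_real (h s)" for s
    proof -
      have "g s * cnj (g s) = of_real ((norm (g s))\<^sup>2)" using complex_norm_square[of "g s"] by simp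
      then have "g s * \<phi> s = of_real ((norm (g s))\<^sup>2 / (norm (g s) + d))" by (simp add: \<phi>_def)
      moreover have "G (\<i> * of_real y + of_real s) = g s" by (simp add: g_def add.commute)
      ultimately show ?thesis unfolding h_def scaleR_conv_of_real of_real_mult by simp
    qed
    have "norm (LINT s|lborel. complex_of_real (h s)) \<le> K * exp (\<tau> * \<bar>Im (\<i> * of_real y)\<bar>)"
      using smoothed_bound[OF c\<phi> n\<phi> R, of "\<i> * of_real y"] unfolding eq .
    then have 1: "(LINT s|lborel. h s) \<le> K * exp (\<tau> * \<bar>y\<bar>)" by simp
    have gid: "integrable lborel (\<lambda>s. indicator {-R..R} s * d)"
      using R by (auto intro!: integrable_real_indicator)
    have "(LINT s|lborel. indicator {-R..R} s * norm (g s) - indicator {-R..R} s * d) \<le> (LINT s|lborel. h s)"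
      by (intro integral_mono hi hb Bochner_Integration.integrable_diff gi gid)
    also have "(LINT s|lborel. indicator {-R..R} s * norm (g s) - indicator {-R..R} s * d)
       = (LINT s|lborel. indicator {-R..R} s * norm (g s)) - 2 * R * d"
      using gi[of R] R gid by (subst Bochner_Integration.integral_diff) auto
    finally show "(LINT s|lborel. indicator {-R..R} s * norm (g s)) \<le> K * exp (\<tau> * \<bar>y\<bar>) + e"
      using 1 d by linarith
  qed
  define X where "X = (\<lambda>n. LINT s|lborel. indicator {-real n..real n} s * norm (g s))"
  have inc: "incseq X" unfolding X_def incseq_def
    by (intro allI impI integral_mono gi mult_right_mono) (auto simp: indicator_def)
  have "\<forall>n. X n \<le> K * exp (\<tau> * \<bar>y\<bar>)" using step by (simp add: X_def)
  then obtain L where L: "X \<longlonglongrightarrow> L" using incseq_convergent[OF inc] by blast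
  have Lle: "L \<le> K * exp (\<tau> * \<bar>y\<bar>)" using L step by (intro LIMSEQ_le_const2[OF L]) (auto simp: X_def)
  have pt: "(\<lambda>n. indicator {-real n..real n} s * norm (g s)) \<longlonglongrightarrow> norm (g s)" for s
  proof -
    have "\<forall>\<^sub>F n in sequentially. real n \<ge> \<bar>s\<bar>" using filterlim_real_sequentially by (auto simp: filterlim_at_top)
    then have "\<forall>\<^sub>F n in sequentially. norm (g s) = indicator {-real n..real n} s * norm (g s)"
      by eventually_elim (auto simp: indicator_def)
    then show ?thesis by (rule Lim_transform_eventually[rotated]) simp
  qed
  have "has_bochner_integral lborel (\<lambda>s. norm (g s)) L"
  proof (rule has_bochner_integral_monotone_convergence[where f = "\<lambda>n s. indicator {-real n..real n} s * norm (g s)"])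
    show "AE x in lborel. mono (\<lambda>n. indicator {-real n..real n} x * norm (g x))"
      by (intro AE_I2 monoI mult_right_mono) (auto simp: indicator_def)
  qed (use gi pt L X_def in auto)
  then have "integrable lborel (\<lambda>s. norm (g s))" "(LINT s|lborel. norm (g s)) = L"
    by (auto simp: has_bochner_integral_iff)
  then show "integrable lborel (\<lambda>x. G (of_real x + \<i> * of_real y))"
    "(LINT x|lborel. norm (G (of_real x + \<i> * of_real y))) \<le> K * exp (\<tau> * \<bar>y\<bar>)"
    using Lle integrable_norm_cancel[of lborel g] by (auto simp: g_def)
qed

end

section \<open>Pointwise bounds and decay in horizontal strips\<close>

context exp_type_L1
begin

text \<open>Cauchy's formula for \<open>G\<close> times a Gaussian that equals 1 at
  \<open>z\<close>. The Gaussian beats the exponential type on the vertical sides, and in the result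
  it localises the two line integrals near \<open>Re z\<close>, which yields decay and not merely
  boundedness. The factor \<open>exp ((b - a)\<^sup>2)\<close> bounds its growth in the imaginary
  direction; the unit distance to both lines disposes of the Cauchy kernel.\<close>

lemma gaussian_cauchy_bound:
  assumes z: "a \<le> Im z - 1" "Im z + 1 \<le> b"
  shows "norm (G z) \<le> exp ((b - a)\<^sup>2) *
    ((LINT u|lborel. norm (G (of_real u + \<i> * of_real a)) * exp (- (u - Re z)\<^sup>2)) +
     (LINT u|lborel. norm (G (of_real u + \<i> * of_real b)) * exp (- (u - Re z)\<^sup>2)))"
proof -
  define h where "h = (\<lambda>w. G w * exp (- (w - z)\<^sup>2))"
  define f where "f = (\<lambda>w. h w / (w - z))"
  define R where "R = (\<lambda>n. \<bar>Re z\<bar> + 1 + real n)"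
  obtain C where C: "\<And>z. norm (G z) \<le> C * exp ((\<tau> + 1) * norm z)"
    using type unfolding exp_type_at_most_def by (meson zero_less_one)
  have C0: "C \<ge> 0" using order_trans[OF norm_ge_zero C[of 0]] by simp
  have nexp: "norm (exp (- (w - z)\<^sup>2)) \<le> exp ((b - a)\<^sup>2) * exp (- (Re w - Re z)\<^sup>2)"
    if "a \<le> Im w" "Im w \<le> b" for w
  proof -
    have "(Im w - Im z)\<^sup>2 \<le> (b - a)\<^sup>2" using that z by (intro abs_le_square_iff[THEN iffD1]) auto
    then show ?thesis by (simp add: power2_eq_square flip: exp_add)
  qed
  have fb: "norm (f w) \<le> norm (G w) * (exp ((b - a)\<^sup>2) * exp (- (Re w - Re z)\<^sup>2))"
    if "a \<le> Im w" "Im w \<le> b" "norm (w - z) \<ge> 1" for w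
  proof -
    have "norm (f w) \<le> norm (h w)" unfolding f_def norm_divide using that(3)
      by (simp add: divide_le_eq mult_le_cancel_left1)
    also have "\<dots> \<le> norm (G w) * (exp ((b - a)\<^sup>2) * exp (- (Re w - Re z)\<^sup>2))"
      unfolding h_def norm_mult by (intro mult_left_mono nexp that) auto
    finally show ?thesis .
  qed
  have line: "norm (of_real u + \<i> * of_real y - z) \<ge> 1" if "\<bar>y - Im z\<bar> \<ge> 1" for u y
    using abs_Im_le_cmod[of "of_real u + \<i> * of_real y - z"] that by simp
  have hline: "integrable lborel (\<lambda>u. norm (G (of_real u + \<i> * of_real y)) * exp (- (u - Re z)\<^sup>2))" for y
    by (rule Bochner_Integration.integrable_bound[OF integrable_line[of y]])
       (auto intro!: AE_I2 mult_left_le)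
  have fi: "integrable lborel (\<lambda>x. f (of_real x + \<i> * of_real y))" and
    fn: "norm (LINT x|lborel. f (of_real x + \<i> * of_real y)) \<le> exp ((b - a)\<^sup>2) *
     (LINT u|lborel. norm (G (of_real u + \<i> * of_real y)) * exp (- (u - Re z)\<^sup>2))"
    if y: "y = a \<or> y = b" for y
  proof -
    have y': "a \<le> y" "y \<le> b" "\<bar>y - Im z\<bar> \<ge> 1" using y z by auto
    have le: "norm (f (of_real x + \<i> * of_real y)) \<le> exp ((b - a)\<^sup>2) * (norm (G (of_real x + \<i> * of_real y)) * exp (- (x - Re z)\<^sup>2))" for x
      using fb[of "of_real x + \<i> * of_real y"] y' line[of y x] by (simp add: mult_ac)
    have m: "(\<lambda>x::real. f (of_real x + \<i> * of_real y)) \<in> borel_measurable lborel"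
      unfolding f_def h_def by measurable
    show "integrable lborel (\<lambda>x. f (of_real x + \<i> * of_real y))"
      by (rule Bochner_Integration.integrable_bound[OF integrable_mult_right[OF hline[of y], of "exp ((b - a)\<^sup>2)"] m])
        (use le in \<open>auto intro!: AE_I2\<close>)
    have "norm (LINT x|lborel. f (of_real x + \<i> * of_real y)) \<le> (LINT x|lborel. norm (f (of_real x + \<i> * of_real y)))"
      by (rule integral_norm_bound)
    also have "\<dots> \<le> (LINT x|lborel. exp ((b - a)\<^sup>2) * (norm (G (of_real x + \<i> * of_real y)) * exp (- (x - Re z)\<^sup>2)))"
      by (intro integral_mono' integrable_mult_right hline le) auto
    finally show "norm (LINT x|lborel. f (of_real x + \<i> * of_real y)) \<le> exp ((b - a)\<^sup>2) *
     (LINT u|lborel. norm (G (of_real u + \<i> * of_real y)) * exp (- (u - Re z)\<^sup>2))" by simp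
  qed
  have hhol: "h holomorphic_on A" for A unfolding h_def
    by (intro holomorphic_intros holomorphic_on_subset[OF hol]) auto
  define v where "v = (\<lambda>n. C * exp ((\<tau> + 1) * (R n + \<bar>a\<bar> + \<bar>b\<bar>)) * (exp ((b - a)\<^sup>2) * exp (- (real n + 1)\<^sup>2)))"
  have zbox: "z \<in> box (Complex (- R n) a) (Complex (R n) b)" for n
    using z by (auto simp: in_box_complex_iff R_def)
  have zni: "z \<notin> path_image (rectpath (Complex (- R n) a) (Complex (R n) b))" for n
    using zbox[of n] z by (subst path_image_rectpath_cbox_minus_box) (auto simp: R_def)
  have "(\<lambda>n. contour_integral (rectpath (Complex (- R n) a) (Complex (R n) b)) f)
    \<longlonglongrightarrow> (LINT x|lborel. f (of_real x + \<i> * of_real a)) - (LINT x|lborel. f (of_real x + \<i> * of_real b))"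
  proof (rule contour_integral_rectpath_tendsto[where v = v])
    show "a < b" using z by simp
    show "filterlim R at_top sequentially" unfolding R_def by real_asymp
    show "R n > 0" for n by (simp add: R_def add_pos_nonneg)
    show "continuous_on (path_image (rectpath (Complex (- R n) a) (Complex (R n) b))) f" for n
      unfolding f_def using zni[of n]
      by (intro continuous_intros holomorphic_on_imp_continuous_on hhol) auto
    show "v \<longlonglongrightarrow> 0"
    proof (rule Lim_null_comparison)
      \<comment> \<open>\<open>D\<close> is chosen so that the linear exponent minus the square is
        at most \<open>D - real n\<close>; the difference of the two sides is then a visible sum of
        nonnegative terms.\<close>
      define c D where "c = \<tau> + 1" and "D = c * (\<bar>Re z\<bar> + 1 + \<bar>a\<bar> + \<bar>b\<bar>) + (c + 1)\<^sup>2"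
      have "c * (R n + \<bar>a\<bar> + \<bar>b\<bar>) - (real n + 1)\<^sup>2 \<le> D - real n" for n
      proof -
        have "D - real n - (c * (R n + \<bar>a\<bar> + \<bar>b\<bar>) - (real n + 1)\<^sup>2) = (real n - c)\<^sup>2 + c * real n + 2 * c + real n + 2"
          by (simp add: D_def R_def power2_eq_square algebra_simps)
        moreover have "\<dots> \<ge> 0" using \<tau> by (intro add_nonneg_nonneg) (auto simp: c_def)
        ultimately show ?thesis by linarith
      qed
      then have "C * exp ((b - a)\<^sup>2) * exp (c * (R n + \<bar>a\<bar> + \<bar>b\<bar>) - (real n + 1)\<^sup>2) \<le> C * exp ((b - a)\<^sup>2) * exp (D - real n)" for n
        using C0 by (intro mult_left_mono) auto
      then have "norm (v n) \<le> (C * exp ((b - a)\<^sup>2) * exp D) * exp (- real n)" for n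
        using C0 by (simp add: v_def c_def exp_diff exp_minus divide_inverse mult_ac abs_mult)
      then show "\<forall>\<^sub>F n in sequentially. norm (v n) \<le> (C * exp ((b - a)\<^sup>2) * exp D) * exp (- real n)" by simp
      have "(\<lambda>n. exp (- real n)) \<longlonglongrightarrow> 0" by real_asymp
      then show "(\<lambda>n. (C * exp ((b - a)\<^sup>2) * exp D) * exp (- real n)) \<longlonglongrightarrow> 0" by (rule tendsto_mult_right_zero)
    qed
    have vv: "norm (f w) \<le> v n" if w: "a \<le> Im w" "Im w \<le> b" "\<bar>Re w\<bar> = R n" for w n
    proof -
      have d: "\<bar>Re w - Re z\<bar> \<ge> real n + 1" using w(3) by (auto simp: R_def)
      then have "norm (w - z) \<ge> 1" using abs_Re_le_cmod[of "w - z"] by simp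
      note fb[OF w(1,2) this]
      also have "norm (G w) * (exp ((b - a)\<^sup>2) * exp (- (Re w - Re z)\<^sup>2)) \<le> v n" unfolding v_def
      proof (intro mult_mono)
        have "norm w \<le> R n + \<bar>a\<bar> + \<bar>b\<bar>" using cmod_le[of w] w by auto
        then have "C * exp ((\<tau> + 1) * norm w) \<le> C * exp ((\<tau> + 1) * (R n + \<bar>a\<bar> + \<bar>b\<bar>))"
          using C0 \<tau> by (intro mult_left_mono) auto
        then show "norm (G w) \<le> C * exp ((\<tau> + 1) * (R n + \<bar>a\<bar> + \<bar>b\<bar>))" using C[of w] by linarith
        have "(real n + 1)\<^sup>2 \<le> (Re w - Re z)\<^sup>2" using d by (intro abs_le_square_iff[THEN iffD1]) auto
        then show "exp (- (Re w - Re z)\<^sup>2) \<le> exp (- (real n + 1)\<^sup>2)" by simp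
      qed (use C0 in auto)
      finally show ?thesis .
    qed
    fix n y assume y: "a \<le> y" "y \<le> b"
    have "R n \<ge> 0" by (simp add: R_def)
    then show "norm (f (of_real (R n) + \<i> * of_real y)) \<le> v n" "norm (f (- of_real (R n) + \<i> * of_real y)) \<le> v n"
      using y by (auto intro!: vv)
  qed (use fi in auto)
  moreover have "contour_integral (rectpath (Complex (- R n) a) (Complex (R n) b)) f = 2 * pi * \<i> * G z" for n
  proof -
    have "((\<lambda>w. h w / (w - z)) has_contour_integral
      (2 * pi * \<i> * winding_number (rectpath (Complex (- R n) a) (Complex (R n) b)) z * h z)) (rectpath (Complex (- R n) a) (Complex (R n) b))"
      by (rule Cauchy_integral_formula_convex_simple[of UNIV]) (use hhol zni in auto)
    then show ?thesis unfolding winding_number_rectpath[OF zbox] f_def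
      by (simp add: h_def contour_integral_unique)
  qed
  ultimately have "2 * pi * \<i> * G z = (LINT x|lborel. f (of_real x + \<i> * of_real a)) - (LINT x|lborel. f (of_real x + \<i> * of_real b))"
    by (simp add: LIMSEQ_const_iff)
  then have "norm (2 * pi * \<i> * G z) \<le> norm (LINT x|lborel. f (of_real x + \<i> * of_real a)) + norm (LINT x|lborel. f (of_real x + \<i> * of_real b))"
    by (metis norm_triangle_ineq4)
  also have "norm (2 * pi * \<i> * G z) = 2 * pi * norm (G z)" by (simp add: norm_mult)
  finally have "2 * pi * norm (G z) \<le> exp ((b - a)\<^sup>2) *
    ((LINT u|lborel. norm (G (of_real u + \<i> * of_real a)) * exp (- (u - Re z)\<^sup>2)) +
     (LINT u|lborel. norm (G (of_real u + \<i> * of_real b)) * exp (- (u - Re z)\<^sup>2)))"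
    using fn[of a] fn[of b] by (simp add: distrib_left)
  moreover have "1 * norm (G z) \<le> (2 * pi) * norm (G z)"
    using pi_gt3 by (intro mult_right_mono) auto
  ultimately show ?thesis by linarith
qed

lemma gaussian_weight_integrable:
  "integrable lborel (\<lambda>u. norm (G (of_real u + \<i> * of_real y)) * exp (- (u - x)\<^sup>2))"
  by (rule Bochner_Integration.integrable_bound[OF integrable_line[of y]])
     (auto intro!: AE_I2 mult_left_le)

lemma gaussian_weight_le:
  "(LINT u|lborel. norm (G (of_real u + \<i> * of_real y)) * exp (- (u - x)\<^sup>2)) \<le> K * exp (\<tau> * \<bar>y\<bar>)"
  by (rule order_trans[OF integral_mono[OF gaussian_weight_integrable integrable_norm[OF integrable_line]] norm_line_le])
     (auto intro!: mult_left_le)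

text \<open>The two lines at distance 1 above and below \<open>z\<close> are at distance 2 from each
  other, whence \<open>exp 4\<close>. The exponent is \<tau> itself, without the loss of \<epsilon>
  in the definition of exponential type, and this sharp form is what division by the squared sine
  requires.\<close>

lemma pointwise_bound: "\<exists>C\<ge>0. \<forall>z. norm (G z) \<le> C * exp (\<tau> * \<bar>Im z\<bar>)"
proof (intro exI[of _ "exp 4 * (2 * K * exp \<tau>)"] conjI allI)
  show "0 \<le> exp 4 * (2 * K * exp \<tau>)" using K_nonneg by simp
  fix z
  have e: "K * exp (\<tau> * \<bar>y\<bar>) \<le> K * (exp \<tau> * exp (\<tau> * \<bar>Im z\<bar>))" if "\<bar>y - Im z\<bar> = 1" for y
  proof -
    have "\<bar>y\<bar> \<le> 1 + \<bar>Im z\<bar>" using that by auto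
    then have "\<tau> * \<bar>y\<bar> \<le> \<tau> + \<tau> * \<bar>Im z\<bar>" using \<tau> mult_left_mono[of "\<bar>y\<bar>" "1 + \<bar>Im z\<bar>" \<tau>] by (simp add: distrib_left)
    then show ?thesis using K_nonneg by (intro mult_left_mono) (auto simp flip: exp_add)
  qed
  have "norm (G z) \<le> exp 4 *
    ((LINT u|lborel. norm (G (of_real u + \<i> * of_real (Im z - 1))) * exp (- (u - Re z)\<^sup>2)) +
     (LINT u|lborel. norm (G (of_real u + \<i> * of_real (Im z + 1))) * exp (- (u - Re z)\<^sup>2)))"
    using gaussian_cauchy_bound[of "Im z - 1" z "Im z + 1"] by simp
  also have "\<dots> \<le> exp 4 * (K * (exp \<tau> * exp (\<tau> * \<bar>Im z\<bar>)) + K * (exp \<tau> * exp (\<tau> * \<bar>Im z\<bar>)))"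
    by (intro mult_left_mono add_mono order_trans[OF gaussian_weight_le] e) auto
  finally show "norm (G z) \<le> exp 4 * (2 * K * exp \<tau>) * exp (\<tau> * \<bar>Im z\<bar>)" by (simp add: algebra_simps)
qed

lemma gaussian_weight_tendsto:
  assumes "filterlim (\<lambda>n. \<bar>R n\<bar>) at_top sequentially"
  shows "(\<lambda>n. LINT u|lborel. norm (G (of_real u + \<i> * of_real y)) * exp (- (u - R n)\<^sup>2)) \<longlonglongrightarrow> 0"
proof -
  have "(\<lambda>n. LINT u|lborel. norm (G (of_real u + \<i> * of_real y)) * exp (- (u - R n)\<^sup>2)) \<longlonglongrightarrow> (LINT (u::real)|lborel. (0::real))"
  proof (rule integral_dominated_convergence[where w = "\<lambda>u. norm (G (of_real u + \<i> * of_real y))"])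
    show "AE u in lborel. (\<lambda>n. norm (G (of_real u + \<i> * of_real y)) * exp (- (u - R n)\<^sup>2)) \<longlonglongrightarrow> 0"
    proof (rule AE_I2)
      fix u :: real
      have "filterlim (\<lambda>n. \<bar>R n\<bar> - \<bar>u\<bar>) at_top sequentially"
        using filterlim_tendsto_add_at_top[OF tendsto_const[of "- \<bar>u\<bar>"] assms] by simp
      then have "filterlim (\<lambda>n. \<bar>u - R n\<bar>) at_top sequentially"
        by (rule filterlim_at_top_mono) (auto intro!: always_eventually)
      then have "filterlim (\<lambda>n. \<bar>u - R n\<bar>\<^sup>2) at_top sequentially"
        by (rule filterlim_pow_at_top[rotated]) auto
      then have "filterlim (\<lambda>n. - (u - R n)\<^sup>2) at_bot sequentially"
        by (simp add: filterlim_uminus_at_top)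
      then have "(\<lambda>n. exp (- (u - R n)\<^sup>2)) \<longlonglongrightarrow> 0"
        by (rule filterlim_compose[OF exp_at_bot])
      then show "(\<lambda>n. norm (G (of_real u + \<i> * of_real y)) * exp (- (u - R n)\<^sup>2)) \<longlonglongrightarrow> 0"
        by (rule tendsto_mult_right_zero)
    qed
    show "integrable lborel (\<lambda>u. norm (G (of_real u + \<i> * of_real y)))" by (intro integrable_norm integrable_line)
  qed (auto intro!: mult_left_le)
  then show ?thesis by simp
qed

text \<open>The lines at heights \<open>a - 1\<close> and \<open>b + 1\<close> serve every point of
  the strip at once, so the decay is uniform in \<open>y\<close>. The weighted integrals vanish in
  the limit because a Gaussian of fixed width moves to infinity across an integrable
  function.\<close>

lemma vertical_decay:
  assumes R: "filterlim R at_top sequentially"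
  shows "\<exists>v. v \<longlonglongrightarrow> 0 \<and> (\<forall>n y. a \<le> y \<longrightarrow> y \<le> b \<longrightarrow>
      norm (G (of_real (R n) + \<i> * of_real y)) \<le> v n \<and> norm (G (- of_real (R n) + \<i> * of_real y)) \<le> v n)"
proof -
  define J where "J = (\<lambda>y x. LINT u|lborel. norm (G (of_real u + \<i> * of_real y)) * exp (- (u - x)\<^sup>2))"
  define E where "E = exp ((b - a + 2)\<^sup>2)"
  define v where "v = (\<lambda>n. E * (J (a - 1) (R n) + J (b + 1) (R n) + J (a - 1) (- R n) + J (b + 1) (- R n)))"
  have J0: "J y x \<ge> 0" for y x unfolding J_def by (intro integral_nonneg_AE) auto
  have A: "filterlim (\<lambda>n. \<bar>R n\<bar>) at_top sequentially"
    by (rule filterlim_at_top_mono[OF R]) (auto intro!: always_eventually)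
  then have lim: "(\<lambda>n. J y (R n)) \<longlonglongrightarrow> 0" "(\<lambda>n. J y (- R n)) \<longlonglongrightarrow> 0" for y
    unfolding J_def by (intro gaussian_weight_tendsto; simp)+
  have "v \<longlonglongrightarrow> E * (0 + 0 + 0 + 0)" unfolding v_def by (intro tendsto_intros lim)
  then have "v \<longlonglongrightarrow> 0" by simp
  moreover have "norm (G z) \<le> v n" if z: "a \<le> Im z" "Im z \<le> b" "Re z = R n \<or> Re z = - R n" for z n
  proof -
    have "norm (G z) \<le> E * (J (a - 1) (Re z) + J (b + 1) (Re z))"
      using gaussian_cauchy_bound[of "a - 1" z "b + 1"] z by (simp add: E_def J_def algebra_simps)
    also have "\<dots> \<le> v n" unfolding v_def using z(3) J0
      by (intro mult_left_mono) (auto simp: E_def add_increasing add_increasing2)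
    finally show ?thesis .
  qed
  ultimately show ?thesis by (intro exI[of _ v]) auto
qed

section \<open>The Fourier transform on horizontal lines and its support\<close>

lemma norm_e2pi: "norm (e2pi (- of_real t * z)) = exp (2 * pi * t * Im z)"
    "norm (e2pi (- (of_real t * z))) = exp (2 * pi * t * Im z)"
  by (simp_all add: e2pi_def)

text \<open>The character is evaluated at the complex point and not at its real part. The integrand
  is thus the restriction of one entire function, and the value does not depend on the line.\<close>

definition "FT t y = (LINT x|lborel. G (of_real x + \<i> * of_real y) * e2pi (- of_real t * (of_real x + \<i> * of_real y)))"

lemma FT_integrable: "integrable lborel (\<lambda>x. G (of_real x + \<i> * of_real y) * e2pi (- of_real t * (of_real x + \<i> * of_real y)))"
proof (rule Bochner_Integration.integrable_bound[OF integrable_mult_left[OF integrable_line[of y], of "of_real (exp (2 * pi * t * y))"]])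
  show "AE x in lborel. norm (G (of_real x + \<i> * of_real y) * e2pi (- of_real t * (of_real x + \<i> * of_real y)))
    \<le> norm (G (of_real x + \<i> * of_real y) * of_real (exp (2 * pi * t * y)))"
    by (intro AE_I2) (simp add: norm_mult norm_e2pi)
  have [measurable]: "e2pi \<in> borel_measurable borel" unfolding e2pi_def by measurable
  show "(\<lambda>x. G (of_real x + \<i> * of_real y) * e2pi (- of_real t * (of_real x + \<i> * of_real y))) \<in> borel_measurable lborel"
    by measurable
qed

lemma FT_bound: "norm (FT t y) \<le> K * exp (\<tau> * \<bar>y\<bar> + 2 * pi * t * y)"
proof -
  have "norm (FT t y) \<le> (LINT x|lborel. norm (G (of_real x + \<i> * of_real y) * e2pi (- of_real t * (of_real x + \<i> * of_real y))))"
    unfolding FT_def by (rule integral_norm_bound)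
  also have "\<dots> = (LINT x|lborel. norm (G (of_real x + \<i> * of_real y))) * exp (2 * pi * t * y)"
    by (simp add: norm_mult norm_e2pi)
  also have "\<dots> \<le> (K * exp (\<tau> * \<bar>y\<bar>)) * exp (2 * pi * t * y)"
    by (intro mult_right_mono norm_line_le) auto
  finally show ?thesis by (simp add: exp_add)
qed

lemma FT_shift_less:
  assumes "y1 < y2"
  shows "FT t y1 = FT t y2"
proof -
  define f where "f = (\<lambda>z. G z * e2pi (- of_real t * z))"
  define R where "R = (\<lambda>n. real n + 1)"
  have fhol: "f holomorphic_on A" for A unfolding f_def e2pi_def
    by (intro holomorphic_intros holomorphic_on_subset[OF hol]) auto
  have R: "filterlim R at_top sequentially" unfolding R_def by real_asymp
  obtain v where v: "v \<longlonglongrightarrow> 0" "\<And>n y. y1 \<le> y \<Longrightarrow> y \<le> y2 \<Longrightarrow> norm (G (of_real (R n) + \<i> * of_real y)) \<le> v n"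
     "\<And>n y. y1 \<le> y \<Longrightarrow> y \<le> y2 \<Longrightarrow> norm (G (- of_real (R n) + \<i> * of_real y)) \<le> v n"
    using vertical_decay[OF R, of y1 y2] assms by auto
  define E where "E = exp (2 * pi * \<bar>t\<bar> * (\<bar>y1\<bar> + \<bar>y2\<bar>))"
  have ne: "norm (e2pi (- of_real t * (x + \<i> * of_real y))) \<le> E" if "y1 \<le> y" "y \<le> y2" "Im x = 0" for x y
  proof -
    have "t * y \<le> \<bar>t\<bar> * \<bar>y\<bar>" using abs_le_D1[of "t * y"] by (simp add: abs_mult)
    also have "\<dots> \<le> \<bar>t\<bar> * (\<bar>y1\<bar> + \<bar>y2\<bar>)" using that by (intro mult_left_mono) auto
    finally show ?thesis using that(3) mult_left_mono[of "t * y" _ "2 * pi"]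
      by (simp add: norm_e2pi E_def mult.assoc)
  qed
  have "(\<lambda>n. contour_integral (rectpath (Complex (- R n) y1) (Complex (R n) y2)) f)
    \<longlonglongrightarrow> (LINT x|lborel. f (of_real x + \<i> * of_real y1)) - (LINT x|lborel. f (of_real x + \<i> * of_real y2))"
  proof (rule contour_integral_rectpath_tendsto[OF assms R, where v = "\<lambda>n. v n * E"])
    show "(\<lambda>n. v n * E) \<longlonglongrightarrow> 0" using v(1) by (rule tendsto_mult_left_zero)
    show "norm (f (of_real (R n) + \<i> * of_real y)) \<le> v n * E"
      "norm (f (- of_real (R n) + \<i> * of_real y)) \<le> v n * E" if y: "y1 \<le> y" "y \<le> y2" for n y
      unfolding f_def norm_mult using v(2,3)[OF y, of n] order_trans[OF norm_ge_zero v(2)[OF y, of n]]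
      by (intro mult_mono ne y; simp)+
    show "integrable lborel (\<lambda>x. f (of_real x + \<i> * of_real y1))" "integrable lborel (\<lambda>x. f (of_real x + \<i> * of_real y2))"
      unfolding f_def by (rule FT_integrable)+
  qed (auto simp: R_def intro: holomorphic_on_imp_continuous_on[OF fhol])
  moreover have "contour_integral (rectpath (Complex (- R n) y1) (Complex (R n) y2)) f = 0" for n
    by (rule contour_integral_unique, rule Cauchy_theorem_convex_simple[of _ UNIV]) (auto intro: fhol)
  ultimately show ?thesis by (simp add: FT_def f_def LIMSEQ_const_iff)
qed

lemma FT_shift: "FT t y = FT t 0"
proof (cases y "0::real" rule: linorder_cases)
  case less
  then show ?thesis by (rule FT_shift_less)
next
  case greater
  then show ?thesis by (rule FT_shift_less[symmetric])
qed simp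

text \<open>The easy half of the Paley-Wiener theorem: moving the line to height
  \<open>- sgn t * real n\<close>, the decay of the character outweighs the growth of
  \<open>G\<close> by the factor \<open>exp (- c * real n)\<close>.\<close>

lemma FT_vanish:
  assumes "\<tau> < 2 * pi * \<bar>t\<bar>"
  shows "FT t 0 = 0"
proof -
  define c where "c = 2 * pi * \<bar>t\<bar> - \<tau>"
  have c: "c > 0" using assms by (simp add: c_def)
  have "norm (FT t 0) \<le> K * exp (- c * real n)" for n
  proof -
    have "norm (FT t 0) \<le> K * exp (\<tau> * \<bar>- sgn t * real n\<bar> + 2 * pi * t * (- sgn t * real n))"
      using FT_bound[of t "- sgn t * real n"] unfolding FT_shift[of t "- sgn t * real n"] .
    also have "t \<noteq> 0" using assms \<tau> by auto
    then have "\<tau> * \<bar>- sgn t * real n\<bar> + 2 * pi * t * (- sgn t * real n) = - c * real n"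
      by (auto simp: c_def abs_mult sgn_if algebra_simps)
    finally show ?thesis .
  qed
  moreover have "(\<lambda>n. exp (- c * real n)) \<longlonglongrightarrow> 0" using c by real_asymp
  then have "(\<lambda>n. K * exp (- c * real n)) \<longlonglongrightarrow> 0" by (rule tendsto_mult_right_zero)
  ultimately have "norm (FT t 0) \<le> 0" by (intro LIMSEQ_le_const[of "\<lambda>n. K * exp (- c * real n)"]) auto
  then show ?thesis by simp
qed

text \<open>The frequencies \<open>s n\<close> approach \<open>t\<close> from strictly outside the
  spectrum, where the transform is 0, and dominated convergence passes to the limit. The case of a
  critical frequency is the one needed for Poisson summation.\<close>

lemma FT_vanish':
  assumes "\<tau> \<le> 2 * pi * \<bar>t\<bar>" "t \<noteq> 0"
  shows "FT t y = 0"
proof -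
  define s where "s = (\<lambda>n. t * (1 + 1 / (real n + 1)))"
  have "(\<lambda>n. FT (s n) 0) \<longlonglongrightarrow> FT t 0" unfolding FT_def
  proof (rule integral_dominated_convergence[where w = "\<lambda>x. norm (G (of_real x))"])
    have [measurable]: "e2pi \<in> borel_measurable borel" unfolding e2pi_def by measurable
    show "(\<lambda>x. G (of_real x + \<i> * of_real 0) * e2pi (- of_real t' * (of_real x + \<i> * of_real 0))) \<in> borel_measurable lborel" for t'
      by measurable
    then show "(\<lambda>x. G (of_real x + \<i> * of_real 0) * e2pi (- of_real t' * (of_real x + \<i> * of_real 0))) \<in> borel_measurable lborel" for t' .
    show "AE x in lborel. (\<lambda>n. G (of_real x + \<i> * of_real 0) * e2pi (- of_real (s n) * (of_real x + \<i> * of_real 0)))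
       \<longlonglongrightarrow> G (of_real x + \<i> * of_real 0) * e2pi (- of_real t * (of_real x + \<i> * of_real 0))"
    proof (rule AE_I2)
      fix x :: real
      have "s \<longlonglongrightarrow> t" unfolding s_def by real_asymp
      then show "(\<lambda>n. G (of_real x + \<i> * of_real 0) * e2pi (- of_real (s n) * (of_real x + \<i> * of_real 0)))
       \<longlonglongrightarrow> G (of_real x + \<i> * of_real 0) * e2pi (- of_real t * (of_real x + \<i> * of_real 0))"
        unfolding e2pi_def by (intro tendsto_intros)
    qed
    show "AE x in lborel. norm (G (of_real x + \<i> * of_real 0) * e2pi (- of_real (s n) * (of_real x + \<i> * of_real 0))) \<le> norm (G (of_real x))" for n
      by (intro AE_I2) (simp add: norm_mult norm_e2pi)
  qed (use integrable_real in auto)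
  moreover have "FT (s n) 0 = 0" for n
  proof (rule FT_vanish)
    have "\<bar>s n\<bar> = \<bar>t\<bar> * (1 + 1 / (real n + 1))" by (simp add: s_def abs_mult add_nonneg_nonneg)
    then have "\<bar>s n\<bar> > \<bar>t\<bar>" using assms(2) by simp
    then have "2 * pi * \<bar>s n\<bar> > 2 * pi * \<bar>t\<bar>" by simp
    then show "\<tau> < 2 * pi * \<bar>s n\<bar>" using assms(1) by linarith
  qed
  ultimately have "FT t 0 = 0" by (simp add: LIMSEQ_const_iff)
  then show ?thesis using FT_shift[of t y] by simp
qed

end

section \<open>Poisson summation at the critical exponential type\<close>

lemma sin_pi_eq_0_iff: "sin (of_real pi * z) = 0 \<longleftrightarrow> z \<in> \<int>" for z :: complex
proof
  assume "sin (of_real pi * z) = 0"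
  then obtain n :: int where "of_real pi * z = of_real (of_int n * pi)" by (auto simp: sin_eq_0)
  then have "z = of_int n" by (simp add: mult.commute)
  then show "z \<in> \<int>" by simp
next
  assume "z \<in> \<int>"
  then obtain n :: int where "z = of_int n" by (auto elim: Ints_cases)
  then show "sin (of_real pi * z) = 0" by (auto simp: sin_eq_0 intro!: exI[of _ n])
qed

lemma cot_pi_e2pi:
  assumes "e2pi z \<noteq> 1"
  shows "cos (of_real pi * z) / sin (of_real pi * z) = \<i> * (e2pi z + 1) / (e2pi z - 1)"
proof -
  define E where "E = exp (\<i> * (of_real pi * z))"
  have E: "E \<noteq> 0" "exp (- (\<i> * (of_real pi * z))) = inverse E" by (simp_all add: E_def exp_minus)
  have q: "e2pi z = E * E" by (simp add: E_def e2pi_def mult_ac flip: exp_add)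
  have ne: "E * E - 1 \<noteq> 0" using assms q by simp
  have cs: "cos (of_real pi * z) = (E * E + 1) / (2 * E)" "sin (of_real pi * z) = (E * E - 1) / (2 * \<i> * E)"
    using E(1) unfolding cos_exp_eq sin_exp_eq E(2) E_def[symmetric] by (simp_all add: field_simps)
  show ?thesis unfolding q cs using ne E(1) by (simp add: field_simps)
qed

text \<open>With \<sigma> the sign of the imaginary part, \<open>u\<close> is small far from the
  real axis and the cotangent is a geometric series in \<open>u\<close>. It is stopped after the
  linear term, which will integrate to a Fourier coefficient at frequency 1 or -1; the remainder is
  quadratic in \<open>u\<close>, one power more than the growth of a function of type 2\<pi>
  consumes.\<close>

lemma cot_pi_expansion:
  assumes "\<sigma> = 1 \<or> \<sigma> = -1" and u: "u = e2pi (\<sigma> * z)" "u \<noteq> 1"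
  shows "cos (of_real pi * z) / sin (of_real pi * z) = - \<sigma> * \<i> * (1 + 2 * u + 2 * u\<^sup>2 / (1 - u))"
proof -
  have ne: "1 - u \<noteq> 0" "u \<noteq> 0" using u by (auto simp: e2pi_def)
  have e: "1 + 2 * u + 2 * u\<^sup>2 / (1 - u) = (1 + u) / (1 - u)"
    using ne by (simp add: field_simps power2_eq_square)
  show ?thesis
  proof (cases "\<sigma> = 1")
    case True
    then have "e2pi z = u" using u by simp
    then have "cos (of_real pi * z) / sin (of_real pi * z) = \<i> * (u + 1) / (u - 1)"
      using cot_pi_e2pi[of z] u by simp
    also have "\<dots> = - (\<i> * ((1 + u) / (1 - u)))" using ne by (simp add: field_simps)
    finally show ?thesis unfolding e True by simp
  next
    case False
    then have s: "\<sigma> = -1" using assms(1) by simp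
    then have q: "e2pi z = 1 / u" using u by (simp add: e2pi_def exp_minus divide_inverse)
    then have "e2pi z \<noteq> 1" using ne u by auto
    then have "cos (of_real pi * z) / sin (of_real pi * z) = \<i> * (1 / u + 1) / (1 / u - 1)"
      using cot_pi_e2pi[of z] unfolding q by simp
    also have "\<dots> = \<i> * ((1 + u) / u) / ((1 - u) / u)" using ne by (simp add: add_divide_distrib diff_divide_distrib add.commute)
    also have "\<dots> = \<i> * ((1 + u) / (1 - u))" using ne by simp
    finally show ?thesis unfolding e s by simp
  qed
qed

lemma residue_cot_pi:
  assumes hol: "G holomorphic_on UNIV"
  shows "residue (\<lambda>z. G z * (cos (of_real pi * z) / sin (of_real pi * z))) (of_int k) = G (of_int k) / of_real pi"
proof (rule residue_simple'[of "ball (of_int k) 1"])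
  have "sin (of_real pi * w) \<noteq> 0" if "w \<in> ball (of_int k) 1 - {of_int k}" for w :: complex
  proof
    assume "sin (of_real pi * w) = 0"
    then obtain m :: int where m: "w = of_int m" by (auto simp: sin_pi_eq_0_iff elim: Ints_cases)
    with that have "norm (complex_of_int (k - m)) < 1" "m \<noteq> k" by (auto simp: dist_norm)
    then have "\<bar>k - m\<bar> < 1" by (simp only: norm_of_int)
    then show False using \<open>m \<noteq> k\<close> by simp
  qed
  then show "(\<lambda>z. G z * (cos (of_real pi * z) / sin (of_real pi * z))) holomorphic_on ball (of_int k) 1 - {of_int k}"
    by (intro holomorphic_intros holomorphic_on_subset[OF hol]) auto
  have s0: "sin (complex_of_real pi * of_int k) = 0" by (simp add: sin_pi_eq_0_iff)
  then have c0: "cos (complex_of_real pi * of_int k) \<noteq> 0"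
    using sin_cos_squared_add[of "complex_of_real pi * of_int k"] by auto
  have "((\<lambda>w. sin (of_real pi * w)) has_field_derivative of_real pi * cos (of_real pi * of_int k)) (at (of_int k :: complex))"
    by (auto intro!: derivative_eq_intros)
  then have "((\<lambda>w. sin (of_real pi * w) / (w - of_int k)) \<longlongrightarrow> of_real pi * cos (of_real pi * of_int k)) (at (of_int k :: complex))"
    by (simp add: has_field_derivative_iff s0)
  moreover have "isCont (\<lambda>w. G w * cos (of_real pi * w)) (of_int k)"
    using holomorphic_on_imp_continuous_on[OF hol] by (intro continuous_intros) (auto simp: continuous_on_eq_continuous_at)
  then have "((\<lambda>w. G w * cos (of_real pi * w)) \<longlongrightarrow> G (of_int k) * cos (of_real pi * of_int k)) (at (of_int k :: complex))"
    by (simp add: isCont_def)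
  ultimately have "((\<lambda>w. G w * cos (of_real pi * w) / (sin (of_real pi * w) / (w - of_int k)))
    \<longlongrightarrow> G (of_int k) * cos (of_real pi * of_int k) / (of_real pi * cos (of_real pi * of_int k))) (at (of_int k :: complex))"
    using c0 by (intro tendsto_divide) auto
  then show "((\<lambda>w. G w * (cos (of_real pi * w) / sin (of_real pi * w)) * (w - of_int k)) \<longlongrightarrow> G (of_int k) / of_real pi) (at (of_int k :: complex))"
    using c0 by (simp add: field_simps)
qed auto

context exp_type_L1
begin

text \<open>The constant term of the expansion gives the integral of \<open>G\<close> up to a factor
  \<open>\<i>\<close> or \<open>- \<i>\<close>, the linear term vanishes by
  \<open>FT_vanish'\<close>, and only the quadratic remainder contributes to the error.\<close>

lemma cot_line_integral:
  assumes \<tau>': "\<tau> = 2 * pi" and \<sigma>: "\<sigma> = 1 \<or> \<sigma> = -1" and Y: "Y > 0"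
  defines "f \<equiv> (\<lambda>z. G z * (cos (of_real pi * z) / sin (of_real pi * z)))"
  shows "integrable lborel (\<lambda>x. f (of_real x + \<i> * of_real (\<sigma> * Y)))"
    and "norm ((LINT x|lborel. f (of_real x + \<i> * of_real (\<sigma> * Y))) - (- of_real \<sigma> * \<i> * (LINT x|lborel. G (of_real x))))
      \<le> 2 * K * exp (- 2 * pi * Y) / (1 - exp (- 2 * pi * Y))"
proof -
  have [measurable]: "e2pi \<in> borel_measurable borel" unfolding e2pi_def by measurable
  define y where "y = \<sigma> * Y"
  define p where "p = exp (- 2 * pi * Y)"
  have p: "0 < p" "p < 1" using Y by (auto simp: p_def)
  define z where "z = (\<lambda>x::real. of_real x + \<i> * of_real y)"
  define u where "u = (\<lambda>x. e2pi (of_real \<sigma> * z x))"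
  have nu: "norm (u x) = p" for x
    using \<sigma> by (auto simp: u_def z_def e2pi_def p_def y_def)
  have u1: "u x \<noteq> 1" for x using nu[of x] p by auto
  define r where "r = (\<lambda>x. 2 * (u x)\<^sup>2 / (1 - u x))"
  have nr: "norm (r x) \<le> 2 * p\<^sup>2 / (1 - p)" for x
  proof -
    have "1 - p \<le> norm (1 - u x)" using norm_triangle_ineq2[of 1 "u x"] by (simp add: nu)
    then show ?thesis using p unfolding r_def norm_divide norm_mult norm_power nu
      by (intro frac_le) auto
  qed
  have gi: "integrable lborel (\<lambda>x. G (z x))" unfolding z_def by (rule integrable_line)
  have gm[measurable]: "(\<lambda>x. G (z x)) \<in> borel_measurable borel" unfolding z_def by (rule meas_line)
  have um[measurable]: "u \<in> borel_measurable borel" unfolding u_def z_def by measurable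
  have rm[measurable]: "r \<in> borel_measurable borel" unfolding r_def by measurable
  have FTu: "(LINT x|lborel. G (z x) * u x) = FT (- \<sigma>) y" unfolding FT_def u_def z_def by simp
  have gui: "integrable lborel (\<lambda>x. G (z x) * u x)" unfolding u_def z_def using FT_integrable[of y "- \<sigma>"] by simp
  have gri: "integrable lborel (\<lambda>x. G (z x) * r x)"
  proof (rule Bochner_Integration.integrable_bound[OF integrable_mult_left[OF gi, of "of_real (2 * p\<^sup>2 / (1 - p))"]])
    show "AE x in lborel. norm (G (z x) * r x) \<le> norm (G (z x) * of_real (2 * p\<^sup>2 / (1 - p)))"
      unfolding norm_mult norm_of_real by (intro AE_I2 mult_left_mono order_trans[OF nr abs_ge_self]) auto
  qed auto
  have fe: "f (z x) = - of_real \<sigma> * \<i> * (G (z x) + 2 * (G (z x) * u x) + G (z x) * r x)" for x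
  proof -
    have c: "cos (of_real pi * z x) / sin (of_real pi * z x) = - of_real \<sigma> * \<i> * (1 + 2 * u x + r x)"
      unfolding r_def by (rule cot_pi_expansion) (use \<sigma> u1 in \<open>auto simp: u_def\<close>)
    show ?thesis unfolding f_def c by (simp add: algebra_simps)
  qed
  have int: "integrable lborel (\<lambda>x. f (z x))" unfolding fe
    by (intro integrable_mult_right Bochner_Integration.integrable_add gi gui gri)
  then show "integrable lborel (\<lambda>x. f (of_real x + \<i> * of_real (\<sigma> * Y)))" by (simp add: z_def y_def)
  have "(LINT x|lborel. f (z x)) = - of_real \<sigma> * \<i> * ((LINT x|lborel. G (z x)) + 2 * FT (- \<sigma>) y + (LINT x|lborel. G (z x) * r x))"
    unfolding fe FTu[symmetric] using gi gui gri by (simp add: Bochner_Integration.integral_add)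
  also have "FT (- \<sigma>) y = 0" by (rule FT_vanish') (use \<sigma> \<tau>' in auto)
  also have "(LINT x|lborel. G (z x)) = FT 0 y" unfolding FT_def z_def by (simp add: e2pi_def)
  also have "FT 0 y = FT 0 0" by (rule FT_shift)
  also have "FT 0 0 = (LINT x|lborel. G (of_real x))" unfolding FT_def by (simp add: e2pi_def)
  finally have eq: "(LINT x|lborel. f (z x)) - (- of_real \<sigma> * \<i> * (LINT x|lborel. G (of_real x)))
     = - of_real \<sigma> * \<i> * (LINT x|lborel. G (z x) * r x)"
    by (simp only: mult_zero_right add_0_right distrib_left add_diff_cancel_left')
  have "norm (LINT x|lborel. G (z x) * r x) \<le> (LINT x|lborel. norm (G (z x) * r x))" by (rule integral_norm_bound)
  also have "\<dots> \<le> (LINT x|lborel. norm (G (z x)) * (2 * p\<^sup>2 / (1 - p)))"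
    unfolding norm_mult using nr p by (intro integral_mono' integrable_mult_left integrable_norm gi mult_left_mono) auto
  also have "\<dots> = (LINT x|lborel. norm (G (z x))) * (2 * p\<^sup>2 / (1 - p))" by simp
  also have "\<dots> \<le> (K * exp (\<tau> * \<bar>y\<bar>)) * (2 * p\<^sup>2 / (1 - p))"
    unfolding z_def using p by (intro mult_right_mono norm_line_le) auto
  \<comment> \<open>One of the two factors \<open>p\<close> of the remainder pays for the growth of
    the L1 norm on the line; the other one makes the error tend to 0.\<close>
  also have "exp (\<tau> * \<bar>y\<bar>) = 1 / p" using \<sigma> Y by (auto simp: y_def p_def \<tau>' exp_minus field_simps)
  also have "K * (1 / p) * (2 * p\<^sup>2 / (1 - p)) = 2 * K * p / (1 - p)" using p by (simp add: power2_eq_square)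
  finally have "norm (- of_real \<sigma> * \<i> * (LINT x|lborel. G (z x) * r x)) \<le> 2 * K * p / (1 - p)"
    using \<sigma> by (auto simp: norm_mult)
  then show "norm ((LINT x|lborel. f (of_real x + \<i> * of_real (\<sigma> * Y))) - (- of_real \<sigma> * \<i> * (LINT x|lborel. G (of_real x))))
      \<le> 2 * K * exp (- 2 * pi * Y) / (1 - exp (- 2 * pi * Y))"
    using eq unfolding p_def z_def y_def by simp
qed

text \<open>The critical type \<open>2 * pi\<close> is admissible: only the frequencies \<open>1\<close> and \<open>-1\<close> lie on the edge of
  the spectrum, and there the Fourier transform vanishes by continuity.\<close>

lemma poisson_summation:
  assumes \<tau>': "\<tau> = 2 * pi"
  shows "(\<lambda>n. \<Sum>k\<in>{- int n..int n}. G (of_int k)) \<longlonglongrightarrow> (LINT x|lborel. G (of_real x))"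
proof -
  define f where "f = (\<lambda>z. G z * (cos (of_real pi * z) / sin (of_real pi * z)))"
  define I where "I = (LINT x|lborel. G (of_real x))"
  \<comment> \<open>Half-integers: the vertical sides run midway between poles, and exactly the
    integers from \<open>- n\<close> to \<open>n\<close> are enclosed.\<close>
  define R where "R = (\<lambda>n. real n + 1 / 2)"
  have R: "filterlim R at_top sequentially" unfolding R_def by real_asymp
  have R0: "R n > 0" for n by (simp add: R_def add_nonneg_pos)
  define J where "J = (\<lambda>y. LINT x|lborel. f (of_real x + \<i> * of_real y))"
  \<comment> \<open>On these vertical lines \<open>e2pi w\<close> is the negative real number
    \<open>- p\<close>, so the modulus of the cotangent is \<bar>1 - p\<bar> / (1 + p).\<close>
  have cotv: "norm (cos (of_real pi * w) / sin (of_real pi * w)) \<le> 1"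
    if w: "w = of_real (R n) + \<i> * of_real y \<or> w = - of_real (R n) + \<i> * of_real y" for w n y
  proof -
    define p where "p = exp (- 2 * pi * y)"
    have p: "p > 0" by (simp add: p_def)
    have "e2pi (of_real (R n)) = -1" "e2pi (- of_real (R n)) = -1"
    proof -
      have a: "e2pi (of_real (R n)) = exp (\<i> * of_real pi) * exp (2 * of_real pi * \<i> * of_nat n)"
        unfolding e2pi_def exp_add[symmetric] by (simp add: R_def algebra_simps)
      have "exp (2 * of_real pi * \<i> * of_nat n) = (exp (2 * of_real pi * \<i>)) ^ n"
        by (simp add: exp_of_nat_mult[symmetric] mult_ac)
      also have "\<dots> = 1" by simp
      finally show b: "e2pi (of_real (R n)) = -1" unfolding a by simp
      have "e2pi (- of_real (R n)) = inverse (e2pi (of_real (R n)))" unfolding e2pi_def by (simp add: exp_minus)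
      then show "e2pi (- of_real (R n)) = -1" by (simp add: b)
    qed
    moreover have "e2pi (a + \<i> * of_real y) = e2pi a * of_real p" for a
      unfolding e2pi_def p_def exp_of_real[symmetric] exp_add[symmetric] by (simp add: algebra_simps)
    ultimately have q: "e2pi w = - of_real p" using w by (elim disjE) (simp_all only: mult_minus1)
    have ne: "- of_real p \<noteq> (1::complex)"
    proof
      assume "- of_real p = (1::complex)"
      then have "Re (- of_real p) = 1" by simp
      then show False using p by simp
    qed
    have "cos (of_real pi * w) / sin (of_real pi * w) = \<i> * of_real ((1 - p) / (- p - 1))"
      using cot_pi_e2pi[of w] ne unfolding q by simp
    then have "norm (cos (of_real pi * w) / sin (of_real pi * w)) = \<bar>1 - p\<bar> / \<bar>- p - 1\<bar>"
      by (simp add: norm_mult abs_divide del: of_real_divide)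
    also have "\<dots> \<le> 1" using p by simp
    finally show ?thesis .
  qed
  have sumlim: "(\<lambda>n. \<Sum>k\<in>{- int n..int n}. G (of_int k)) \<longlonglongrightarrow> (J (- Y) - J Y) / (2 * \<i>)" if Y: "Y > 0" for Y
  proof -
    obtain v where v: "v \<longlonglongrightarrow> 0" "\<And>n y. - Y \<le> y \<Longrightarrow> y \<le> Y \<Longrightarrow> norm (G (of_real (R n) + \<i> * of_real y)) \<le> v n"
      "\<And>n y. - Y \<le> y \<Longrightarrow> y \<le> Y \<Longrightarrow> norm (G (- of_real (R n) + \<i> * of_real y)) \<le> v n"
      using vertical_decay[OF R, of "- Y" Y] Y by auto
    define \<gamma> where "\<gamma> = (\<lambda>n. rectpath (Complex (- R n) (- Y)) (Complex (R n) Y))"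
    have pim: "z \<notin> \<int>" "\<bar>Re z\<bar> \<le> R n" if "z \<in> path_image (\<gamma> n)" for z n
    proof -
      have z: "(\<bar>Re z\<bar> = R n) \<or> \<bar>Im z\<bar> = Y" "\<bar>Re z\<bar> \<le> R n"
        using that Y R0[of n] unfolding \<gamma>_def by (subst (asm) path_image_rectpath; force)+
      show "z \<notin> \<int>"
      proof
        assume "z \<in> \<int>"
        then obtain m :: int where m: "z = of_int m" by (auto elim: Ints_cases)
        then have "\<bar>real_of_int m\<bar> = real n + 1/2" using z Y by (auto simp: R_def)
        then have "real_of_int (2 * \<bar>m\<bar>) = real_of_int (2 * int n + 1)" by simp
        then have "2 * \<bar>m\<bar> = 2 * int n + 1" by (simp only: of_int_eq_iff)
        then show False by presburger
      qed
      show "\<bar>Re z\<bar> \<le> R n" by fact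
    qed
    have fhol: "f holomorphic_on A" if "A \<inter> \<int> = {}" for A
      unfolding f_def using that by (intro holomorphic_intros holomorphic_on_subset[OF hol]) (auto simp: sin_pi_eq_0_iff)
    have "(\<lambda>n. contour_integral (\<gamma> n) f) \<longlonglongrightarrow> (LINT x|lborel. f (of_real x + \<i> * of_real (- Y))) - (LINT x|lborel. f (of_real x + \<i> * of_real Y))"
      unfolding \<gamma>_def
    proof (rule contour_integral_rectpath_tendsto[OF _ R R0, where v = v])
      show "continuous_on (path_image (rectpath (Complex (- R n) (- Y)) (Complex (R n) Y))) f" for n
        using pim unfolding \<gamma>_def by (intro holomorphic_on_imp_continuous_on fhol) auto
      show "integrable lborel (\<lambda>x. f (of_real x + \<i> * of_real (- Y)))" "integrable lborel (\<lambda>x. f (of_real x + \<i> * of_real Y))"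
        using cot_line_integral(1)[OF \<tau>' _ Y, of "-1"] cot_line_integral(1)[OF \<tau>' _ Y, of 1] by (simp_all add: f_def)
      show "norm (f (of_real (R n) + \<i> * of_real y)) \<le> v n" if "- Y \<le> y" "y \<le> Y" for n y
      proof -
        have "norm (f (of_real (R n) + \<i> * of_real y)) \<le> v n * 1"
          unfolding f_def norm_mult using order_trans[OF norm_ge_zero v(2)[OF that, of n]]
          by (intro mult_mono v(2)[OF that] cotv[where n = n and y = y]) auto
        then show ?thesis by simp
      qed
      show "norm (f (- of_real (R n) + \<i> * of_real y)) \<le> v n" if "- Y \<le> y" "y \<le> Y" for n y
      proof -
        have "norm (f (- of_real (R n) + \<i> * of_real y)) \<le> v n * 1"
          unfolding f_def norm_mult using order_trans[OF norm_ge_zero v(2)[OF that, of n]]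
          by (intro mult_mono v(3)[OF that] cotv[where n = n and y = y]) auto
        then show ?thesis by simp
      qed
    qed (use Y v in auto)
    moreover have "contour_integral (\<gamma> n) f = 2 * \<i> * (\<Sum>k\<in>{- int n..int n}. G (of_int k))" for n
    proof -
      \<comment> \<open>This strip contains the contour at abscissa \<open>real n + 1 / 2\<close>,
        yet no integers beyond those in \<open>P\<close>.\<close>
      define S where "S = {z. \<bar>Re z\<bar> < real n + 1}"
      have Seq: "S = {z. Re z < real n + 1} \<inter> {z. Re z > - (real n + 1)}" by (auto simp: S_def)
      define P where "P = (of_int :: int \<Rightarrow> complex) ` {- int n..int n}"
      have SP: "(S - P) \<inter> \<int> = {}"
      proof -
        have "z \<in> P" if z: "z \<in> S" "z \<in> \<int>" for z
        proof -
          obtain m :: int where m: "z = of_int m" using z by (auto elim: Ints_cases)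
          with z have "\<bar>real_of_int m\<bar> < real n + 1" by (simp add: S_def)
          then have "m \<in> {- int n..int n}" by auto
          then show ?thesis unfolding P_def m by (rule imageI)
        qed
        then show ?thesis by blast
      qed
      have box: "p \<in> box (Complex (- R n) (- Y)) (Complex (R n) Y)" if "p \<in> P" for p
        using that Y by (auto simp: P_def in_box_complex_iff R_def)
      have "contour_integral (\<gamma> n) f = 2 * pi * \<i> * (\<Sum>p\<in>P. winding_number (\<gamma> n) p * residue f p)"
      proof (rule Residue_theorem)
        show "open S" unfolding Seq by (intro open_Int open_halfspace_Re_lt open_halfspace_Re_gt)
        show "connected S" unfolding Seq
          by (intro convex_connected convex_Int convex_halfspace_Re_lt convex_halfspace_Re_gt)
        show "f holomorphic_on S - P" by (rule fhol[OF SP])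
        show "path_image (\<gamma> n) \<subseteq> S - P"
          using pim[of _ n] by (force simp: S_def P_def R_def)
        show "\<forall>z. z \<notin> S \<longrightarrow> winding_number (\<gamma> n) z = 0"
          unfolding \<gamma>_def using Y R0[of n] by (intro allI impI winding_number_rectpath_outside) (auto simp: S_def in_cbox_complex_iff R_def)
      qed (auto simp: P_def \<gamma>_def)
      also have "(\<Sum>p\<in>P. winding_number (\<gamma> n) p * residue f p) = (\<Sum>p\<in>P. residue f p)"
        by (intro sum.cong refl) (simp add: \<gamma>_def winding_number_rectpath[OF box])
      also have "\<dots> = (\<Sum>k\<in>{- int n..int n}. G (of_int k) / of_real pi)"
        unfolding P_def f_def by (subst sum.reindex) (simp_all add: inj_on_def o_def residue_cot_pi[OF hol] del: times_divide_eq_right)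
      also have "2 * pi * \<i> * \<dots> = 2 * \<i> * (\<Sum>k\<in>{- int n..int n}. G (of_int k))"
        by (simp add: sum_divide_distrib[symmetric])
      finally show ?thesis .
    qed
    ultimately have "(\<lambda>n. 2 * \<i> * (\<Sum>k\<in>{- int n..int n}. G (of_int k))) \<longlonglongrightarrow> J (- Y) - J Y" by (simp add: J_def)
    then have "(\<lambda>n. 2 * \<i> * (\<Sum>k\<in>{- int n..int n}. G (of_int k)) / (2 * \<i>)) \<longlonglongrightarrow> (J (- Y) - J Y) / (2 * \<i>)"
      by (intro tendsto_divide tendsto_const) auto
    then show ?thesis by simp
  qed
  define L where "L = (J (- 1) - J 1) / (2 * \<i>)"
  \<comment> \<open>The sums over integers do not involve \<open>Y\<close>, so their limit
    \<open>L\<close> can be compared with the line integrals at every height, and \<open>Y\<close>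
    may tend to infinity afterwards.\<close>
  have LY: "norm (L - I) \<le> 2 * K * exp (- 2 * pi * Y) / (1 - exp (- 2 * pi * Y))" if Y: "Y > 0" for Y
  proof -
    define \<eta> where "\<eta> = 2 * K * exp (- 2 * pi * Y) / (1 - exp (- 2 * pi * Y))"
    have "L = (J (- Y) - J Y) / (2 * \<i>)"
      using LIMSEQ_unique[OF sumlim[of 1] sumlim[OF Y]] by (simp add: L_def)
    then have "L - I = ((J (- Y) - \<i> * I) - (J Y - (- \<i> * I))) / (2 * \<i>)" by (simp add: field_simps)
    then have "norm (L - I) = norm ((J (- Y) - \<i> * I) - (J Y - (- \<i> * I))) / 2" by (simp add: norm_divide norm_mult)
    also have "\<dots> \<le> (norm (J (- Y) - \<i> * I) + norm (J Y - (- \<i> * I))) / 2"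
      by (intro divide_right_mono norm_triangle_ineq4) auto
    also have "norm (J (- Y) - \<i> * I) \<le> \<eta>"
      using cot_line_integral(2)[OF \<tau>' _ Y, of "-1"] by (simp add: J_def I_def f_def \<eta>_def)
    also have "norm (J Y - (- \<i> * I)) \<le> \<eta>"
      using cot_line_integral(2)[OF \<tau>' _ Y, of 1] by (simp add: J_def I_def f_def \<eta>_def)
    finally have "norm (L - I) \<le> \<eta>" by simp
    then show ?thesis by (simp add: \<eta>_def)
  qed
  have "((\<lambda>Y. exp (- 2 * pi * Y) / (1 - exp (- 2 * pi * Y))) \<longlongrightarrow> 0) at_top" by real_asymp
  then have "((\<lambda>Y. 2 * K * (exp (- 2 * pi * Y) / (1 - exp (- 2 * pi * Y)))) \<longlongrightarrow> 0) at_top"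
    by (rule tendsto_mult_right_zero)
  then have "((\<lambda>Y. 2 * K * exp (- 2 * pi * Y) / (1 - exp (- 2 * pi * Y))) \<longlongrightarrow> 0) at_top" by simp
  then have "norm (L - I) \<le> 0"
  proof (rule tendsto_lowerbound)
    show "\<forall>\<^sub>F Y in at_top. norm (L - I) \<le> 2 * K * exp (- 2 * pi * Y) / (1 - exp (- 2 * pi * Y))"
      by (rule eventually_mono[OF eventually_gt_at_top[of "0::real"]]) (rule LY)
  qed simp
  then have "L = I" by simp
  then show ?thesis using sumlim[of 1] by (simp add: L_def I_def)
qed

end

section \<open>Uniqueness in the interpolation problem\<close>

text \<open>The factor \<open>1 - (z - c)\<^sup>2 / r\<^sup>2\<close> has modulus \<open>2 \<bar>Im z\<bar> / r\<close> on the circle and compensates a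
  double pole of the bound on the real axis.\<close>

lemma damped_maximum_modulus:
  assumes hol: "F holomorphic_on UNIV" and r: "r > 0" and K: "K \<ge> 0"
    and bound: "\<And>w. norm (w - of_real c) = r \<Longrightarrow> Im w \<noteq> 0 \<Longrightarrow> norm (F w) * (Im w)\<^sup>2 \<le> K"
    and z: "Re z = c" "\<bar>Im z\<bar> < r"
  shows "norm (F z) \<le> 4 * K / r\<^sup>2"
proof -
  define g where "g = (\<lambda>w::complex. 1 - (w - of_real c)\<^sup>2 / of_real (r\<^sup>2))"
  define h where "h = (\<lambda>w. F w * (g w)\<^sup>2)"
  have hhol: "h holomorphic_on A" for A unfolding h_def g_def
    using r by (intro holomorphic_intros holomorphic_on_subset[OF hol]) auto
  have gc: "norm (g w) = 2 * \<bar>Im w\<bar> / r" if w: "norm (w - of_real c) = r" for w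
  proof -
    define u where "u = w - of_real c"
    have "of_real (r\<^sup>2) = u * cnj u" using w complex_norm_square[of u] by (simp add: u_def)
    moreover have "g w * of_real (r\<^sup>2) = of_real (r\<^sup>2) - u\<^sup>2" using r
      by (simp add: g_def u_def left_diff_distrib)
    ultimately have "g w * of_real (r\<^sup>2) = u * (cnj u - u)"
      by (simp only:) (simp add: algebra_simps power2_eq_square)
    then have "norm (g w) * r\<^sup>2 = r * norm (cnj u - u)"
      using w by (metis norm_mult norm_of_real abs_power2 u_def)
    also have "cnj u - u = of_real (- 2 * Im u) * \<i>" by (simp add: complex_eq_iff)
    also have "norm \<dots> = 2 * \<bar>Im w\<bar>" by (simp add: norm_mult u_def)
    finally show ?thesis using r by (simp add: field_simps power2_eq_square)
  qed
  have "norm (h z) \<le> 4 * K / r\<^sup>2"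
  proof (rule maximum_modulus_frontier[where f = h and S = "cball (of_real c) r"])
    fix w assume "w \<in> frontier (cball (complex_of_real c) r)"
    then have w: "norm (w - of_real c) = r" using r by (simp add: dist_norm norm_minus_commute)
    have "norm (h w) = norm (F w) * (Im w)\<^sup>2 * (4 / r\<^sup>2)"
      by (simp add: h_def norm_mult norm_power gc[OF w] power_divide power_mult_distrib)
    also have "\<dots> \<le> K * (4 / r\<^sup>2)"
      using bound[OF w] K by (cases "Im w = 0") (auto intro!: divide_right_mono)
    finally show "norm (h w) \<le> 4 * K / r\<^sup>2" by (simp add: mult.commute)
  qed (use z in \<open>auto intro: hhol holomorphic_on_imp_continuous_on[OF hhol] simp: dist_norm cmod_def\<close>)
  moreover have "norm (F z) \<le> norm (h z)"
  proof -
    have "z - of_real c = of_real (Im z) * \<i>" using z by (simp add: complex_eq_iff)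
    then have "g z = of_real (1 + (Im z)\<^sup>2 / r\<^sup>2)" by (simp add: g_def power_mult_distrib)
    then have "norm (g z) = 1 + (Im z)\<^sup>2 / r\<^sup>2" by (simp only: norm_of_real) simp
    then have "norm (g z) \<ge> 1" by simp
    then have "(norm (g z))\<^sup>2 \<ge> 1" by simp
    then have "norm (F z) * 1 \<le> norm (F z) * (norm (g z))\<^sup>2" by (intro mult_left_mono) auto
    then show ?thesis by (simp add: h_def norm_mult norm_power)
  qed
  ultimately show ?thesis by linarith
qed

text \<open>The double zeros of \<open>F\<close> cancel those of the squared sine, which are of
  exact order two, so every integer is a removable singularity of the quotient.\<close>

lemma entire_divide_sin_square:
  assumes hol: "F holomorphic_on UNIV"
    and zero: "\<And>n::int. F (of_int n) = 0" "\<And>n::int. deriv F (of_int n) = 0"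
  shows "\<exists>W. W holomorphic_on UNIV \<and> (\<forall>z. F z = W z * (sin (of_real pi * z))\<^sup>2)"
proof -
  define f where "f = (\<lambda>z. F z / (sin (of_real pi * z))\<^sup>2)"
  have clZ: "closed (\<int> :: complex set)" by (rule closed_Ints)
  have an: "f analytic_on - \<int>"
    unfolding f_def using clZ
    by (subst analytic_on_open) (auto intro!: holomorphic_intros holomorphic_on_subset[OF hol] simp: sin_pi_eq_0_iff open_Compl)
  have at_int: "isolated_singularity_at f (of_int n) \<and> (\<exists>c. f \<midarrow>of_int n\<rightarrow> c)" for n :: int
  proof -
    define a where "a = complex_of_int n"
    define s where "s = (\<lambda>z::complex. sin (of_real pi * z))"
    have shol: "s holomorphic_on UNIV" unfolding s_def by (intro holomorphic_intros)
    have sa: "s a = 0" by (simp add: s_def sin_pi_eq_0_iff a_def)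
    have ds: "deriv s a \<noteq> 0"
    proof -
      have "(s has_field_derivative of_real pi * cos (of_real pi * a)) (at a)"
        unfolding s_def by (auto intro!: derivative_eq_intros)
      moreover have "cos (of_real pi * a) \<noteq> 0"
        using sa unfolding s_def by (metis sin_cos_squared_add add.right_neutral zero_neq_one zero_power2)
      ultimately show ?thesis by (simp add: DERIV_imp_deriv)
    qed
    \<comment> \<open>Divided differences with the limit filled in at \<open>a\<close>: locally
      \<open>F\<close> is \<open>(z - a)\<^sup>2 * g2 z\<close> and the sine is
      \<open>(z - a) * s1 z\<close>, with \<open>s1\<close> nonzero at \<open>a\<close>.\<close>
    define s1 where "s1 = (\<lambda>z. if z = a then deriv s a else (s z - s a) / (z - a))"
    define g1 where "g1 = (\<lambda>z. if z = a then deriv F a else (F z - F a) / (z - a))"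
    define g2 where "g2 = (\<lambda>z. if z = a then deriv g1 a else (g1 z - g1 a) / (z - a))"
    have h: "s1 holomorphic_on UNIV" "g1 holomorphic_on UNIV" unfolding s1_def g1_def
      by (rule pole_lemma; use shol hol in simp)+
    then have h2: "g2 holomorphic_on UNIV" unfolding g2_def by (intro pole_lemma) auto
    have e: "f z = g2 z / (s1 z)\<^sup>2" if "z \<noteq> a" for z
    proof -
      have "F z = (z - a)\<^sup>2 * g2 z" "s z = (z - a) * s1 z"
        using that zero[of n] sa by (auto simp: g2_def g1_def s1_def a_def power2_eq_square)
      moreover have "f z = F z / (s z)\<^sup>2" by (simp add: f_def s_def)
      ultimately show ?thesis using that by (simp add: power_mult_distrib)
    qed
    have "isCont g2 a" "isCont s1 a"
      using holomorphic_on_imp_continuous_on[OF h2] holomorphic_on_imp_continuous_on[OF h(1)]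
      by (auto simp: continuous_on_eq_continuous_at)
    then have "((\<lambda>z. g2 z / (s1 z)\<^sup>2) \<longlongrightarrow> g2 a / (s1 a)\<^sup>2) (at a)"
      using ds unfolding isCont_def by (intro tendsto_intros) (auto simp: s1_def)
    then have "f \<midarrow>a\<rightarrow> g2 a / (s1 a)\<^sup>2"
      by (rule Lim_transform_eventually) (auto simp: eventually_at_filter e)
    moreover have "isolated_singularity_at f a"
      unfolding isolated_singularity_at_def
    proof (intro exI[of _ 1] conjI)
      show "f analytic_on ball a 1 - {a}"
      proof (rule analytic_on_subset[OF an], rule subsetI, rule ComplI)
        fix w assume w: "w \<in> ball a 1 - {a}" "w \<in> \<int>"
        then obtain m :: int where m: "w = of_int m" by (auto elim: Ints_cases)
        with w have "norm (complex_of_int (n - m)) < 1" "m \<noteq> n" by (auto simp: dist_norm a_def)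
        then have "\<bar>n - m\<bar> < 1" by (simp only: norm_of_int)
        then show False using \<open>m \<noteq> n\<close> by simp
      qed
    qed simp
    ultimately show ?thesis by (auto simp: a_def)
  qed
  define W where "W = remove_sings f"
  have "W analytic_on {z}" for z
  proof (cases "z \<in> \<int>")
    case True
    then obtain n :: int where "z = of_int n" by (auto elim: Ints_cases)
    then show ?thesis using at_int[of n] remove_sings_analytic_at unfolding W_def by blast
  next
    case False
    then show ?thesis unfolding W_def by (intro remove_sings_analytic_on analytic_on_subset[OF an]) auto
  qed
  then have "W analytic_on UNIV" using analytic_on_analytic_at by blast
  then have "W holomorphic_on UNIV" by (rule analytic_imp_holomorphic)
  moreover have "F z = W z * (sin (of_real pi * z))\<^sup>2" for z
  proof (cases "z \<in> \<int>")
    case True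
    then obtain n :: int where "z = of_int n" by (auto elim: Ints_cases)
    then show ?thesis using zero[of n] True by (simp add: sin_pi_eq_0_iff)
  next
    case False
    then have "W z = f z" unfolding W_def by (intro remove_sings_at_analytic analytic_on_subset[OF an]) auto
    then show ?thesis using False by (simp add: f_def sin_pi_eq_0_iff)
  qed
  ultimately show ?thesis by blast
qed

text \<open>The worst case for the modulus of the sine at a given height is the hyperbolic sine of
  \<open>p\<close>. The estimate 1 - exp(-2p) \<ge> 2p / (1 + 2p) turns this into a multiple of the
  full exponential; the loss is bounded far from the axis and has a double pole on it after
  squaring.\<close>

lemma norm_sin_pi_ge:
  fixes z :: complex
  assumes y: "Im z \<noteq> 0"
  shows "exp (2 * pi * \<bar>Im z\<bar>) \<le> (norm (sin (of_real pi * z)))\<^sup>2 * ((1 + 2 * pi * \<bar>Im z\<bar>) / (pi * \<bar>Im z\<bar>))\<^sup>2"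
proof -
  define p where "p = pi * \<bar>Im z\<bar>"
  have p: "p > 0" using y by (simp add: p_def)
  have "(norm (sin (of_real pi * z)))\<^sup>2 = (exp (2 * (pi * Im z)) + inverse (exp (2 * (pi * Im z))) - 2 * cos (2 * Re (of_real pi * z))) / 4"
    using norm_sin_squared[of "of_real pi * z"] by simp
  also have "exp (2 * (pi * Im z)) + inverse (exp (2 * (pi * Im z))) = exp (2 * p) + exp (- (2 * p))"
    by (cases "Im z \<ge> 0") (auto simp: p_def exp_minus)
  also have "(exp (2 * p) + exp (- (2 * p)) - 2 * cos (2 * Re (of_real pi * z))) / 4 \<ge> (exp (2 * p) + exp (- (2 * p)) - 2) / 4"
    by simp
  also have "(exp (2 * p) + exp (- (2 * p)) - 2) / 4 = (exp p * (1 - exp (- (2 * p))) / 2)\<^sup>2"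
    by (simp add: power2_eq_square algebra_simps flip: exp_add)
  finally have 1: "(exp p * (1 - exp (- (2 * p))) / 2)\<^sup>2 \<le> (norm (sin (of_real pi * z)))\<^sup>2" .
  have "1 + 2 * p \<le> exp (2 * p)" by (rule exp_ge_add_one_self)
  then have "exp (- (2 * p)) \<le> 1 / (1 + 2 * p)" using p by (simp add: exp_minus field_simps)
  then have "1 - exp (- (2 * p)) \<ge> 2 * p / (1 + 2 * p)" using p by (simp add: field_simps)
  then have "(1 - exp (- (2 * p))) / 2 * ((1 + 2 * p) / p) \<ge> 2 * p / (1 + 2 * p) / 2 * ((1 + 2 * p) / p)"
    using p by (intro mult_right_mono divide_right_mono) auto
  also have "2 * p / (1 + 2 * p) / 2 * ((1 + 2 * p) / p) = 1"
  proof -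
    have "1 + 2 * p \<noteq> 0" "p \<noteq> 0" using p by auto
    then show ?thesis by simp
  qed
  finally have "exp p * 1 \<le> exp p * ((1 - exp (- (2 * p))) / 2 * ((1 + 2 * p) / p))" by (intro mult_left_mono) auto
  then have "(exp p)\<^sup>2 \<le> (exp p * ((1 - exp (- (2 * p))) / 2 * ((1 + 2 * p) / p)))\<^sup>2" by (intro power_mono) auto
  also have "\<dots> = (exp p * (1 - exp (- (2 * p))) / 2)\<^sup>2 * ((1 + 2 * p) / p)\<^sup>2"
    by (simp add: power_mult_distrib[symmetric] mult_ac)
  also have "\<dots> \<le> (norm (sin (of_real pi * z)))\<^sup>2 * ((1 + 2 * p) / p)\<^sup>2" by (intro mult_right_mono 1) auto
  also have "(exp p)\<^sup>2 = exp (2 * p)" by (simp add: power2_eq_square flip: exp_add)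
  finally show ?thesis by (simp add: p_def mult.assoc)
qed

lemma (in exp_type_L1) eq_zero_of_double_zeros:
  assumes \<tau>': "\<tau> = 2 * pi"
    and zero: "\<And>n::int. G (of_int n) = 0" "\<And>n::int. n \<noteq> 0 \<Longrightarrow> deriv G (of_int n) = 0"
  shows "G z = 0"
proof -
  define F where "F = (\<lambda>z. z * G z)"
  have Fhol: "F holomorphic_on UNIV" unfolding F_def by (intro holomorphic_intros hol)
  have dG: "(G has_field_derivative deriv G z) (at z)" for z using hol by (intro holomorphic_derivI[of _ UNIV]) auto
  have dF: "deriv F z = G z + z * deriv G z" for z
    unfolding F_def by (rule DERIV_imp_deriv) (auto intro!: derivative_eq_intros dG)
  have "deriv F (of_int n) = 0" for n :: int using zero[of n] by (cases "n = 0") (auto simp: dF)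
  then obtain W where W: "W holomorphic_on UNIV" "\<And>z. F z = W z * (sin (of_real pi * z))\<^sup>2"
    using entire_divide_sin_square[OF Fhol] zero by (auto simp: F_def)
  obtain C where C: "C \<ge> 0" "\<And>z. norm (G z) \<le> C * exp (2 * pi * \<bar>Im z\<bar>)"
    using pointwise_bound \<tau>' by auto
  have Wb: "norm (W z) \<le> C * norm z * ((1 + 2 * pi * \<bar>Im z\<bar>) / (pi * \<bar>Im z\<bar>))\<^sup>2" if y: "Im z \<noteq> 0" for z
  proof -
    have s: "sin (of_real pi * z) \<noteq> 0" using y by (auto simp: sin_pi_eq_0_iff elim!: Ints_cases)
    have "norm (W z) * (norm (sin (of_real pi * z)))\<^sup>2 = norm z * norm (G z)"
      using arg_cong[OF W(2)[of z], of norm] by (simp add: F_def norm_mult norm_power)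
    also have "\<dots> \<le> norm z * (C * exp (2 * pi * \<bar>Im z\<bar>))" using C by (intro mult_left_mono) auto
    also have "\<dots> \<le> norm z * (C * ((norm (sin (of_real pi * z)))\<^sup>2 * ((1 + 2 * pi * \<bar>Im z\<bar>) / (pi * \<bar>Im z\<bar>))\<^sup>2))"
      by (intro mult_left_mono norm_sin_pi_ge y C) auto
    finally have "(norm (sin (of_real pi * z)))\<^sup>2 * norm (W z) \<le> (norm (sin (of_real pi * z)))\<^sup>2 * (C * norm z * ((1 + 2 * pi * \<bar>Im z\<bar>) / (pi * \<bar>Im z\<bar>))\<^sup>2)"
      by (simp only: mult_ac)
    moreover have "(norm (sin (of_real pi * z)))\<^sup>2 > 0" using s by simp
    ultimately show ?thesis by (simp only: mult_le_cancel_left_pos)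
  qed
  define Q where "Q = ((1 + 2 * pi) / pi)\<^sup>2"
  have Q: "Q > 0" unfolding Q_def by (intro zero_less_power divide_pos_pos) (auto intro: add_pos_pos)
  have Qy: "((1 + 2 * pi * y) / (pi * y))\<^sup>2 * y\<^sup>2 \<le> Q" if "0 < y" "y \<le> 1" for y :: real
  proof -
    have "((1 + 2 * pi * y) / (pi * y))\<^sup>2 * y\<^sup>2 = ((1 + 2 * pi * y) / pi)\<^sup>2"
      using that by (simp add: power_divide power_mult_distrib)
    also have "\<dots> \<le> Q" unfolding Q_def using that
      by (intro power_mono divide_right_mono) (auto intro!: add_nonneg_nonneg)
    finally show ?thesis .
  qed
  have Qy': "((1 + 2 * pi * y) / (pi * y))\<^sup>2 \<le> Q" if "1 \<le> y" for y :: real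
    unfolding Q_def using that by (intro power_mono) (auto simp: field_simps)
  \<comment> \<open>At distance at least 1 from the axis the bound \<open>Wb\<close> is already
    linear. Closer to it, \<open>Wb\<close> has a double pole in the imaginary part, and the damped
    maximum principle on a unit disc centred on the axis removes it. The 8 is the 4 of that
    principle times the 2 in \<bar>Re z\<bar> + 1 \<le> 2 * norm z.\<close>
  have Wlin: "norm (W z) \<le> 8 * C * Q * norm z" if z1: "1 \<le> norm z" for z
  proof (cases "\<bar>Im z\<bar> < 1")
    case False
    then have "norm (W z) \<le> C * norm z * ((1 + 2 * pi * \<bar>Im z\<bar>) / (pi * \<bar>Im z\<bar>))\<^sup>2" by (intro Wb) auto
    also have "\<dots> \<le> C * norm z * Q" using False C by (intro mult_left_mono Qy') auto
    finally have "norm (W z) \<le> C * norm z * Q" .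
    also have "\<dots> \<le> 8 * C * Q * norm z" using C Q by (simp add: algebra_simps)
    finally show ?thesis .
  next
    case True
    have "norm (W z) \<le> 4 * (C * (\<bar>Re z\<bar> + 1) * Q) / 1\<^sup>2"
    proof (rule damped_maximum_modulus[OF W(1), where c = "Re z"])
      fix w assume w: "norm (w - of_real (Re z)) = 1" "Im w \<noteq> 0"
      have nw: "norm w \<le> \<bar>Re z\<bar> + 1" using norm_triangle_ineq2[of w "of_real (Re z)"] w by simp
      have iw: "\<bar>Im w\<bar> \<le> 1" using abs_Im_le_cmod[of "w - of_real (Re z)"] w by simp
      have "norm (W w) * (Im w)\<^sup>2 \<le> (C * norm w * ((1 + 2 * pi * \<bar>Im w\<bar>) / (pi * \<bar>Im w\<bar>))\<^sup>2) * (Im w)\<^sup>2"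
        by (intro mult_right_mono Wb w) auto
      also have "\<dots> = (C * norm w) * (((1 + 2 * pi * \<bar>Im w\<bar>) / (pi * \<bar>Im w\<bar>))\<^sup>2 * \<bar>Im w\<bar>\<^sup>2)" by simp
      also have "\<dots> \<le> (C * (\<bar>Re z\<bar> + 1)) * Q" using w iw C nw by (intro mult_mono mult_left_mono Qy) auto
      finally show "norm (W w) * (Im w)\<^sup>2 \<le> C * (\<bar>Re z\<bar> + 1) * Q" .
    qed (use True C Q in auto)
    also have "\<dots> \<le> 4 * (C * (norm z + norm z) * Q)"
    proof -
      have "\<bar>Re z\<bar> + 1 \<le> norm z + norm z" using z1 abs_Re_le_cmod[of z] by linarith
      then have "C * (\<bar>Re z\<bar> + 1) * Q \<le> C * (norm z + norm z) * Q"
        using C Q by (intro mult_left_mono mult_right_mono) auto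
      then have "4 * (C * (\<bar>Re z\<bar> + 1) * Q) \<le> 4 * (C * (norm z + norm z) * Q)"
        by (rule mult_left_mono) simp
      then show ?thesis by (simp only: power_one div_by_1)
    qed
    finally show ?thesis by (simp add: mult_ac)
  qed
  obtain a b where ab: "\<And>z. W z = a + b * z"
  proof
    fix z show "W z = W 0 + deriv W 0 * z"
      using Liouville_polynomial[OF W(1), of 1 "8 * C * Q" 1 z] Wlin by simp
  qed
  define s0 where "s0 = exp (2 * pi) / Q"
  have s0: "s0 > 0" using Q by (simp add: s0_def)
  \<comment> \<open>At height 1 the sine is bounded below, so the affine quotient can be read off
    from the size of \<open>G\<close>.\<close>
  have line: "norm (G (of_real x + \<i>)) * (\<bar>x\<bar> + 1) \<ge> norm (a + b * (of_real x + \<i>)) * s0" for x :: real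
  proof -
    define z where "z = of_real x + \<i>"
    have "exp (2 * pi) \<le> (norm (sin (of_real pi * z)))\<^sup>2 * Q"
      using norm_sin_pi_ge[of z] by (simp add: z_def Q_def)
    then have "s0 \<le> (norm (sin (of_real pi * z)))\<^sup>2" using Q by (simp add: s0_def field_simps)
    then have "norm (a + b * z) * s0 \<le> norm (a + b * z) * (norm (sin (of_real pi * z)))\<^sup>2" by (intro mult_left_mono) auto
    also have "\<dots> = norm (F z)" by (simp add: W(2) ab norm_mult norm_power)
    also have "\<dots> \<le> norm (G z) * (\<bar>x\<bar> + 1)"
    proof -
      have "norm z \<le> \<bar>x\<bar> + 1" using cmod_le[of z] by (simp add: z_def)
      then have "norm (G z) * norm z \<le> norm (G z) * (\<bar>x\<bar> + 1)" by (rule mult_left_mono) simp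
      then show ?thesis by (simp add: F_def norm_mult mult.commute)
    qed
    finally show ?thesis by (simp add: z_def)
  qed
  \<comment> \<open>With a nonzero slope the modulus of \<open>G\<close> would stay away from 0
    along this line, against its decay at infinity.\<close>
  have "b = 0"
  proof -
    have "filterlim real at_top sequentially" by (rule filterlim_real_sequentially)
    from vertical_decay[OF this, of 1 1] obtain v where v: "v \<longlonglongrightarrow> 0" "\<And>n. norm (G (of_real (real n) + \<i>)) \<le> v n" by auto
    have nb: "norm ((a + b * (of_real (real n) + \<i>)) / of_real (real n + 1)) \<le> v n / s0" for n
    proof -
      have "norm (a + b * (of_real (real n) + \<i>)) * s0 \<le> v n * (real n + 1)"
      proof -
        have "norm (G (of_real (real n) + \<i>)) * (real n + 1) \<le> v n * (real n + 1)"
          by (intro mult_right_mono v) auto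
        then show ?thesis using line[of "real n"] unfolding abs_of_nat by linarith
      qed
      moreover have "norm ((a + b * (of_real (real n) + \<i>)) / of_real (real n + 1)) = norm (a + b * (of_real (real n) + \<i>)) / (real n + 1)"
        unfolding norm_divide norm_of_real by simp
      ultimately show ?thesis using s0 by (simp only:) (simp add: field_simps)
    qed
    have vs: "(\<lambda>n. v n / s0) \<longlonglongrightarrow> 0" using tendsto_divide[OF v(1) tendsto_const[of s0]] s0 by simp
    have "(\<lambda>n. (a + b * (of_real (real n) + \<i>)) / of_real (real n + 1)) \<longlonglongrightarrow> 0"
      by (rule Lim_null_comparison[OF always_eventually vs]) (use nb in blast)
    moreover have "(\<lambda>n. (a + b * (of_real (real n) + \<i>)) / of_real (real n + 1)) \<longlonglongrightarrow> b"
    proof -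
      have "(\<lambda>n. (1::real) / (real n + 1)) \<longlonglongrightarrow> 0" by real_asymp
      then have "(\<lambda>n. complex_of_real (1 / (real n + 1))) \<longlonglongrightarrow> of_real 0" by (rule tendsto_of_real)
      then have "(\<lambda>n. (a + b * \<i> - b) * of_real (1 / (real n + 1)) + b) \<longlonglongrightarrow> (a + b * \<i> - b) * of_real 0 + b"
        by (rule tendsto_add[OF tendsto_mult[OF tendsto_const] tendsto_const])
      moreover have "(a + b * \<i> - b) * of_real (1 / (real n + 1)) + b = (a + b * (of_real (real n) + \<i>)) / of_real (real n + 1)" for n
      proof -
        define N where "N = complex_of_real (real n + 1)"
        have "real n + 1 \<noteq> 0" by simp
        then have N: "N \<noteq> 0" unfolding N_def of_real_eq_0_iff .
        have n: "complex_of_real (real n) = N - 1" by (simp add: N_def)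
        have "complex_of_real (1 / (real n + 1)) = 1 / N" by (simp add: N_def)
        then show ?thesis unfolding n N_def[symmetric] using N by (simp add: field_simps)
      qed
      ultimately show ?thesis by simp
    qed
    ultimately show ?thesis using LIMSEQ_unique by blast
  qed
  \<comment> \<open>A nonzero constant would make the modulus of \<open>G\<close> at least
    \<open>c / (1 + x)\<close>, whose integral grows like a logarithm, while the L1 norm on the line
    is finite.\<close>
  have "a = 0"
  proof (rule ccontr)
    assume "a \<noteq> 0"
    define c where "c = norm a * s0"
    have c: "c > 0" using \<open>a \<noteq> 0\<close> s0 by (simp add: c_def)
    have bound: "c * ln (1 + real N) \<le> K * exp \<tau>" for N
    proof -
      have "(LINT x|lborel. (c / (1 + x)) * indicator {0..real N} x) = c * ln (1 + real N) - c * ln (1 + 0)"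
        by (rule integral_FTC_Icc_real) (auto intro!: derivative_eq_intros continuous_intros)
      moreover have "(LINT x|lborel. (c / (1 + x)) * indicator {0..real N} x) \<le> (LINT x|lborel. norm (G (of_real x + \<i> * of_real 1)))"
      proof (rule integral_mono')
        show "integrable lborel (\<lambda>x. norm (G (of_real x + \<i> * of_real 1)))" by (intro integrable_norm integrable_line)
        show "(c / (1 + x)) * indicator {0..real N} x \<le> norm (G (of_real x + \<i> * of_real 1))" for x
          using line[of x] \<open>b = 0\<close> by (auto simp: indicator_def c_def field_simps)
      qed auto
      moreover have "(LINT x|lborel. norm (G (of_real x + \<i> * of_real 1))) \<le> K * exp \<tau>"
        using norm_line_le[of 1] by simp
      ultimately show ?thesis by simp
    qed
    have "filterlim (\<lambda>N. c * ln (1 + real N)) at_top sequentially" using c by real_asymp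
    then have "\<forall>\<^sub>F N in sequentially. c * ln (1 + real N) > K * exp \<tau>" by (simp add: filterlim_at_top_dense)
    then show False using bound by (auto simp: eventually_sequentially not_le[symmetric])
  qed
  have W0: "W w = 0" for w using ab \<open>a = 0\<close> \<open>b = 0\<close> by simp
  show "G z = 0"
  proof (cases "z = 0")
    case True then show ?thesis using zero(1)[of 0] by simp
  next
    case False then show ?thesis using W(2)[of z] W0 by (simp add: F_def)
  qed
qed

section \<open>The majorant as a cardinal series\<close>

lemma sum_int_symmetric:
  fixes f :: "int \<Rightarrow> 'a::comm_monoid_add"
  shows "(\<Sum>k\<in>{- int N..int N}. f k) = f 0 + (\<Sum>n=1..N. f (int n) + f (- int n))"
proof (induction N)
  case (Suc N)
  have "{- int (Suc N)..int (Suc N)} = insert (int (Suc N)) (insert (- int (Suc N)) {- int N..int N})" by auto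
  then have "(\<Sum>k\<in>{- int (Suc N)..int (Suc N)}. f k) = f (int (Suc N)) + (f (- int (Suc N)) + (\<Sum>k\<in>{- int N..int N}. f k))"
    by (simp del: of_nat_Suc)
  then show ?case unfolding Suc.IH by (simp add: ac_simps del: of_nat_Suc)
qed simp

lemma integrable_count_space_int:
  fixes f :: "int \<Rightarrow> 'a::{banach, second_countable_topology}"
  assumes "summable (\<lambda>n. norm (f (int n)))" "summable (\<lambda>n. norm (f (- int n)))"
  shows "integrable (count_space UNIV) f"
proof -
  have "Infinite_Set_Sum.abs_summable_on f (range int)" "Infinite_Set_Sum.abs_summable_on f (range (\<lambda>n. - int n))"
    using assms by (auto intro!: abs_summable_on_reindex simp: abs_summable_on_nat_iff')
  then have "Infinite_Set_Sum.abs_summable_on f (range int \<union> range (\<lambda>n. - int n))" by (rule abs_summable_on_union)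
  also have "range int \<union> range (\<lambda>n. - int n) = UNIV"
  proof -
    have "k \<in> range int \<union> range (\<lambda>n. - int n)" for k
      by (cases k rule: int_cases2) auto
    then show ?thesis by auto
  qed
  finally show ?thesis by (simp add: abs_summable_on_def)
qed

lemma sum_int_tendsto:
  fixes f :: "int \<Rightarrow> 'a::{banach, second_countable_topology}"
  assumes f: "integrable (count_space UNIV) f"
  shows "(\<lambda>N. \<Sum>k\<in>{- int N..int N}. f k) \<longlonglongrightarrow> (LINT k|count_space UNIV. f k)"
proof -
  have "(\<lambda>N. LINT k|count_space UNIV. indicator {- int N..int N} k *\<^sub>R f k) \<longlonglongrightarrow> (LINT k|count_space UNIV. f k)"
  proof (rule integral_dominated_convergence[where w = "\<lambda>k. norm (f k)"])
    show "AE k in count_space UNIV. (\<lambda>N. indicator {- int N..int N} k *\<^sub>R f k) \<longlonglongrightarrow> f k"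
    proof (rule AE_I2)
      fix k
      have "\<forall>\<^sub>F N in sequentially. N \<ge> nat \<bar>k\<bar>" by (rule eventually_ge_at_top)
      then have "\<forall>\<^sub>F N in sequentially. f k = indicator {- int N..int N} k *\<^sub>R f k"
        by eventually_elim (auto simp: indicator_def)
      then show "(\<lambda>N. indicator {- int N..int N} k *\<^sub>R f k) \<longlonglongrightarrow> f k"
        by (rule Lim_transform_eventually[rotated]) simp
    qed
  qed (use f in \<open>auto simp: indicator_def\<close>)
  moreover have "(LINT k|count_space UNIV. indicator {- int N..int N} k *\<^sub>R f k) = (\<Sum>k\<in>{- int N..int N}. f k)" for N
    by (subst lebesgue_integral_count_space_finite_support)
      (auto intro!: sum.mono_neutral_cong_left finite_subset[of _ "{- int N..int N}"] simp: indicator_def)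
  ultimately show ?thesis by simp
qed

text \<open>The normalised sinc function with its singularity filled in. Interpolation sums written
  with it are entire term by term, so that integers need no exceptional treatment until they are
  compared with the formulas containing quotients.\<close>

definition csinc :: "complex \<Rightarrow> complex" where
  "csinc z = (if z = 0 then 1 else sin (of_real pi * z) / (of_real pi * z))"

lemma csinc_mult: "z * csinc z = sin (of_real pi * z) / of_real pi"
  by (simp add: csinc_def)

lemma csinc_holomorphic: "csinc holomorphic_on A"
proof -
  define s where "s = (\<lambda>z::complex. sin (of_real pi * z) / of_real pi)"
  have "(s has_field_derivative cos (of_real pi * 0)) (at 0)"
    unfolding s_def by (auto intro!: derivative_eq_intros)
  then have "deriv s 0 = 1" by (simp add: DERIV_imp_deriv)
  then have "csinc = (\<lambda>z. if z = 0 then deriv s 0 else (s z - s 0) / (z - 0))"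
    by (auto simp: csinc_def s_def fun_eq_iff)
  moreover have "(\<lambda>z. if z = 0 then deriv s 0 else (s z - s 0) / (z - 0)) holomorphic_on UNIV"
    by (rule pole_lemma) (auto simp: s_def intro!: holomorphic_intros)
  ultimately show ?thesis using holomorphic_on_subset by (metis subset_UNIV)
qed

lemma csinc_minus [simp]: "csinc (- z) = csinc z" by (simp add: csinc_def)

lemma csinc_of_int: "csinc (of_int k) = (if k = 0 then 1 else 0)"
  by (auto simp: csinc_def sin_pi_eq_0_iff)

lemma norm_sin_pi_le: "norm (sin (of_real pi * z)) \<le> exp (pi * \<bar>Im z\<bar>)"
proof -
  have "(norm (sin (of_real pi * z)))\<^sup>2 = (exp (2 * (pi * Im z)) + inverse (exp (2 * (pi * Im z))) - 2 * cos (2 * Re (of_real pi * z))) / 4"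
    using norm_sin_squared[of "of_real pi * z"] by simp
  also have "exp (2 * (pi * Im z)) + inverse (exp (2 * (pi * Im z))) = exp (2 * (pi * \<bar>Im z\<bar>)) + exp (- (2 * (pi * \<bar>Im z\<bar>)))"
    by (cases "Im z \<ge> 0") (auto simp: exp_minus)
  also have "(exp (2 * (pi * \<bar>Im z\<bar>)) + exp (- (2 * (pi * \<bar>Im z\<bar>))) - 2 * cos (2 * Re (of_real pi * z))) / 4
      \<le> (exp (2 * (pi * \<bar>Im z\<bar>)) + 1 + 2 * 1) / 4"
  proof (intro divide_right_mono)
    have "exp (- (2 * (pi * \<bar>Im z\<bar>))) \<le> 1" by simp
    then show "exp (2 * (pi * \<bar>Im z\<bar>)) + exp (- (2 * (pi * \<bar>Im z\<bar>))) - 2 * cos (2 * Re (of_real pi * z)) \<le> exp (2 * (pi * \<bar>Im z\<bar>)) + 1 + 2 * 1"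
      using cos_ge_minus_one[of "2 * Re (of_real pi * z)"] by linarith
  qed simp
  also have "\<dots> \<le> exp (2 * (pi * \<bar>Im z\<bar>))"
  proof -
    have "1 \<le> exp (2 * (pi * \<bar>Im z\<bar>))" by simp
    moreover have "(x + 1 + 2 * 1) / 4 \<le> x" if "1 \<le> x" for x :: real using that by simp
    ultimately show ?thesis by blast
  qed
  also have "\<dots> = (exp (pi * \<bar>Im z\<bar>))\<^sup>2" by (simp add: power2_eq_square flip: exp_add)
  finally show ?thesis by (rule power2_le_imp_le) simp
qed

lemma norm_mult_csinc_le: "norm (z * csinc z) \<le> exp (pi * \<bar>Im z\<bar>)"
proof -
  have "norm (z * csinc z) = norm (sin (of_real pi * z)) / pi" by (simp add: csinc_mult norm_divide)
  also have "\<dots> \<le> norm (sin (of_real pi * z)) / 1" using pi_gt3 by (intro divide_left_mono) auto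
  finally show ?thesis using norm_sin_pi_le[of z] by simp
qed

text \<open>Outside the unit disc the bound on \<open>z * csinc z\<close> suffices. On the unit
  circle the two functions have the same modulus, and the maximum principle carries that bound
  inside, which is where \<open>exp pi\<close> comes from.\<close>

lemma norm_csinc_le: "norm (csinc z) \<le> exp pi * exp (pi * \<bar>Im z\<bar>)"
proof (cases "norm z < 1")
  case False
  then have "norm (csinc z) * 1 \<le> norm (csinc z) * norm z" by (intro mult_left_mono) auto
  also have "\<dots> \<le> 1 * exp (pi * \<bar>Im z\<bar>)" using norm_mult_csinc_le[of z] by (simp add: norm_mult mult.commute)
  also have "\<dots> \<le> exp pi * exp (pi * \<bar>Im z\<bar>)" by (intro mult_right_mono) auto
  finally show ?thesis by simp
next
  case True
  have "norm (csinc z) \<le> exp pi"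
  proof (rule maximum_modulus_frontier[where f = csinc and S = "cball 0 1"])
    fix w :: complex assume "w \<in> frontier (cball 0 1)"
    then have w: "norm w = 1" by simp
    then have "norm (csinc w) \<le> exp (pi * \<bar>Im w\<bar>)" using norm_mult_csinc_le[of w] by (simp add: norm_mult)
    also have "\<dots> \<le> exp pi" using abs_Im_le_cmod[of w] w by simp
    finally show "norm (csinc w) \<le> exp pi" .
  qed (use True in \<open>auto intro: csinc_holomorphic holomorphic_on_imp_continuous_on\<close>)
  also have "\<dots> \<le> exp pi * exp (pi * \<bar>Im z\<bar>)" by simp
  finally show ?thesis .
qed

lemma norm_csinc_square_le: "norm ((csinc z)\<^sup>2) \<le> exp (2 * pi) * exp (2 * pi * \<bar>Im z\<bar>)"
proof -
  have "norm ((csinc z)\<^sup>2) \<le> (exp pi * exp (pi * \<bar>Im z\<bar>))\<^sup>2"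
    unfolding norm_power by (intro power_mono norm_csinc_le) auto
  also have "\<dots> = exp (2 * pi) * exp (2 * pi * \<bar>Im z\<bar>)"
    by (simp add: power2_eq_square flip: exp_add)
  finally show ?thesis .
qed

lemma norm_mult_csinc_square_le: "norm (z * (csinc z)\<^sup>2) \<le> exp (2 * pi) * exp (2 * pi * \<bar>Im z\<bar>)"
proof -
  have "norm (z * (csinc z)\<^sup>2) = norm (z * csinc z) * norm (csinc z)"
    by (simp add: power2_eq_square norm_mult)
  also have "\<dots> \<le> exp (pi * \<bar>Im z\<bar>) * (exp pi * exp (pi * \<bar>Im z\<bar>))"
    by (intro mult_mono norm_mult_csinc_le norm_csinc_le) auto
  also have "\<dots> \<le> exp (2 * pi) * exp (2 * pi * \<bar>Im z\<bar>)"
    by (simp flip: exp_add)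
  finally show ?thesis .
qed

lemma csinc_shift_int:
  assumes "z \<notin> \<int>"
  shows "(csinc (z - of_int k))\<^sup>2 = (sin (of_real pi * z) / of_real pi)\<^sup>2 / (z - of_int k)\<^sup>2"
    "(z - of_int k) * (csinc (z - of_int k))\<^sup>2 = (sin (of_real pi * z) / of_real pi)\<^sup>2 / (z - of_int k)"
proof -
  have nz: "z - of_int k \<noteq> 0" using assms by auto
  have "sin (of_real pi * (z - of_int k)) ^ 2 = sin (of_real pi * z) ^ 2"
  proof -
    have s: "sin (of_real pi * of_int k :: complex) = 0" by (simp add: sin_pi_eq_0_iff)
    then have "cos (of_real pi * of_int k :: complex) ^ 2 = 1"
      by (metis sin_cos_squared_add add.left_neutral zero_power2)
    then show ?thesis using s by (simp add: right_diff_distrib sin_diff power_mult_distrib)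
  qed
  then show "(csinc (z - of_int k))\<^sup>2 = (sin (of_real pi * z) / of_real pi)\<^sup>2 / (z - of_int k)\<^sup>2"
    using nz by (simp add: csinc_def power_divide power_mult_distrib)
  then show "(z - of_int k) * (csinc (z - of_int k))\<^sup>2 = (sin (of_real pi * z) / of_real pi)\<^sup>2 / (z - of_int k)"
    using nz by (simp add: power2_eq_square)
qed

lemma (in exp_type_L1) exp_type_L1_shift: "exp_type_L1 (\<lambda>w. G (w + c)) \<tau>"
proof
  show "(\<lambda>w. G (w + c)) holomorphic_on UNIV"
    by (intro holomorphic_on_compose[of "\<lambda>w. w + c" UNIV G, unfolded o_def] holomorphic_intros holomorphic_on_subset[OF hol]) auto
  show "exp_type_at_most \<tau> (\<lambda>w. G (w + c))" unfolding exp_type_at_most_def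
  proof (intro allI impI)
    fix \<epsilon> :: real assume \<epsilon>: "\<epsilon> > 0"
    obtain C where C: "\<And>z. norm (G z) \<le> C * exp ((\<tau> + \<epsilon>) * norm z)"
      using type \<epsilon> unfolding exp_type_at_most_def by blast
    have C0: "C \<ge> 0" using order_trans[OF norm_ge_zero C[of 0]] by simp
    show "\<exists>C. \<forall>z. norm (G (z + c)) \<le> C * exp ((\<tau> + \<epsilon>) * norm z)"
    proof (intro exI allI)
      fix z
      have "norm (G (z + c)) \<le> C * exp ((\<tau> + \<epsilon>) * norm (z + c))" by (rule C)
      also have "\<dots> \<le> C * exp ((\<tau> + \<epsilon>) * (norm z + norm c))"
      proof -
        have "(\<tau> + \<epsilon>) * norm (z + c) \<le> (\<tau> + \<epsilon>) * (norm z + norm c)"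
          using \<tau> \<epsilon> by (intro mult_left_mono norm_triangle_ineq) auto
        then show ?thesis using C0 by (intro mult_left_mono) auto
      qed
      finally show "norm (G (z + c)) \<le> (C * exp ((\<tau> + \<epsilon>) * norm c)) * exp ((\<tau> + \<epsilon>) * norm z)"
        by (simp add: distrib_left exp_add mult_ac)
    qed
  qed
  have "integrable lborel (\<lambda>x. G (of_real (Re c + 1 * x) + \<i> * of_real (Im c)))"
    by (rule lborel_integrable_real_affine[OF integrable_line]) simp
  moreover have "of_real (Re c + 1 * x) + \<i> * of_real (Im c) = of_real x + c" for x
    by (simp add: complex_eq_iff)
  ultimately show "integrable lborel (\<lambda>x. G (of_real x + c))" by (simp only:)
qed (rule \<tau>)

lemma (in exp_type_L1) integral_shift: "(LINT x|lborel. G (of_real x + c)) = (LINT x|lborel. G (of_real x))"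
proof -
  have "(LINT x|lborel. G (of_real x)) = FT 0 0" by (simp add: FT_def e2pi_def)
  also have "\<dots> = FT 0 (Im c)" by (rule FT_shift[symmetric])
  also have "\<dots> = (LINT x|lborel. G (of_real x + \<i> * of_real (Im c)))" by (simp add: FT_def e2pi_def)
  also have "\<dots> = (LINT x|lborel. G (of_real (Re c + 1 * x) + \<i> * of_real (Im c)))"
    using lborel_integral_real_affine[of 1 "\<lambda>x. G (of_real x + \<i> * of_real (Im c))" "Re c"] by simp
  also have "\<dots> = (LINT x|lborel. G (of_real x + c))"
  proof -
    have "of_real (Re c + 1 * x) + \<i> * of_real (Im c) = of_real x + c" for x
      by (simp add: complex_eq_iff)
    then show ?thesis by (simp only:)
  qed
  finally show ?thesis by simp
qed

lemma exp_type_at_mostI: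
  assumes "\<tau> \<ge> 0" "\<And>z. norm (F z) \<le> C * exp (\<tau> * \<bar>Im z\<bar>)"
  shows "exp_type_at_most \<tau> F"
  unfolding exp_type_at_most_def
proof (intro allI impI exI)
  fix \<epsilon> :: real and z assume \<epsilon>: "\<epsilon> > 0"
  have C0: "C \<ge> 0" using order_trans[OF norm_ge_zero assms(2)[of 0]] by simp
  have "\<tau> * \<bar>Im z\<bar> \<le> (\<tau> + \<epsilon>) * norm z" using assms(1) \<epsilon> abs_Im_le_cmod[of z] by (intro mult_mono) auto
  then have "C * exp (\<tau> * \<bar>Im z\<bar>) \<le> C * exp ((\<tau> + \<epsilon>) * norm z)" using C0 by (intro mult_left_mono) auto
  then show "norm (F z) \<le> C * exp ((\<tau> + \<epsilon>) * norm z)" using assms(2)[of z] by linarith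
qed

lemma integrable_inverse_1_plus_square': "integrable lborel (\<lambda>x::real. 1 / (1 + x\<^sup>2))"
  using integrable_inverse_1_plus_square by (simp add: set_integrable_def inverse_eq_divide)

lemma exp_type_L1_csinc_square: "exp_type_L1 (\<lambda>z. (csinc z)\<^sup>2) (2 * pi)"
proof
  show "(\<lambda>z. (csinc z)\<^sup>2) holomorphic_on UNIV" by (intro holomorphic_intros csinc_holomorphic)
  show "exp_type_at_most (2 * pi) (\<lambda>z. (csinc z)\<^sup>2)"
    by (rule exp_type_at_mostI[OF _ norm_csinc_square_le]) simp
  have c: "continuous_on UNIV (\<lambda>x::real. (csinc (of_real x))\<^sup>2)"
    by (intro continuous_intros continuous_on_compose2[OF holomorphic_on_imp_continuous_on[OF csinc_holomorphic[of UNIV]]]) auto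
  show "integrable lborel (\<lambda>x. (csinc (of_real x))\<^sup>2)"
  proof (rule Bochner_Integration.integrable_bound[OF integrable_mult_right[OF integrable_inverse_1_plus_square', of "exp (2 * pi) + 1"]])
    show "(\<lambda>x. (csinc (of_real x))\<^sup>2) \<in> borel_measurable lborel"
      using borel_measurable_continuous_onI[OF c] by simp
    have "norm ((csinc (of_real x))\<^sup>2) \<le> (exp (2 * pi) + 1) * (1 / (1 + x\<^sup>2))" for x
    proof -
      have "norm ((csinc (of_real x))\<^sup>2) * x\<^sup>2 = (norm (of_real x * csinc (of_real x)))\<^sup>2"
        by (simp add: norm_mult norm_power power_mult_distrib)
      also have "\<dots> \<le> 1\<^sup>2" using norm_mult_csinc_le[of "of_real x"] by (intro power_mono) auto
      finally have "norm ((csinc (of_real x))\<^sup>2) * (1 + x\<^sup>2) \<le> exp (2 * pi) + 1"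
        using norm_csinc_square_le[of "of_real x"] by (simp add: distrib_left)
      moreover have "1 + x\<^sup>2 > 0" by (simp add: add_pos_nonneg)
      ultimately show ?thesis by (simp add: pos_le_divide_eq)
    qed
    then show "AE x in lborel. norm ((csinc (of_real x))\<^sup>2) \<le> norm ((exp (2 * pi) + 1) * (1 / (1 + x\<^sup>2)))"
      by (intro AE_I2) (metis abs_ge_self order_trans real_norm_def)
  qed
qed simp

text \<open>Poisson summation applied to a translate shows that the sum is the integral of the
  squared sinc function, the same number for every complex \<open>z\<close>. At \<open>z = 0\<close>
  a single term is nonzero and equals 1, which fixes that number.\<close>

lemma csinc_square_sum: "(\<lambda>N. \<Sum>k\<in>{- int N..int N}. (csinc (z - of_int k))\<^sup>2) \<longlonglongrightarrow> 1"
proof -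
  interpret S: exp_type_L1 "\<lambda>z. (csinc z)\<^sup>2" "2 * pi" by (rule exp_type_L1_csinc_square)
  have *: "(\<lambda>N. \<Sum>k\<in>{- int N..int N}. (csinc (z - of_int k))\<^sup>2) \<longlonglongrightarrow> (LINT x|lborel. (csinc (of_real x))\<^sup>2)" for z
  proof -
    interpret T: exp_type_L1 "\<lambda>w. (csinc (w + (- z)))\<^sup>2" "2 * pi" by (rule S.exp_type_L1_shift)
    have "csinc (of_int k + - z) = csinc (z - of_int k)" for k
      using csinc_minus[of "z - of_int k"] by simp
    then show ?thesis using T.poisson_summation[OF refl] unfolding S.integral_shift by simp
  qed
  have "(\<lambda>N. \<Sum>k\<in>{- int N..int N}. (csinc (0 - of_int k))\<^sup>2) = (\<lambda>N. 1)"
  proof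
    fix N
    have "(\<Sum>k\<in>{- int N..int N}. (csinc (0 - of_int k))\<^sup>2) = (\<Sum>k\<in>{- int N..int N}. if k = 0 then 1 else 0)"
      by (intro sum.cong refl) (simp add: csinc_of_int)
    then show "(\<Sum>k\<in>{- int N..int N}. (csinc (0 - of_int k))\<^sup>2) = 1" by simp
  qed
  then have "(LINT x|lborel. (csinc (of_real x))\<^sup>2) = 1" using *[of 0] by (simp add: LIMSEQ_const_iff)
  then show ?thesis using *[of z] by simp
qed

text \<open>The summand of the Hermite interpolation series at the node \<open>k\<close>: it has the
  value and, for nonzero \<open>k\<close>, the slope of \<open>exp (- lam * \<bar>x\<bar>)\<close>
  there. At the node 0 the sign makes the slope 0.\<close>

definition majorant_term :: "real \<Rightarrow> complex \<Rightarrow> int \<Rightarrow> complex" where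
  "majorant_term lam z k = of_real (exp (- lam * \<bar>of_int k\<bar>)) *
     ((csinc (z - of_int k))\<^sup>2 - of_real lam * of_int (sgn k) * ((z - of_int k) * (csinc (z - of_int k))\<^sup>2))"

text \<open>Taking the series as an integral over counting measure makes the lemmas on parametric
  integrals, in particular holomorphy, available for it.\<close>

definition majorant :: "real \<Rightarrow> complex \<Rightarrow> complex" where
  "majorant lam z = (LINT k|count_space UNIV. majorant_term lam z k)"

section \<open>Convergence, growth and symmetry of the cardinal series\<close>

lemma integrable_exp_int:
  fixes lam :: real
  assumes "lam > 0"
  shows "integrable (count_space UNIV) (\<lambda>k::int. exp (- lam * \<bar>of_int k\<bar>))"
proof (rule integrable_count_space_int)
  have "norm (exp (- lam)) < 1" using assms by simp
  then have "summable (\<lambda>n. exp (- lam) ^ n)" by (rule summable_geometric)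
  then have "summable (\<lambda>n. norm (exp (- lam * real n)))"
    by (simp add: exp_of_nat_mult[symmetric] mult.commute)
  then show "summable (\<lambda>n. norm (exp (- lam * \<bar>real_of_int (int n)\<bar>)))"
    "summable (\<lambda>n. norm (exp (- lam * \<bar>real_of_int (- int n)\<bar>)))" by simp_all
qed

lemma norm_majorant_term_le:
  assumes "lam > 0"
  shows "norm (majorant_term lam z k) \<le> exp (- lam * \<bar>of_int k\<bar>) * ((1 + lam) * exp (2 * pi) * exp (2 * pi * \<bar>Im z\<bar>))"
proof -
  define E where "E = exp (2 * pi) * exp (2 * pi * \<bar>Im z\<bar>)"
  have 1: "norm ((csinc (z - of_int k))\<^sup>2) \<le> E" "norm ((z - of_int k) * (csinc (z - of_int k))\<^sup>2) \<le> E"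
    using norm_csinc_square_le[of "z - of_int k"] norm_mult_csinc_square_le[of "z - of_int k"] by (auto simp: E_def)
  have "norm (of_real lam * of_int (sgn k) * ((z - of_int k) * (csinc (z - of_int k))\<^sup>2)) \<le> lam * 1 * E"
    unfolding norm_mult[of "of_real lam * of_int (sgn k)"] norm_mult[of "of_real lam"]
    using assms by (intro mult_mono 1) (auto simp: sgn_if)
  then have "norm ((csinc (z - of_int k))\<^sup>2 - of_real lam * of_int (sgn k) * ((z - of_int k) * (csinc (z - of_int k))\<^sup>2)) \<le> E + lam * E"
    using 1(1) norm_triangle_ineq4 by (smt (verit))
  then show ?thesis unfolding majorant_term_def norm_mult E_def
    by (intro mult_mono) (auto simp: algebra_simps)
qed

lemma integrable_majorant_term:
  assumes "lam > 0"
  shows "integrable (count_space UNIV) (majorant_term lam z)"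
  by (rule Bochner_Integration.integrable_bound[OF integrable_mult_left[OF integrable_exp_int[OF assms], of "(1 + lam) * exp (2 * pi) * exp (2 * pi * \<bar>Im z\<bar>)"]])
    (use norm_majorant_term_le[OF assms, of z] assms in \<open>auto simp: abs_mult\<close>)

lemma majorant_holomorphic:
  assumes "lam > 0"
  shows "majorant lam holomorphic_on UNIV"
  unfolding majorant_def
proof (rule holomorphic_parametric_integral)
  fix k :: int
  show "(\<lambda>z. majorant_term lam z k) holomorphic_on UNIV" unfolding majorant_term_def
    by (intro holomorphic_intros holomorphic_on_compose[of "\<lambda>z. z - of_int k" UNIV csinc, unfolded o_def] csinc_holomorphic)
next
  fix z :: complex
  show "\<exists>r>0. \<exists>g. integrable (count_space UNIV) g \<and> (\<forall>w\<in>UNIV. dist z w < r \<longrightarrow> (\<forall>k\<in>space (count_space UNIV). norm (majorant_term lam w k) \<le> g k))"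
  proof (intro exI[of _ 1] conjI exI[of _ "\<lambda>k. exp (- lam * \<bar>of_int k\<bar>) * ((1 + lam) * exp (2 * pi) * exp (2 * pi * (\<bar>Im z\<bar> + 1)))"] ballI impI)
    fix w k assume "dist z w < 1"
    then have "\<bar>Im w\<bar> \<le> \<bar>Im z\<bar> + 1" using abs_Im_le_cmod[of "z - w"] by (simp add: dist_norm)
    then have "exp (- lam * \<bar>of_int k\<bar>) * ((1 + lam) * exp (2 * pi) * exp (2 * pi * \<bar>Im w\<bar>)) \<le> exp (- lam * \<bar>of_int k\<bar>) * ((1 + lam) * exp (2 * pi) * exp (2 * pi * (\<bar>Im z\<bar> + 1)))"
      using assms by (intro mult_left_mono) auto
    then show "norm (majorant_term lam w k) \<le> exp (- lam * \<bar>of_int k\<bar>) * ((1 + lam) * exp (2 * pi) * exp (2 * pi * (\<bar>Im z\<bar> + 1)))"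
      using norm_majorant_term_le[OF assms, of w k] by linarith
  next
    show "integrable (count_space UNIV) (\<lambda>k. exp (- lam * \<bar>of_int k\<bar>) * ((1 + lam) * exp (2 * pi) * exp (2 * pi * (\<bar>Im z\<bar> + 1))))"
      by (rule integrable_mult_left[OF integrable_exp_int[OF assms]])
  qed auto
qed auto

lemma norm_majorant_le:
  assumes "lam > 0"
  shows "\<exists>C. \<forall>z. norm (majorant lam z) \<le> C * exp (2 * pi * \<bar>Im z\<bar>)"
proof (intro exI allI)
  fix z
  have "norm (majorant lam z) \<le> (LINT k|count_space UNIV. norm (majorant_term lam z k))"
    unfolding majorant_def by (rule integral_norm_bound)
  also have "\<dots> \<le> (LINT k|count_space (UNIV::int set). exp (- lam * \<bar>of_int k\<bar>) * ((1 + lam) * exp (2 * pi) * exp (2 * pi * \<bar>Im z\<bar>)))"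
    using assms by (intro integral_mono' integrable_mult_left integrable_exp_int norm_majorant_term_le) auto
  also have "\<dots> = (LINT k|count_space (UNIV::int set). exp (- lam * \<bar>of_int k\<bar>)) * ((1 + lam) * exp (2 * pi)) * exp (2 * pi * \<bar>Im z\<bar>)"
    by simp
  finally show "norm (majorant lam z) \<le> (LINT k|count_space (UNIV::int set). exp (- lam * \<bar>of_int k\<bar>)) * ((1 + lam) * exp (2 * pi)) * exp (2 * pi * \<bar>Im z\<bar>)" .
qed

lemma majorant_of_int:
  shows "majorant lam (of_int n) = of_real (exp (- lam * \<bar>of_int n\<bar>))"
proof -
  have t: "majorant_term lam (of_int n) k = (if k = n then of_real (exp (- lam * \<bar>of_int n\<bar>)) else 0)" for k
    using csinc_of_int[of "n - k"] by (auto simp: majorant_term_def)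
  show ?thesis unfolding majorant_def t
    by (subst lebesgue_integral_count_space_finite_support) (auto intro!: finite_subset[of _ "{n}"])
qed

lemma majorant_minus: "majorant lam (- z) = majorant lam z"
proof -
  have "majorant_term lam (- z) (- k) = majorant_term lam z k" for k
  proof -
    have "csinc (- z + of_int k) = csinc (z - of_int k)" using csinc_minus[of "z - of_int k"] by simp
    then show ?thesis by (simp add: majorant_term_def sgn_minus algebra_simps)
  qed
  then have "majorant lam z = (LINT k|count_space UNIV. majorant_term lam (- z) (- k))" by (simp add: majorant_def)
  also have "\<dots> = majorant lam (- z)" unfolding majorant_def
    by (rule integral_bij_count_space) (auto simp: bij_betw_def inj_on_def intro!: image_eqI[where x = "- _"])
  finally show ?thesis by simp
qed

lemma csinc_real: "csinc (of_real x) \<in> \<real>"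
  unfolding csinc_def of_real_mult[symmetric] sin_of_real by simp

lemma majorant_real: "majorant lam (of_real x) = of_real (Re (majorant lam (of_real x)))"
proof -
  have "majorant_term lam (of_real x) k \<in> \<real>" for k
    unfolding majorant_term_def using csinc_real[of "x - of_int k"] by (intro Reals_mult Reals_diff Reals_power) auto
  then have "majorant_term lam (of_real x) k = of_real (Re (majorant_term lam (of_real x) k))" for k
    by (simp add: of_real_Re)
  then have "majorant lam (of_real x) = (LINT k|count_space UNIV. of_real (Re (majorant_term lam (of_real x) k)))"
    unfolding majorant_def by presburger
  also have "\<dots> = of_real (LINT k|count_space UNIV. Re (majorant_term lam (of_real x) k))" by (rule integral_complex_of_real)
  finally show ?thesis by simp
qed

lemma infsum_eq_lebesgue_integral:
  fixes f :: "'a \<Rightarrow> complex"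
  assumes "integrable (count_space A) f"
  shows "(\<Sum>\<^sub>\<infinity>x\<in>A. f x) = (LINT x|count_space A. f x)"
  using infsetsum_infsum[of f A] assms by (simp add: abs_summable_on_def infsetsum_def)

lemma eventually_at_not_Ints: "\<forall>\<^sub>F w in at z. w \<notin> \<int>" for z :: complex
proof (cases "z \<in> \<int>")
  case True
  then obtain n :: int where n: "z = of_int n" by (auto elim: Ints_cases)
  have "w \<notin> \<int>" if w: "w \<noteq> z" "dist w z < 1" for w
  proof
    assume "w \<in> \<int>"
    then obtain m :: int where m: "w = of_int m" by (auto elim: Ints_cases)
    with w n have "norm (complex_of_int (m - n)) < 1" "m \<noteq> n" by (auto simp: dist_norm)
    then have "\<bar>m - n\<bar> < 1" by (simp only: norm_of_int)
    then show False using \<open>m \<noteq> n\<close> by simp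
  qed
  then show ?thesis unfolding eventually_at by (intro exI[of _ 1]) auto
next
  case False
  then have "\<forall>\<^sub>F w in nhds z. w \<in> - \<int>"
    by (intro eventually_nhds_in_open) (auto simp: open_Compl closed_Ints)
  then show ?thesis by (auto simp: eventually_at_filter elim: eventually_mono)
qed

text \<open>Off the integers the common factor is nonzero and can be pulled out of both series. At
  an integer \<open>remove_sings\<close> returns the limit, which the continuous function
  \<open>majorant\<close> attains.\<close>

lemma M_eq_majorant:
  assumes lam: "lam > 0"
  shows "M lam z = majorant lam z"
proof -
  define F where "F = (\<lambda>z::complex. (sin (of_real pi * z) / of_real pi)\<^sup>2 *
     ((\<Sum>\<^sub>\<infinity>k::int. of_real (exp (- lam * \<bar>of_int k\<bar>)) / (z - of_int k)\<^sup>2)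
      - of_real lam * (\<Sum>\<^sub>\<infinity>l::int. of_int (sgn l) * of_real (exp (- lam * \<bar>of_int l\<bar>)) / (z - of_int l))))"
  have F: "F w = majorant lam w" if w: "w \<notin> \<int>" for w
  proof -
    define s where "s = (sin (of_real pi * w) / of_real pi)\<^sup>2"
    have s0: "s \<noteq> 0" using w by (simp add: s_def sin_pi_eq_0_iff)
    define E where "E = (\<lambda>k::int. exp (- lam * \<bar>of_int k\<bar>))"
    define D where "D = exp (2 * pi) * exp (2 * pi * \<bar>Im w\<bar>)"
    have i1: "integrable (count_space UNIV) (\<lambda>k::int. of_real (E k) * (csinc (w - of_int k))\<^sup>2)"
      by (rule Bochner_Integration.integrable_bound[OF integrable_mult_left[OF integrable_exp_int[OF lam], of D]])
        (use norm_csinc_square_le[of "w - of_int _"] in \<open>auto simp: norm_mult E_def D_def abs_mult\<close>)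
    have i2: "integrable (count_space UNIV) (\<lambda>k::int. of_int (sgn k) * of_real (E k) * ((w - of_int k) * (csinc (w - of_int k))\<^sup>2))"
    proof (rule Bochner_Integration.integrable_bound[OF integrable_mult_left[OF integrable_exp_int[OF lam], of D]])
      show "AE k in count_space UNIV. norm (of_int (sgn k) * of_real (E k) * ((w - of_int k) * (csinc (w - of_int k))\<^sup>2)) \<le> norm (exp (- lam * \<bar>of_int k\<bar>) * D)"
      proof (rule AE_I2)
        fix k :: int
        have "norm (of_int (sgn k) * of_real (E k) * ((w - of_int k) * (csinc (w - of_int k))\<^sup>2)) \<le> (1 * E k) * D"
          unfolding norm_mult[of "of_int (sgn k) * of_real (E k)"] norm_mult[of "of_int (sgn k)"]
          using norm_mult_csinc_square_le[of "w - of_int k"]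
          by (intro mult_mono) (auto simp: sgn_if E_def D_def)
        then show "norm (of_int (sgn k) * of_real (E k) * ((w - of_int k) * (csinc (w - of_int k))\<^sup>2)) \<le> norm (exp (- lam * \<bar>of_int k\<bar>) * D)"
          by (simp add: E_def D_def abs_mult)
      qed
    qed auto
    have e1: "of_real (E k) / (w - of_int k)\<^sup>2 = (of_real (E k) * (csinc (w - of_int k))\<^sup>2) / s" for k
      using s0 unfolding csinc_shift_int(1)[OF w] s_def[symmetric] by simp
    have e2: "of_int (sgn k) * of_real (E k) / (w - of_int k) = of_int (sgn k) * of_real (E k) * ((w - of_int k) * (csinc (w - of_int k))\<^sup>2) / s" for k
      using s0 unfolding csinc_shift_int(2)[OF w] s_def[symmetric] by simp
    have "(\<Sum>\<^sub>\<infinity>k::int. of_real (E k) / (w - of_int k)\<^sup>2) = (LINT k|count_space UNIV. of_real (E k) * (csinc (w - of_int k))\<^sup>2) / s"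
      unfolding e1 by (subst infsum_eq_lebesgue_integral) (use i1 in auto)
    have "(\<Sum>\<^sub>\<infinity>k::int. of_int (sgn k) * of_real (E k) / (w - of_int k)) = (LINT k|count_space UNIV. of_int (sgn k) * of_real (E k) * ((w - of_int k) * (csinc (w - of_int k))\<^sup>2)) / s"
      unfolding e2 by (subst infsum_eq_lebesgue_integral) (use i2 in auto)
    have "F w = s * ((\<Sum>\<^sub>\<infinity>k::int. of_real (E k) / (w - of_int k)\<^sup>2)
      - of_real lam * (\<Sum>\<^sub>\<infinity>k::int. of_int (sgn k) * of_real (E k) / (w - of_int k)))"
      by (simp add: F_def s_def E_def)
    have "F w = (LINT k|count_space UNIV. of_real (E k) * (csinc (w - of_int k))\<^sup>2)
       - of_real lam * (LINT k|count_space UNIV. of_int (sgn k) * of_real (E k) * ((w - of_int k) * (csinc (w - of_int k))\<^sup>2))"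
    proof -
      have "s * (A / s - l * (B / s)) = A - l * B" for A B l
        using s0 by (simp add: right_diff_distrib)
      then show ?thesis
        using \<open>(\<Sum>\<^sub>\<infinity>k::int. of_real (E k) / (w - of_int k)\<^sup>2) = _\<close>
          \<open>(\<Sum>\<^sub>\<infinity>k::int. of_int (sgn k) * of_real (E k) / (w - of_int k)) = _\<close> \<open>F w = _\<close>
        by (simp only:)
    qed
    also have "\<dots> = (LINT k|count_space UNIV. of_real (E k) * (csinc (w - of_int k))\<^sup>2
       - of_real lam * (of_int (sgn k) * of_real (E k) * ((w - of_int k) * (csinc (w - of_int k))\<^sup>2)))"
      using i1 i2 by (subst Bochner_Integration.integral_diff) auto
    also have "\<dots> = majorant lam w" unfolding majorant_def majorant_term_def E_def
      by (intro Bochner_Integration.integral_cong refl) (simp add: algebra_simps)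
    finally show ?thesis .
  qed
  have "isCont (majorant lam) z"
    using holomorphic_on_imp_continuous_on[OF majorant_holomorphic[OF lam]] by (simp add: continuous_on_eq_continuous_at)
  then have "majorant lam \<midarrow>z\<rightarrow> majorant lam z" by (simp add: isCont_def)
  moreover have "\<forall>\<^sub>F w in at z. majorant lam w = F w"
  proof -
    show ?thesis using eventually_at_not_Ints by eventually_elim (simp add: F)
  qed
  ultimately have "F \<midarrow>z\<rightarrow> majorant lam z" by (rule Lim_transform_eventually)
  then show ?thesis unfolding M_def F_def[symmetric] by (rule remove_sings_eqI)
qed

section \<open>Laplace representation in a half-plane\<close>

text \<open>For \<open>0 < t < 1\<close>, \<open>(\<pi> / sin (\<pi> t))\<^sup>2\<close> is the bilateral Laplace transform of this function, which is
  why it governs the gap between the majorant and the exponential.\<close>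

definition bernoulli_fun :: "real \<Rightarrow> real" where
  "bernoulli_fun u = u / (1 - exp (- u))"

lemma bernoulli_fun_minus: "bernoulli_fun (- u) = bernoulli_fun u - u"
proof (cases "u = 0")
  case False
  then have "exp u \<noteq> 1" by simp
  then show ?thesis by (simp add: bernoulli_fun_def exp_minus field_simps)
qed (simp add: bernoulli_fun_def)

lemma sinh_ge_self: "u \<le> sinh u" if "u \<ge> 0" for u :: real
proof -
  have "sinh 0 - 0 \<le> sinh u - u"
    by (rule DERIV_nonneg_imp_nondecreasing[OF that]) (auto intro!: exI derivative_eq_intros simp: cosh_real_ge_1)
  then show ?thesis by simp
qed

lemma sinh_le_mult_cosh: "sinh u \<le> u * cosh u" if "u \<ge> 0" for u :: real
proof -
  have "0 * cosh 0 - sinh 0 \<le> u * cosh u - sinh u"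
    by (rule DERIV_nonneg_imp_nondecreasing[OF that]) (auto intro!: exI derivative_eq_intros)
  then show ?thesis by simp
qed

text \<open>With \<open>x = exp (- u)\<close>, the three bounds on the slope amount to u \<le> sinh
  u, 1 - u \<le> exp(-u) and sinh u \<le> u cosh u, in this order. The lower bound 1/2 is what makes
  the kernel nonnegative; the two upper bounds control it for large and for small
  \<open>lam\<close>.\<close>

lemma bernoulli_fun_deriv:
  assumes u: "u > 0"
  defines "D \<equiv> (1 - exp (- u) - u * exp (- u)) / (1 - exp (- u))\<^sup>2"
  shows "(bernoulli_fun has_real_derivative D) (at u)" "1 / 2 \<le> D" "D \<le> 1" "D \<le> 1 / 2 + u / 2"
proof -
  define x where "x = exp (- u)"
  have x: "0 < x" "x < 1" using u by (auto simp: x_def)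
  then have x1: "0 < (1 - x)\<^sup>2" by simp
  have ex: "exp u = 1 / x" by (simp add: x_def exp_minus inverse_eq_divide)
  show "(bernoulli_fun has_real_derivative D) (at u)"
    unfolding bernoulli_fun_def D_def using u
    by (auto intro!: derivative_eq_intros simp: power2_eq_square)
  have "2 * u \<le> 1 / x - x" using sinh_ge_self[of u] u by (simp add: sinh_def ex[symmetric] x_def[symmetric])
  then have "2 * u * x \<le> (1 / x - x) * x" using x by (intro mult_right_mono) auto
  then have a: "2 * u * x \<le> 1 - x\<^sup>2" using x by (simp add: left_diff_distrib power2_eq_square)
  show "1 / 2 \<le> D" unfolding D_def x_def[symmetric] using x1 a
    by (simp add: pos_le_divide_eq power2_eq_square algebra_simps)
  have "1 - u \<le> x" using exp_ge_add_one_self[of "- u"] by (simp add: x_def)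
  then have "x * (1 - u) \<le> x * x" using x by (intro mult_left_mono) auto
  then show "D \<le> 1" unfolding D_def x_def[symmetric] using x1
    by (simp add: pos_divide_le_eq power2_eq_square algebra_simps)
  have "(1 / x - x) \<le> u * (1 / x + x)" using sinh_le_mult_cosh[of u] u
    by (simp add: sinh_def cosh_def ex[symmetric] x_def[symmetric])
  then have "(1 / x - x) * x \<le> u * (1 / x + x) * x" using x by (intro mult_right_mono) auto
  then have "1 - x\<^sup>2 \<le> u * (1 + x\<^sup>2)" using x by (simp add: algebra_simps power2_eq_square)
  then have "2 * (1 - x - u * x) \<le> (1 + u) * (1 - x)\<^sup>2" by (simp add: algebra_simps power2_eq_square)
  then have "(1 - x - u * x) \<le> (1 / 2 + u / 2) * (1 - x)\<^sup>2" by (simp add: field_simps)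
  then show "D \<le> 1 / 2 + u / 2" unfolding D_def x_def[symmetric] using x1 by (simp add: pos_divide_le_eq)
qed

lemma bernoulli_fun_increment:
  assumes "0 < b" "b \<le> a"
  shows "(a - b) / 2 \<le> bernoulli_fun a - bernoulli_fun b" "bernoulli_fun a - bernoulli_fun b \<le> a - b"
    "bernoulli_fun a - bernoulli_fun b \<le> (a - b) / 2 + (a\<^sup>2 - b\<^sup>2) / 4"
proof -
  define D where "D = (\<lambda>u::real. (1 - exp (- u) - u * exp (- u)) / (1 - exp (- u))\<^sup>2)"
  have d: "(bernoulli_fun has_real_derivative D u) (at u)" "1 / 2 \<le> D u" "D u \<le> 1" "D u \<le> 1 / 2 + u / 2"
    if "u > 0" for u
    unfolding D_def by (rule bernoulli_fun_deriv[OF that])+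
  have "bernoulli_fun b - b / 2 \<le> bernoulli_fun a - a / 2"
  proof (rule DERIV_nonneg_imp_nondecreasing[OF assms(2)], intro exI conjI)
    fix u assume "b \<le> u" "u \<le> a"
    then have u: "u > 0" using assms by simp
    show "((\<lambda>u. bernoulli_fun u - u / 2) has_real_derivative (D u - 1 / 2)) (at u)"
      by (auto intro!: derivative_eq_intros d(1)[OF u])
    show "D u - 1 / 2 \<ge> 0" using d(2)[OF u] by simp
  qed
  then show "(a - b) / 2 \<le> bernoulli_fun a - bernoulli_fun b" by (simp add: field_simps)
  have "b - bernoulli_fun b \<le> a - bernoulli_fun a"
  proof (rule DERIV_nonneg_imp_nondecreasing[OF assms(2)], intro exI conjI)
    fix u assume "b \<le> u" "u \<le> a"
    then have u: "u > 0" using assms by simp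
    show "((\<lambda>u. u - bernoulli_fun u) has_real_derivative (1 - D u)) (at u)"
      by (auto intro!: derivative_eq_intros d(1)[OF u])
    show "1 - D u \<ge> 0" using d(3)[OF u] by simp
  qed
  then show "bernoulli_fun a - bernoulli_fun b \<le> a - b" by simp
  have "b / 2 + b\<^sup>2 / 4 - bernoulli_fun b \<le> a / 2 + a\<^sup>2 / 4 - bernoulli_fun a"
  proof (rule DERIV_nonneg_imp_nondecreasing[OF assms(2)], intro exI conjI)
    fix u assume "b \<le> u" "u \<le> a"
    then have u: "u > 0" using assms by simp
    show "((\<lambda>u. u / 2 + u\<^sup>2 / 4 - bernoulli_fun u) has_real_derivative (1 / 2 + u / 2 - D u)) (at u)"
      by (auto intro!: derivative_eq_intros d(1)[OF u])
    show "1 / 2 + u / 2 - D u \<ge> 0" using d(4)[OF u] by simp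
  qed
  then show "bernoulli_fun a - bernoulli_fun b \<le> (a - b) / 2 + (a\<^sup>2 - b\<^sup>2) / 4" by (simp add: field_simps)
qed

text \<open>The value at \<open>w = lam\<close> is set to \<open>0\<close> because \<open>bernoulli_fun 0 = 0\<close> is a junk value
  (the limit there is \<open>1\<close>).\<close>

definition laplace_kernel :: "real \<Rightarrow> real \<Rightarrow> real" where
  "laplace_kernel lam w = (if w = lam then 0 else bernoulli_fun (w + lam) - bernoulli_fun (w - lam) - lam)"

text \<open>The reflection formula replaces \<open>w - lam\<close> by its absolute value
  \<open>b\<close>, and the kernel becomes the increment of \<open>bernoulli_fun u - u / 2\<close>
  between \<open>b\<close> and \<open>w + lam\<close>. The slope of that function is nonnegative and
  at most both 1/2 and u/2, which integrates to the bounds \<open>w\<close> and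
  \<open>w * lam\<close>.\<close>

lemma laplace_kernel_bounds:
  assumes "lam > 0" "w \<ge> 0"
  shows "0 \<le> laplace_kernel lam w" "laplace_kernel lam w \<le> w * min 1 lam"
proof -
  have "0 \<le> laplace_kernel lam w \<and> laplace_kernel lam w \<le> w \<and> laplace_kernel lam w \<le> w * lam"
  proof (cases "w = lam")
    case False
    define b where "b = \<bar>w - lam\<bar>"
    have b: "0 < b" "b \<le> w + lam" using False assms by (auto simp: b_def)
    have "bernoulli_fun (w - lam) = bernoulli_fun b + (w - lam - b) / 2"
      using bernoulli_fun_minus[of "w - lam"] by (cases "w \<ge> lam") (auto simp: b_def field_simps)
    then have k: "laplace_kernel lam w = bernoulli_fun (w + lam) - bernoulli_fun b - (w + lam - b) / 2"
      using False by (simp add: laplace_kernel_def field_simps)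
    have b2: "b\<^sup>2 = (w - lam)\<^sup>2" by (simp add: b_def)
    have 1: "0 \<le> laplace_kernel lam w" "laplace_kernel lam w \<le> (w + lam - b) / 2"
      "laplace_kernel lam w \<le> ((w + lam)\<^sup>2 - b\<^sup>2) / 4"
      using bernoulli_fun_increment[OF b] unfolding k by (simp_all add: field_simps)
    moreover have "(w + lam - b) / 2 \<le> w" by (auto simp: b_def)
    moreover have "((w + lam)\<^sup>2 - b\<^sup>2) / 4 = w * lam" unfolding b2 by (simp add: power2_eq_square algebra_simps)
    ultimately show ?thesis by linarith
  qed (use assms in \<open>auto simp: laplace_kernel_def\<close>)
  then show "0 \<le> laplace_kernel lam w" "laplace_kernel lam w \<le> w * min 1 lam" by (auto simp: min_def)
qed

lemma bernoulli_fun_measurable [measurable]: "bernoulli_fun \<in> borel_measurable borel"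
  unfolding bernoulli_fun_def by measurable

section \<open>Integral forms of the one-sided sums on the unit interval\<close>

lemma has_bochner_integral_exp_Ici:
  assumes a: "a > 0"
  shows "has_bochner_integral lborel (\<lambda>w::real. indicator {0..} w * exp (- a * w)) (1 / a)"
    and "has_bochner_integral lborel (\<lambda>w::real. indicator {0..} w * (w * exp (- a * w))) (1 / a\<^sup>2)"
proof -
  have "(\<integral>\<^sup>+w. ennreal (exp (- a * w)) * indicator {0..} w \<partial>lborel) = ennreal (0 - (- exp (- a * 0) / a))"
  proof (rule nn_integral_FTC_atLeast)
    show "((\<lambda>w. - exp (- a * w) / a) \<longlongrightarrow> 0) at_top" using a by real_asymp
    show "((\<lambda>w. - exp (- a * w) / a) has_real_derivative exp (- a * w)) (at w)" for w
      using a by (auto intro!: derivative_eq_intros)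
  qed auto
  then have 1: "(\<integral>\<^sup>+w. ennreal (indicator {0..} w * exp (- a * w)) \<partial>lborel) = ennreal (1 / a)"
    by (simp add: ennreal_mult' mult.commute ennreal_indicator)
  have pt: "ennreal (w * exp (- a * w)) * indicator {0..} w = ennreal (indicator {0..} w * (w * exp (- a * w)))" for w
    by (simp split: split_indicator)
  show "has_bochner_integral lborel (\<lambda>w::real. indicator {0..} w * exp (- a * w)) (1 / a)"
    by (rule has_bochner_integral_nn_integral[OF _ _ _ 1]) (use a in auto)
  have "(\<integral>\<^sup>+w. ennreal (w * exp (- a * w)) * indicator {0..} w \<partial>lborel) = ennreal (0 - (- (0 / a + 1 / a\<^sup>2) * exp (- a * 0)))"
  proof (rule nn_integral_FTC_atLeast)
    show "((\<lambda>w. - (w / a + 1 / a\<^sup>2) * exp (- a * w)) \<longlongrightarrow> 0) at_top" using a by real_asymp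
    show "((\<lambda>w. - (w / a + 1 / a\<^sup>2) * exp (- a * w)) has_real_derivative w * exp (- a * w)) (at w)" for w
      using a by (auto intro!: derivative_eq_intros simp: field_simps power2_eq_square)
  qed auto
  then have 2: "(\<integral>\<^sup>+w. ennreal (indicator {0..} w * (w * exp (- a * w))) \<partial>lborel) = ennreal (1 / a\<^sup>2)"
    unfolding pt by simp
  show "has_bochner_integral lborel (\<lambda>w::real. indicator {0..} w * (w * exp (- a * w))) (1 / a\<^sup>2)"
    by (rule has_bochner_integral_nn_integral[OF _ _ _ 2]) (use a in \<open>auto simp: indicator_def\<close>)
qed

text \<open>The denominator is expanded in a geometric series and integrated termwise. For
  \<open>q = 1\<close>, which the partition of unity needs, the expansion breaks down at
  \<open>w = 0\<close>; hence the almost everywhere statements.\<close>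

lemma geometric_laplace_sums:
  fixes h :: "real \<Rightarrow> real" and J :: "real \<Rightarrow> real"
  assumes h: "\<And>a. a > 0 \<Longrightarrow> has_bochner_integral lborel (\<lambda>w. indicator {0..} w * (h w * exp (- a * w))) (J a)"
    and h0: "\<And>w. w \<ge> 0 \<Longrightarrow> h w \<ge> 0"
    and q: "0 < q" "q \<le> 1" and t: "t > 0" and sm: "summable (\<lambda>k. q ^ k * J (t + real k))"
  shows "integrable lborel (\<lambda>w. indicator {0..} w * (h w * exp (- t * w) / (1 - q * exp (- w))))"
    and "(\<lambda>k. q ^ k * J (t + real k)) sums (LINT w|lborel. indicator {0..} w * (h w * exp (- t * w) / (1 - q * exp (- w))))"
proof -
  define f where "f = (\<lambda>k w. q ^ k * (indicator {0..} w * (h w * exp (- (t + real k) * w))))"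
  have hb: "has_bochner_integral lborel (f k) (q ^ k * J (t + real k))" for k
    unfolding f_def using t by (intro has_bochner_integral_mult_right h) (auto intro: add_pos_nonneg)
  have f0: "f k w \<ge> 0" for k w using q h0 by (auto simp: f_def indicator_def)
  have fi: "integrable lborel (f k)" and fv: "(LINT w|lborel. f k w) = q ^ k * J (t + real k)" for k
    using hb by (auto simp: has_bochner_integral_iff)
  have fsums: "(\<lambda>k. f k w) sums (indicator {0..} w * (h w * exp (- t * w) / (1 - q * exp (- w))))" if w: "w \<noteq> 0" for w
  proof (cases "w > 0")
    case True
    have "norm (q * exp (- w)) < 1"
    proof -
      have "q * exp (- w) \<le> 1 * exp (- w)" using q by (intro mult_right_mono) auto
      also have "\<dots> < 1" using True by simp
      finally show ?thesis using q by simp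
    qed
    then have "(\<lambda>k. (h w * exp (- t * w)) * (q * exp (- w)) ^ k) sums ((h w * exp (- t * w)) * (1 / (1 - q * exp (- w))))"
      by (intro sums_mult geometric_sums)
    moreover have "f k w = (h w * exp (- t * w)) * (q * exp (- w)) ^ k" for k
    proof -
      have "exp (- (t + real k) * w) = exp (- t * w) * exp (- w) ^ k"
        by (simp add: exp_of_nat_mult[symmetric] algebra_simps flip: exp_add)
      then show ?thesis using True by (simp add: f_def power_mult_distrib)
    qed
    ultimately show ?thesis using True by simp
  next
    case False
    then show ?thesis using w by (simp add: f_def)
  qed
  have ae: "AE w in lborel. (w::real) \<noteq> 0" by (rule AE_lborel_singleton)
  have s1: "AE w in lborel. summable (\<lambda>k. norm (f k w))"
    using ae by eventually_elim (use fsums f0 in \<open>auto simp: sums_iff\<close>)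
  have s2: "summable (\<lambda>k. LINT w|lborel. norm (f k w))" using sm by (simp add: f0 fv)
  note S = integrable_suminf[OF fi s1 s2] sums_integral[OF fi s1 s2]
  have eq: "AE w in lborel. (\<Sum>k. f k w) = indicator {0..} w * (h w * exp (- t * w) / (1 - q * exp (- w)))"
    using ae by eventually_elim (use fsums in \<open>auto simp: sums_iff\<close>)
  have m: "(\<lambda>w. indicator {0..} w * h w) \<in> borel_measurable borel"
  proof -
    have "(\<lambda>w. f 0 w * exp (t * w)) \<in> borel_measurable borel"
      using borel_measurable_integrable[OF fi[of 0]] by measurable
    moreover have "f 0 w * exp (t * w) = indicator {0..} w * h w" for w
      by (simp add: f_def flip: exp_add)
    ultimately show ?thesis by simp
  qed
  have m': "(\<lambda>w. indicator {0..} w * (h w * exp (- t * w) / (1 - q * exp (- w)))) \<in> borel_measurable lborel"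
  proof -
    have "(\<lambda>w. (indicator {0..} w * h w) * (exp (- t * w) / (1 - q * exp (- w)))) \<in> borel_measurable borel"
      using m by measurable
    then show ?thesis by (simp add: mult.assoc)
  qed
  show "integrable lborel (\<lambda>w. indicator {0..} w * (h w * exp (- t * w) / (1 - q * exp (- w))))"
    using integrable_cong_AE[OF _ m' eq] S(1) by (auto dest: borel_measurable_integrable)
  show "(\<lambda>k. q ^ k * J (t + real k)) sums (LINT w|lborel. indicator {0..} w * (h w * exp (- t * w) / (1 - q * exp (- w))))"
    using S(2) integral_cong_AE[OF _ m' eq] borel_measurable_integrable[OF S(1)] unfolding fv by simp
qed

text \<open>The Lerch sum of \<open>q ^ k / (t + k)\<^sup>2\<close> as an integral;
  \<open>lap0\<close> is the one with a simple power. The factor 1 in \<open>lap0\<close> keeps both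
  in the shape of \<open>geometric_laplace_sums\<close>.\<close>

definition lap1 :: "real \<Rightarrow> real \<Rightarrow> real" where
  "lap1 q t = (LINT w|lborel. indicator {0..} w * (w * exp (- t * w) / (1 - q * exp (- w))))"

definition lap0 :: "real \<Rightarrow> real \<Rightarrow> real" where
  "lap0 q t = (LINT w|lborel. indicator {0..} w * (1 * exp (- t * w) / (1 - q * exp (- w))))"

lemma lap1_sums:
  assumes q: "0 < q" "q \<le> 1" and t: "t > 0"
  shows "integrable lborel (\<lambda>w. indicator {0..} w * (w * exp (- t * w) / (1 - q * exp (- w))))"
    and "(\<lambda>k. q ^ k * (1 / (t + real k)\<^sup>2)) sums lap1 q t"
proof -
  have "summable (\<lambda>k. q ^ k * (1 / (t + real k)\<^sup>2))"
  proof (rule summable_comparison_test_ev)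
    show "summable (\<lambda>k. 1 / real k ^ 2)" using inverse_power_summable[of 2] by (simp add: inverse_eq_divide)
    show "\<forall>\<^sub>F k in sequentially. norm (q ^ k * (1 / (t + real k)\<^sup>2)) \<le> 1 / real k ^ 2"
      using eventually_gt_at_top[of "0::nat"]
    proof eventually_elim
      case (elim k)
      have "q ^ k * (1 / (t + real k)\<^sup>2) \<le> 1 * (1 / real k ^ 2)"
        using q t elim by (intro mult_mono power_le_one divide_left_mono power_mono) auto
      then show ?case using q by simp
    qed
  qed
  from geometric_laplace_sums[OF has_bochner_integral_exp_Ici(2) _ q t this]
  show "integrable lborel (\<lambda>w. indicator {0..} w * (w * exp (- t * w) / (1 - q * exp (- w))))"
    "(\<lambda>k. q ^ k * (1 / (t + real k)\<^sup>2)) sums lap1 q t" by (auto simp: lap1_def)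
qed

lemma lap0_sums:
  assumes q: "0 < q" "q < 1" and t: "t > 0"
  shows "integrable lborel (\<lambda>w. indicator {0..} w * (1 * exp (- t * w) / (1 - q * exp (- w))))"
    and "(\<lambda>k. q ^ k * (1 / (t + real k))) sums lap0 q t"
proof -
  have "summable (\<lambda>k. q ^ k * (1 / (t + real k)))"
  proof (rule summable_comparison_test')
    show "summable (\<lambda>k. q ^ k * (1 / t))" using q by (intro summable_mult2 summable_geometric) auto
    show "norm (q ^ k * (1 / (t + real k))) \<le> q ^ k * (1 / t)" if "k \<ge> 0" for k
      using q t by (auto intro!: mult_left_mono divide_left_mono simp: abs_mult)
  qed
  moreover have "has_bochner_integral lborel (\<lambda>w. indicator {0..} w * (1 * exp (- a * w))) (1 / a)" if "a > 0" for a :: real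
    using has_bochner_integral_exp_Ici(1)[OF that] by simp
  ultimately show "integrable lborel (\<lambda>w. indicator {0..} w * (1 * exp (- t * w) / (1 - q * exp (- w))))"
    "(\<lambda>k. q ^ k * (1 / (t + real k))) sums lap0 q t"
    unfolding lap0_def using geometric_laplace_sums[of "\<lambda>_. 1" "\<lambda>a. 1 / a" q t] q t by auto
qed

text \<open>For a point \<open>t\<close> of the unit interval the nodes 0, -1, -2, ... lie to its
  left and the nodes 1, 2, ... to its right. Both halves are sums over distances, starting at
  \<open>t\<close> and at \<open>1 - t\<close>.\<close>

lemma sum_int_split:
  fixes f :: "int \<Rightarrow> 'a::comm_monoid_add"
  shows "(\<Sum>k\<in>{- int N..int N}. f k) = (\<Sum>n<Suc N. f (- int n)) + (\<Sum>j<N. f (int (Suc j)))"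
proof -
  have "(\<Sum>n=1..N. f (int n) + f (- int n)) = (\<Sum>j<N. f (int (Suc j))) + (\<Sum>j<N. f (- int (Suc j)))"
    unfolding sum.distrib[symmetric] by (induction N) (auto simp del: of_nat_Suc)
  then show ?thesis unfolding sum_int_symmetric sum.lessThan_Suc_shift by (simp add: ac_simps del: of_nat_Suc)
qed

lemma sum_int_sums:
  fixes f :: "int \<Rightarrow> 'a::real_normed_vector"
  assumes "(\<lambda>n. f (- int n)) sums a" "(\<lambda>j. f (int (Suc j))) sums b"
  shows "(\<lambda>N. \<Sum>k\<in>{- int N..int N}. f k) \<longlonglongrightarrow> a + b"
  unfolding sum_int_split
  by (intro tendsto_add LIMSEQ_Suc assms[unfolded sums_def])

text \<open>The partition of unity restricted to the unit interval. It is used to write the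
  exponential as a multiple of the squared sine, so that it can be subtracted from the majorant
  inside one Laplace integral.\<close>

lemma csinc_square_laplace:
  assumes t: "0 < t" "t < 1"
  defines "s \<equiv> (sin (pi * t) / pi)\<^sup>2"
  shows "s * (lap1 1 t + lap1 1 (1 - t)) = 1"
proof -
  define f where "f = (\<lambda>k::int. 1 / (t - of_int k)\<^sup>2)"
  have tZ: "complex_of_real t \<notin> \<int>"
  proof
    assume "complex_of_real t \<in> \<int>"
    then obtain n :: int where "complex_of_real t = of_int n" by (auto elim: Ints_cases)
    then have "t = of_int n" by (metis of_real_eq_iff of_real_of_int_eq)
    with t show False by auto
  qed
  have c: "(csinc (of_real t - of_int k))\<^sup>2 = of_real (s * f k)" for k
    unfolding csinc_shift_int(1)[OF tZ] s_def f_def of_real_mult[symmetric] sin_of_real by simp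
  have "(\<lambda>N. \<Sum>k\<in>{- int N..int N}. complex_of_real (s * f k)) \<longlonglongrightarrow> of_real 1"
    using csinc_square_sum[of "of_real t"] unfolding c by simp
  then have 1: "(\<lambda>N. \<Sum>k\<in>{- int N..int N}. s * f k) \<longlonglongrightarrow> 1"
    unfolding of_real_sum[symmetric] tendsto_of_real_iff .
  have "(\<lambda>n. f (- int n)) sums lap1 1 t"
    using lap1_sums(2)[of 1 t] t by (simp add: f_def)
  moreover have "(\<lambda>j. f (int (Suc j))) sums lap1 1 (1 - t)"
  proof -
    have "f (int (Suc j)) = 1 ^ j * (1 / (1 - t + real j)\<^sup>2)" for j
      by (simp add: f_def power2_commute[of t])
        (simp add: algebra_simps)
    then show ?thesis using lap1_sums(2)[of 1 "1 - t"] t by simp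
  qed
  ultimately have "(\<lambda>N. \<Sum>k\<in>{- int N..int N}. f k) \<longlonglongrightarrow> lap1 1 t + lap1 1 (1 - t)" by (rule sum_int_sums)
  then have "(\<lambda>N. s * (\<Sum>k\<in>{- int N..int N}. f k)) \<longlonglongrightarrow> s * (lap1 1 t + lap1 1 (1 - t))"
    by (rule tendsto_mult[OF tendsto_const])
  then show ?thesis using 1 LIMSEQ_unique unfolding sum_distrib_left by blast
qed

text \<open>The sign of the node and the sign of \<open>t - k\<close> combine so that the simple
  poles contribute with the same sign from both sides. The term \<open>- 1 / t\<close> is there
  because \<open>sgn 0 = 0\<close> removes the node 0, which \<open>lap0\<close> includes; the
  factor \<open>q\<close> reflects that the right half starts at node 1.\<close>

lemma majorant_unit_interval:
  assumes t: "0 < t" "t < 1" and lam: "lam > 0"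
  defines "s \<equiv> (sin (pi * t) / pi)\<^sup>2" and "q \<equiv> exp (- lam)"
  shows "majorant lam (of_real t) =
    of_real (s * (lap1 q t + lam * (lap0 q t - 1 / t) + q * (lap1 q (1 - t) + lam * lap0 q (1 - t))))"
proof -
  define f where "f = (\<lambda>k::int. exp (- lam * \<bar>of_int k\<bar>) * (1 / (t - of_int k)\<^sup>2 - lam * of_int (sgn k) * (1 / (t - of_int k))))"
  have q: "0 < q" "q < 1" using lam by (auto simp: q_def)
  have tZ: "complex_of_real t \<notin> \<int>"
  proof
    assume "complex_of_real t \<in> \<int>"
    then obtain n :: int where "complex_of_real t = of_int n" by (auto elim: Ints_cases)
    then have "t = of_int n" by (metis of_real_eq_iff of_real_of_int_eq)
    with t show False by auto
  qed
  have s': "(sin (of_real pi * of_real t) / of_real pi)\<^sup>2 = complex_of_real s"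
    unfolding s_def of_real_mult[symmetric] sin_of_real by simp
  have c: "majorant_term lam (of_real t) k = of_real (s * f k)" for k
    unfolding majorant_term_def csinc_shift_int(2)[OF tZ] unfolding csinc_shift_int(1)[OF tZ] s' f_def
    by (simp add: right_diff_distrib mult_ac)
  have "(\<lambda>N. \<Sum>k\<in>{- int N..int N}. complex_of_real (s * f k)) \<longlonglongrightarrow> majorant lam (of_real t)"
    using sum_int_tendsto[OF integrable_majorant_term[OF lam, of "of_real t"]]
    unfolding c majorant_def .
  moreover have pw: "q ^ n = exp (- lam * real n)" for n
    by (simp add: q_def exp_of_nat_mult[symmetric] mult.commute)
  have "(\<lambda>n. f (- int n)) sums (lap1 q t + lam * (lap0 q t - 1 / t))"
  proof -
    have "(\<lambda>n. if n = 0 then 1 / t else 0) sums (1 / t)" by (rule sums_single)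
    with lap1_sums(2)[of q t] lap0_sums(2)[of q t] q t
    have "(\<lambda>n. q ^ n * (1 / (t + real n)\<^sup>2) + lam * (q ^ n * (1 / (t + real n)) - (if n = 0 then 1 / t else 0)))
       sums (lap1 q t + lam * (lap0 q t - 1 / t))" by (intro sums_add sums_mult sums_diff) auto
    moreover have "f (- int n) = q ^ n * (1 / (t + real n)\<^sup>2) + lam * (q ^ n * (1 / (t + real n)) - (if n = 0 then 1 / t else 0))" for n
      by (cases "n = 0") (auto simp: f_def pw sgn_if algebra_simps)
    ultimately show ?thesis by simp
  qed
  moreover have "(\<lambda>j. f (int (Suc j))) sums (q * (lap1 q (1 - t) + lam * lap0 q (1 - t)))"
  proof -
    have "(\<lambda>j. q * (q ^ j * (1 / (1 - t + real j)\<^sup>2) + lam * (q ^ j * (1 / (1 - t + real j)))))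
       sums (q * (lap1 q (1 - t) + lam * lap0 q (1 - t)))"
      using lap1_sums(2)[of q "1 - t"] lap0_sums(2)[of q "1 - t"] q t by (intro sums_add sums_mult) auto
    moreover have "f (int (Suc j)) = q * (q ^ j * (1 / (1 - t + real j)\<^sup>2) + lam * (q ^ j * (1 / (1 - t + real j))))" for j
    proof -
      define d where "d = 1 - t + real j"
      have d: "d > 0" "t - of_int (int (Suc j)) = - d" using t by (auto simp: d_def)
      have "exp (- lam * \<bar>of_int (int (Suc j))\<bar>) = q * q ^ j" unfolding pw by (simp add: q_def algebra_simps flip: exp_add)
      then show ?thesis unfolding f_def d(2) d_def[symmetric] by (simp add: algebra_simps)
    qed
    ultimately show ?thesis by simp
  qed
  ultimately have lim: "(\<lambda>N. \<Sum>k\<in>{- int N..int N}. complex_of_real (s * f k)) \<longlonglongrightarrow> majorant lam (of_real t)"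
    and "(\<lambda>N. \<Sum>k\<in>{- int N..int N}. f k) \<longlonglongrightarrow> (lap1 q t + lam * (lap0 q t - 1 / t)) + q * (lap1 q (1 - t) + lam * lap0 q (1 - t))"
    by (auto intro: sum_int_sums)
  from tendsto_of_real[OF tendsto_mult[OF tendsto_const this(2)], of s, where 'a = complex]
  have "(\<lambda>N. \<Sum>k\<in>{- int N..int N}. complex_of_real (s * f k)) \<longlonglongrightarrow>
     of_real (s * ((lap1 q t + lam * (lap0 q t - 1 / t)) + q * (lap1 q (1 - t) + lam * lap0 q (1 - t))))"
    by (simp only: sum_distrib_left of_real_sum)
  then show ?thesis using lim LIMSEQ_unique by (simp only: add.assoc) blast
qed

section \<open>The Laplace transform of the kernel and its relation to the majorant\<close>

definition laplace :: "real \<Rightarrow> complex \<Rightarrow> complex" where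
  "laplace lam z = (LINT w|lborel. indicator {0..} w *\<^sub>R (of_real (laplace_kernel lam w) * exp (- z * of_real w)))"

lemma laplace_kernel_measurable [measurable]: "laplace_kernel lam \<in> borel_measurable borel"
  unfolding laplace_kernel_def by measurable

lemma laplace_dominated:
  assumes lam: "lam > 0" and a: "a \<le> Re z"
  shows "norm (indicator {0..} w *\<^sub>R (of_real (laplace_kernel lam w) * exp (- z * of_real w)))
    \<le> min 1 lam * (indicator {0..} w * (w * exp (- a * w)))"
proof (cases "w \<ge> 0")
  case True
  have "norm (of_real (laplace_kernel lam w) * exp (- z * of_real w)) = laplace_kernel lam w * exp (- Re z * w)"
    using laplace_kernel_bounds[OF lam True] by (simp add: norm_mult)
  also have "\<dots> \<le> (w * min 1 lam) * exp (- a * w)"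
    using laplace_kernel_bounds[OF lam True] True a lam by (intro mult_mono) (auto intro: mult_right_mono)
  finally show ?thesis using True by (simp add: mult_ac)
qed simp

lemma laplace_holomorphic:
  assumes lam: "lam > 0"
  shows "laplace lam holomorphic_on {z. Re z > 0}"
  unfolding laplace_def
proof (rule holomorphic_parametric_integral)
  show "open {z::complex. Re z > 0}" by (rule open_halfspace_Re_gt)
  show "(\<lambda>z. indicator {0..} w *\<^sub>R (of_real (laplace_kernel lam w) * exp (- z * of_real w))) holomorphic_on {z. Re z > 0}" for w :: real
    unfolding scaleR_conv_of_real by (intro holomorphic_intros)
  fix z :: complex assume z: "z \<in> {z. Re z > 0}"
  show "\<exists>r>0. \<exists>g. integrable lborel g \<and> (\<forall>x\<in>{z. Re z > 0}. dist z x < r \<longrightarrow> (\<forall>w\<in>space lborel.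
      norm (indicator {0..} w *\<^sub>R (of_real (laplace_kernel lam w) * exp (- x * of_real w))) \<le> g w))"
  proof (intro exI[of _ "Re z / 2"] conjI exI[of _ "\<lambda>w. min 1 lam * (indicator {0..} w * (w * exp (- (Re z / 2) * w)))"] ballI impI)
    show "0 < Re z / 2" using z by simp
    then show "integrable lborel (\<lambda>w. min 1 lam * (indicator {0..} w * (w * exp (- (Re z / 2) * w))))"
      using has_bochner_integral_exp_Ici(2)[of "Re z / 2"] by (intro integrable_mult_right) (auto simp: has_bochner_integral_iff)
    fix x :: complex and w assume "dist z x < Re z / 2"
    then have "Re z / 2 \<le> Re x" using abs_Re_le_cmod[of "z - x"] by (simp add: dist_norm)
    then show "norm (indicator {0..} w *\<^sub>R (of_real (laplace_kernel lam w) * exp (- x * of_real w))) \<le> min 1 lam * (indicator {0..} w * (w * exp (- (Re z / 2) * w)))"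
      by (rule laplace_dominated[OF lam])
  qed
qed measurable

lemma norm_laplace_le:
  assumes lam: "lam > 0" and z: "Re z > 0"
  shows "norm (laplace lam z) \<le> min 1 lam / (Re z)\<^sup>2"
proof -
  note I = has_bochner_integral_exp_Ici(2)[OF z, unfolded has_bochner_integral_iff]
  have "norm (laplace lam z) \<le> (LINT w|lborel. norm (indicator {0..} w *\<^sub>R (of_real (laplace_kernel lam w) * exp (- z * of_real w))))"
    unfolding laplace_def by (rule integral_norm_bound)
  also have "\<dots> \<le> (LINT w|lborel. min 1 lam * (indicator {0..} w * (w * exp (- Re z * w))))"
    using laplace_dominated[OF lam order_refl, where z = z] I order_trans[OF norm_ge_zero laplace_dominated[OF lam order_refl, where z = z]]
    by (intro integral_mono' integrable_mult_right) auto
  also have "\<dots> = min 1 lam / (Re z)\<^sup>2" using I by simp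
  finally show ?thesis .
qed

lemma laplace_of_real:
  assumes lam: "lam > 0"
  shows "laplace lam (of_real x) = of_real (LINT w|lborel. indicator {0..} w * (laplace_kernel lam w * exp (- x * w)))"
    and "(LINT w|lborel. indicator {0..} w * (laplace_kernel lam w * exp (- x * w))) \<ge> 0"
proof -
  have "indicator {0..} w *\<^sub>R (of_real (laplace_kernel lam w) * exp (- of_real x * of_real w))
      = complex_of_real (indicator {0..} w * (laplace_kernel lam w * exp (- x * w)))" for w :: real
    by (simp add: scaleR_conv_of_real exp_of_real[symmetric])
  then show "laplace lam (of_real x) = of_real (LINT w|lborel. indicator {0..} w * (laplace_kernel lam w * exp (- x * w)))"
    unfolding laplace_def by (simp only: integral_complex_of_real)
  show "(LINT w|lborel. indicator {0..} w * (laplace_kernel lam w * exp (- x * w))) \<ge> 0"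
    using laplace_kernel_bounds(1)[OF lam] by (intro integral_nonneg_AE AE_I2) (auto simp: indicator_def)
qed

lemma bernoulli_fun_neg: "u * exp (- u) / (1 - exp (- u)) = bernoulli_fun (- u)" if "u > 0"
  using that unfolding bernoulli_fun_minus bernoulli_fun_def by (simp add: field_simps exp_minus_inverse)

text \<open>Every value of \<open>lap1\<close> and \<open>lap0\<close> is rewritten as an integral of
  \<open>bernoulli_fun (v - lam) * exp (- t * v)\<close> or \<open>(bernoulli_fun (v + lam) - lam) * exp (- t * v)\<close>
  over a half-line; the contributions of negative \<open>v\<close> cancel.\<close>

lemma laplace_unit_interval:
  assumes t: "0 < t" "t < 1" and lam: "lam > 0"
  defines "q \<equiv> exp (- lam)"
  shows "(LINT w|lborel. indicator {0..} w * (laplace_kernel lam w * exp (- t * w))) =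
    lap1 q t + lam * (lap0 q t - 1 / t) + q * (lap1 q (1 - t) + lam * lap0 q (1 - t))
     - exp (- lam * t) * (lap1 1 t + lap1 1 (1 - t))"
proof -
  define B where "B = bernoulli_fun"
  have q: "0 < q" "q < 1" using lam by (auto simp: q_def)
  define g1 where "g1 = (\<lambda>p a w::real. indicator {0..} w * (w * exp (- a * w) / (1 - p * exp (- w))))"
  define g0 where "g0 = (\<lambda>p a w::real. indicator {0..} w * (1 * exp (- a * w) / (1 - p * exp (- w))))"
  have h1: "has_bochner_integral lborel (g1 p a) (lap1 p a)" if "0 < p" "p \<le> 1" "a > 0" for p a
    unfolding has_bochner_integral_iff g1_def lap1_def using lap1_sums(1)[OF that] by simp
  have h0: "has_bochner_integral lborel (g0 p a) (lap0 p a)" if "0 < p" "p < 1" "a > 0" for p a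
    unfolding has_bochner_integral_iff g0_def lap0_def using lap0_sums(1)[OF that] by simp
  have shift: "has_bochner_integral lborel (\<lambda>v. f (c + d * v)) I" if "has_bochner_integral lborel f I" "d = 1 \<or> d = -1"
    for f :: "real \<Rightarrow> real" and c d I
    using that lborel_has_bochner_integral_real_affine_iff[of d f I c] by auto
  \<comment> \<open>The substitutions w = v - lam, w = lam - v and w = - v in the first three
    integrals give all of them the common exponential \<open>exp (- t * v)\<close>; the fourth
    already has it.\<close>
  define X1 where "X1 = (\<lambda>v. exp (- lam * t) * g1 1 t (- lam + 1 * v))"
  define X2 where "X2 = (\<lambda>v. exp (- lam * t) * g1 1 (1 - t) (lam + (-1) * v))"
  define X3 where "X3 = (\<lambda>v. q * (g1 q (1 - t) (0 + (-1) * v) + lam * g0 q (1 - t) (0 + (-1) * v)))"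
  define X4 where "X4 = (\<lambda>v. g1 q t v + lam * (g0 q t v - indicator {0..} v * exp (- t * v)))"
  have I1: "has_bochner_integral lborel X1 (exp (- lam * t) * lap1 1 t)"
    unfolding X1_def using t by (intro has_bochner_integral_mult_right shift h1) auto
  have I2: "has_bochner_integral lborel X2 (exp (- lam * t) * lap1 1 (1 - t))"
    unfolding X2_def using t by (intro has_bochner_integral_mult_right shift h1) auto
  have I3: "has_bochner_integral lborel X3 (q * (lap1 q (1 - t) + lam * lap0 q (1 - t)))"
    unfolding X3_def using t q by (intro has_bochner_integral_mult_right has_bochner_integral_add shift h1 h0) auto
  have I4: "has_bochner_integral lborel X4 (lap1 q t + lam * (lap0 q t - 1 / t))"
    unfolding X4_def using t q
    by (intro has_bochner_integral_mult_right has_bochner_integral_add has_bochner_integral_diff h1 h0 has_bochner_integral_exp_Ici) auto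
  have J: "has_bochner_integral lborel (\<lambda>v. X4 v + X3 v - (X1 v + X2 v))
     (lap1 q t + lam * (lap0 q t - 1 / t) + q * (lap1 q (1 - t) + lam * lap0 q (1 - t))
      - (exp (- lam * t) * lap1 1 t + exp (- lam * t) * lap1 1 (1 - t)))"
    by (intro has_bochner_integral_add has_bochner_integral_diff I1 I2 I3 I4)
  have qe: "q * exp (- w) = exp (- (w + lam))" for w by (simp add: q_def algebra_simps flip: exp_add)
  have E1: "X1 v = (if v > lam then B (v - lam) * exp (- t * v) else 0)" if "v \<noteq> lam" for v
  proof (cases "v > lam")
    case True
    have "exp (- lam * t) * exp (- t * (v - lam)) = exp (- t * v)" by (simp add: algebra_simps flip: exp_add)
    then show ?thesis using True by (simp add: X1_def g1_def B_def bernoulli_fun_def mult_ac)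
  qed (use that in \<open>simp add: X1_def g1_def\<close>)
  have E2: "X2 v = (if v < lam then B (v - lam) * exp (- t * v) else 0)" if "v \<noteq> lam" for v
  proof (cases "v < lam")
    case True
    have e: "exp (- lam * t) * exp (- (1 - t) * (lam - v)) = exp (- (lam - v)) * exp (- t * v)"
      by (simp add: algebra_simps flip: exp_add)
    have "X2 v = (lam - v) * (exp (- lam * t) * exp (- (1 - t) * (lam - v))) / (1 - exp (- (lam - v)))"
      using True by (simp add: X2_def g1_def) (simp add: algebra_simps)
    also have "\<dots> = ((lam - v) * exp (- (lam - v)) / (1 - exp (- (lam - v)))) * exp (- t * v)"
      unfolding e by simp
    also have "\<dots> = B (v - lam) * exp (- t * v)" using bernoulli_fun_neg[of "lam - v"] True by (simp add: B_def)
    finally show ?thesis using True by simp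
  qed (use that in \<open>simp add: X2_def g1_def\<close>)
  have E3: "X3 v = (if v < 0 then B (v - lam) * exp (- t * v) else 0)" if "v \<noteq> 0" for v
  proof (cases "v < 0")
    case True
    define w where "w = - v"
    have w: "w > 0" using True by (simp add: w_def)
    have "X3 v = q * (w * exp (- (1 - t) * w) / (1 - q * exp (- w)) + lam * (exp (- (1 - t) * w) / (1 - q * exp (- w))))"
      using w by (simp add: X3_def g1_def g0_def w_def) (simp add: algebra_simps)
    also have "\<dots> = (w + lam) * (q * exp (- (1 - t) * w)) / (1 - q * exp (- w))"
    proof -
      have "q * (w * e / d + lam * (e / d)) = (w + lam) * (q * e) / d" for e d
        by (simp add: add_divide_distrib distrib_right distrib_left mult_ac)
      then show ?thesis .
    qed
    also have "q * exp (- (1 - t) * w) = exp (- (w + lam)) * exp (t * w)" by (simp add: q_def algebra_simps flip: exp_add)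
    also have "(w + lam) * (exp (- (w + lam)) * exp (t * w)) / (1 - q * exp (- w)) =
      ((w + lam) * exp (- (w + lam)) / (1 - exp (- (w + lam)))) * exp (t * w)" unfolding qe by simp
    also have "\<dots> = B (- (w + lam)) * exp (t * w)" using bernoulli_fun_neg[of "w + lam"] w lam unfolding B_def by simp
    finally show ?thesis using True by (simp add: w_def)
  qed (use that in \<open>simp add: X3_def g1_def g0_def\<close>)
  have E4: "X4 v = (if v \<ge> 0 then (B (v + lam) - lam) * exp (- t * v) else 0)" for v
  proof (cases "v \<ge> 0")
    case True
    have "v * e / d + lam * (1 * e / d - e) = ((v + lam) / d - lam) * e" for e d
      by (simp add: add_divide_distrib distrib_right left_diff_distrib right_diff_distrib)
    with True show ?thesis unfolding X4_def g1_def g0_def qe B_def bernoulli_fun_def by simp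
  qed (simp add: X4_def g1_def g0_def)
  \<comment> \<open>At 0 and at \<open>lam\<close> the closed half-lines overlap and
    \<open>bernoulli_fun\<close> may be evaluated at 0; these two points form a null set.\<close>
  have ae: "AE v in lborel. (v::real) \<noteq> 0 \<and> v \<noteq> lam"
    using AE_lborel_singleton[of 0] AE_lborel_singleton[of lam] by eventually_elim simp
  have "AE v in lborel. indicator {0..} v * (laplace_kernel lam v * exp (- t * v)) = X4 v + X3 v - (X1 v + X2 v)"
    using ae
  proof eventually_elim
    case (elim v)
    have k: "laplace_kernel lam v = B (v + lam) - B (v - lam) - lam" using elim by (simp add: laplace_kernel_def B_def)
    consider "v < 0" | "0 < v" "v < lam" | "v > lam" using elim by linarith
    then show ?case
    proof cases
      case 1
      then have "X1 v = 0" "X2 v = X3 v" "X4 v = 0" using E1[of v] E2[of v] E3[of v] E4[of v] lam elim by auto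
      then show ?thesis using 1 by simp
    next
      case 2
      then have "X1 v = 0" "X2 v = B (v - lam) * exp (- t * v)" "X3 v = 0" "X4 v = (B (v + lam) - lam) * exp (- t * v)"
        using E1[of v] E2[of v] E3[of v] E4[of v] elim by auto
      then show ?thesis using 2 unfolding k by (simp add: left_diff_distrib)
    next
      case 3
      then have "X2 v = 0" "X1 v = B (v - lam) * exp (- t * v)" "X3 v = 0" "X4 v = (B (v + lam) - lam) * exp (- t * v)"
        using E1[of v] E2[of v] E3[of v] E4[of v] elim lam by auto
      then show ?thesis using 3 lam unfolding k by (simp add: left_diff_distrib)
    qed
  qed
  then have "(LINT w|lborel. indicator {0..} w * (laplace_kernel lam w * exp (- t * w))) = (LINT v|lborel. X4 v + X3 v - (X1 v + X2 v))"
    using J by (intro integral_cong_AE) (auto simp: has_bochner_integral_iff)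
  then show ?thesis using J by (simp add: has_bochner_integral_iff distrib_left)
qed

text \<open>On the interval (0,1) the majorant is \<open>s * S\<close> and the transform is
  \<open>S - exp (- lam * t) * P\<close>, and \<open>s * P = 1\<close> makes the two sides agree.
  The identity theorem extends this to the half-plane, although the sums were computed only between
  the nodes 0 and 1.\<close>

lemma majorant_laplace:
  assumes lam: "lam > 0" and z: "Re z > 0"
  shows "majorant lam z = exp (- of_real lam * z) + (sin (of_real pi * z) / of_real pi)\<^sup>2 * laplace lam z"
proof -
  define F where "F = (\<lambda>z. majorant lam z - exp (- of_real lam * z) - (sin (of_real pi * z) / of_real pi)\<^sup>2 * laplace lam z)"
  have "F z = 0"
  proof (rule analytic_continuation[of F "{z. Re z > 0}" "of_real ` {0<..<1}" "1/2"])
    show "F holomorphic_on {z. Re z > 0}" unfolding F_def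
      by (intro holomorphic_intros laplace_holomorphic lam holomorphic_on_subset[OF majorant_holomorphic[OF lam]]) auto
    show "open {z::complex. Re z > 0}" by (rule open_halfspace_Re_gt)
    show "connected {z::complex. Re z > 0}" by (intro convex_connected convex_halfspace_Re_gt)
    have "complex_of_real (1/2) islimpt (of_real ` {0<..<1})"
    proof (rule islimpt_isCont_image)
      show "(1/2::real) islimpt {0<..<1}" by (rule interior_limit_point) (simp add: interior_open)
      show "\<forall>\<^sub>F y in at (1/2). complex_of_real y \<noteq> complex_of_real (1/2)"         unfolding eventually_at_filter of_real_eq_iff by simp
    qed auto
    then show "1/2 islimpt complex_of_real ` {0<..<1}" by simp
    fix w :: complex assume "w \<in> of_real ` {0<..<1}"
    then obtain t where t: "w = of_real t" "0 < t" "t < 1" by auto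
    define s q where "s = (sin (pi * t) / pi)\<^sup>2" and "q = exp (- lam)"
    define S where "S = lap1 q t + lam * (lap0 q t - 1 / t) + q * (lap1 q (1 - t) + lam * lap0 q (1 - t))"
    define P where "P = lap1 1 t + lap1 1 (1 - t)"
    have m: "majorant lam w = of_real (s * S)" unfolding S_def s_def q_def t(1) by (rule majorant_unit_interval[OF t(2,3) lam])
    have l: "laplace lam w = of_real (S - exp (- lam * t) * P)"
      unfolding t(1) laplace_of_real(1)[OF lam] laplace_unit_interval[OF t(2,3) lam] S_def P_def q_def ..
    have sP: "s * P = 1" unfolding s_def P_def by (rule csinc_square_laplace[OF t(2,3)])
    have "F w = of_real (s * S - exp (- lam * t) - s * (S - exp (- lam * t) * P))"
      unfolding F_def m l by (simp add: t(1) s_def exp_of_real[symmetric] sin_of_real[symmetric])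
    also have "s * S - exp (- lam * t) - s * (S - exp (- lam * t) * P) = exp (- lam * t) * (s * P - 1)"
      by (simp add: algebra_simps)
    finally show "F w = 0" unfolding sP by simp
  qed (use z in auto)
  then show ?thesis unfolding F_def diff_diff_eq right_minus_eq .
qed

lemma majorant_gap_bounds:
  assumes lam: "lam > 0"
  defines "D \<equiv> (\<lambda>x. Re (majorant lam (of_real x)) - exp (- lam * \<bar>x\<bar>))"
  shows "0 \<le> D x" "D x \<le> min 1 lam * (norm (csinc (of_real x)))\<^sup>2"
proof -
  have pos: "0 \<le> D x \<and> D x \<le> min 1 lam * (norm (csinc (of_real x)))\<^sup>2" if x: "x > 0" for x
  proof -
    obtain r where r: "laplace lam (of_real x) = of_real r" "r \<ge> 0" using laplace_of_real[OF lam, of x] by blast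
    have rb: "r \<le> min 1 lam / x\<^sup>2" using norm_laplace_le[OF lam, of "of_real x"] x r by simp
    define s where "s = (sin (pi * x) / pi)\<^sup>2"
    have "majorant lam (of_real x) = of_real (exp (- lam * x) + s * r)"
      using majorant_laplace[OF lam, of "of_real x"] x
      by (simp add: r s_def exp_of_real[symmetric] sin_of_real[symmetric])
    then have D: "D x = s * r" using x by (simp add: D_def)
    have s0: "s \<ge> 0" by (simp add: s_def)
    have "s * r \<le> s * (min 1 lam / x\<^sup>2)" by (intro mult_left_mono rb s0)
    also have "(norm (csinc (of_real x)))\<^sup>2 = s / x\<^sup>2"
    proof -
      have "csinc (of_real x) = of_real (sin (pi * x) / (pi * x))" using x by (simp add: csinc_def sin_of_real[symmetric])
      then have "norm (csinc (of_real x)) = \<bar>sin (pi * x) / (pi * x)\<bar>" by (simp only: norm_of_real)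
      then show ?thesis by (simp add: s_def power_divide power_mult_distrib)
    qed
    then have "s * (min 1 lam / x\<^sup>2) = min 1 lam * (norm (csinc (of_real x)))\<^sup>2" by simp
    finally show ?thesis using D s0 r(2) by simp
  qed
  have "0 \<le> D x \<and> D x \<le> min 1 lam * (norm (csinc (of_real x)))\<^sup>2"
  proof (cases x "0::real" rule: linorder_cases)
    case less
    have "D x = D (- x)" using majorant_minus[of lam "of_real x"] by (simp add: D_def)
    moreover have "csinc (of_real (- x)) = csinc (of_real x)" by simp
    ultimately show ?thesis using pos[of "- x"] less by simp
  next
    case equal
    then show ?thesis using majorant_of_int[of lam 0] lam by (simp add: D_def)
  qed (use pos in simp)
  then show "0 \<le> D x" "D x \<le> min 1 lam * (norm (csinc (of_real x)))\<^sup>2" by auto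
qed

section \<open>Growth of the majorant, uniformly in the parameter\<close>

text \<open>For small \<open>lam\<close> the two exponentials differ by at most the derivative bound
  \<open>lam\<close> times the distance from \<open>z\<close> to 1; for large \<open>lam\<close>
  each of them is at most 1.\<close>

lemma exp_neg_mult_diff_le:
  fixes z :: complex
  assumes lam: "lam > 0" and z: "Re z \<ge> 0"
  shows "norm (exp (- of_real lam * z) - of_real (exp (- lam))) \<le> 2 * min 1 lam * (1 + norm z)"
proof (cases "lam < 1")
  case True
  have "norm (exp (- of_real lam * z) - exp (- of_real lam * 1)) \<le> lam * norm (z - 1)"
  proof (rule field_differentiable_bound[where S = "{w. Re w \<ge> 0}" and f' = "\<lambda>w. - of_real lam * exp (- of_real lam * w)"])
    show "convex {w::complex. Re w \<ge> 0}" by (rule convex_halfspace_Re_ge)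
    show "((\<lambda>w. exp (- of_real lam * w)) has_field_derivative - of_real lam * exp (- of_real lam * w)) (at w within {w. Re w \<ge> 0})" for w :: complex
      by (auto intro!: derivative_eq_intros)
    show "norm (- of_real lam * exp (- of_real lam * w)) \<le> lam" if "w \<in> {w. Re w \<ge> 0}" for w :: complex
      using that lam by (simp add: norm_mult mult_le_cancel_left1)
  qed (use z in auto)
  also have "\<dots> \<le> lam * (norm z + 1)" using lam norm_triangle_ineq4[of z 1] by (intro mult_left_mono) auto
  also have "\<dots> \<le> 2 * min 1 lam * (1 + norm z)" using True lam by (simp add: algebra_simps)
  finally show ?thesis by (simp add: exp_of_real[symmetric])
next
  case False
  have "norm (exp (- of_real lam * z) - of_real (exp (- lam))) \<le> norm (exp (- of_real lam * z)) + norm (complex_of_real (exp (- lam)))"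
    by (rule norm_triangle_ineq4)
  also have "\<dots> \<le> 1 + 1" using lam z by (intro add_mono) auto
  also have "\<dots> \<le> 2 * min 1 lam * (1 + norm z)" using False by simp
  finally show ?thesis .
qed

text \<open>The termwise estimate in \<open>norm_majorant_le\<close> has a constant that blows up as
  \<open>lam\<close> tends to 0. The Laplace formula is uniform in \<open>lam\<close> but has a
  double pole at the imaginary axis; evenness covers the left half-plane, and the damped maximum
  principle removes the pole.\<close>

lemma norm_majorant_minus_le:
  assumes lam: "lam > 0"
  shows "norm (majorant lam z - of_real (exp (- lam))) \<le> min 1 lam * (24 * exp (2 * pi) * (1 + norm z) * exp (2 * pi * \<bar>Im z\<bar>))"
proof -
  define m where "m = min 1 lam"
  have m: "m > 0" using lam by (simp add: m_def)
  define \<Psi> where "\<Psi> = (\<lambda>z. majorant lam z - of_real (exp (- lam)))"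
  have pos: "norm (\<Psi> z) \<le> m * (1 + norm z) * exp (2 * pi * \<bar>Im z\<bar>) * (2 + 1 / (Re z)\<^sup>2)" if z: "Re z > 0" for z
  proof -
    define E where "E = exp (2 * pi * \<bar>Im z\<bar>)"
    have E: "E \<ge> 1" by (simp add: E_def)
    have "\<Psi> z = (exp (- of_real lam * z) - of_real (exp (- lam))) + (sin (of_real pi * z) / of_real pi)\<^sup>2 * laplace lam z"
      unfolding \<Psi>_def majorant_laplace[OF lam z] by simp
    then have "norm (\<Psi> z) \<le> norm (exp (- of_real lam * z) - of_real (exp (- lam))) + norm ((sin (of_real pi * z) / of_real pi)\<^sup>2 * laplace lam z)"
      by (simp only: norm_triangle_ineq)
    also have "\<dots> \<le> 2 * m * (1 + norm z) * E + E * (m / (Re z)\<^sup>2)"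
    proof (intro add_mono)
      have "norm (exp (- of_real lam * z) - of_real (exp (- lam))) \<le> 2 * m * (1 + norm z) * 1"
        using exp_neg_mult_diff_le[OF lam, of z] z by (simp add: m_def)
      also have "\<dots> \<le> 2 * m * (1 + norm z) * E" using m E by (intro mult_left_mono) auto
      finally show "norm (exp (- of_real lam * z) - of_real (exp (- lam))) \<le> 2 * m * (1 + norm z) * E" .
      have "norm (sin (of_real pi * z) / of_real pi) \<le> exp (pi * \<bar>Im z\<bar>)"
        using norm_mult_csinc_le[of z] by (simp add: csinc_mult)
      then have "norm ((sin (of_real pi * z) / of_real pi)\<^sup>2) \<le> (exp (pi * \<bar>Im z\<bar>))\<^sup>2"
        unfolding norm_power by (intro power_mono) auto
      also have "\<dots> = E" by (simp add: E_def power2_eq_square flip: exp_add)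
      finally show "norm ((sin (of_real pi * z) / of_real pi)\<^sup>2 * laplace lam z) \<le> E * (m / (Re z)\<^sup>2)"
        unfolding norm_mult using norm_laplace_le[OF lam z] E by (intro mult_mono) (auto simp: m_def)
    qed
    also have "\<dots> \<le> 2 * m * (1 + norm z) * E + (1 + norm z) * E * (m / (Re z)\<^sup>2)"
      using E m mult_right_mono[of 1 "1 + norm z" E] by (intro add_left_mono mult_right_mono) auto
    also have "\<dots> = m * (1 + norm z) * E * (2 + 1 / (Re z)\<^sup>2)" by (simp add: algebra_simps add_divide_distrib)
    finally show ?thesis by (simp add: E_def)
  qed
  have both: "norm (\<Psi> z) \<le> m * (1 + norm z) * exp (2 * pi * \<bar>Im z\<bar>) * (2 + 1 / (Re z)\<^sup>2)" if z: "Re z \<noteq> 0" for z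
  proof (cases "Re z > 0")
    case False
    have "\<Psi> (- z) = \<Psi> z" by (simp add: \<Psi>_def majorant_minus)
    then show ?thesis using pos[of "- z"] False z by simp
  qed (rule pos)
  \<comment> \<open>A quarter turn moves the singular line of the bound from the imaginary to the
    real axis, the position for which \<open>damped_maximum_modulus\<close> is stated.\<close>
  define F where "F = (\<lambda>w. \<Psi> (\<i> * w))"
  have \<Psi>hol: "\<Psi> holomorphic_on UNIV" unfolding \<Psi>_def by (intro holomorphic_intros majorant_holomorphic lam)
  have Fhol: "F holomorphic_on UNIV" unfolding F_def
    by (rule holomorphic_on_compose[of "\<lambda>w. \<i> * w" UNIV \<Psi>, unfolded o_def])
      (auto intro!: holomorphic_intros holomorphic_on_subset[OF \<Psi>hol])
  have Fb: "norm (F w) \<le> m * (1 + norm w) * exp (2 * pi * \<bar>Re w\<bar>) * (2 + 1 / (Im w)\<^sup>2)" if "Im w \<noteq> 0" for w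
    using both[of "\<i> * w"] that by (simp add: F_def norm_mult)
  have "norm (F w) \<le> m * (24 * exp (2 * pi) * (1 + norm w) * exp (2 * pi * \<bar>Re w\<bar>))" for w
  proof (cases "\<bar>Im w\<bar> < 1")
    case False
    then have "(1::real) \<le> \<bar>Im w\<bar>\<^sup>2" by (intro one_le_power) simp
    then have "2 + 1 / (Im w)\<^sup>2 \<le> 3" by (simp add: divide_le_eq)
    also have "3 \<le> 24 * exp (2 * pi)" using one_le_exp_iff[of "2 * pi"] by (simp del: one_le_exp_iff)
    finally have "m * (1 + norm w) * exp (2 * pi * \<bar>Re w\<bar>) * (2 + 1 / (Im w)\<^sup>2) \<le> m * (1 + norm w) * exp (2 * pi * \<bar>Re w\<bar>) * (24 * exp (2 * pi))"
      using m by (intro mult_left_mono) auto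
    moreover have "Im w \<noteq> 0" using False by auto
    ultimately show ?thesis using Fb[of w] by (simp add: mult_ac)
  next
    case True
    define c where "c = Re w"
    define K where "K = 3 * m * (2 + \<bar>c\<bar>) * exp (2 * pi * (\<bar>c\<bar> + 1))"
    have "norm (F w) \<le> 4 * K / 1\<^sup>2"
    proof (rule damped_maximum_modulus[OF Fhol, where c = c])
      show "K \<ge> 0" using m by (simp add: K_def)
      fix x assume x: "norm (x - of_real c) = 1" "Im x \<noteq> 0"
      have nx: "norm x \<le> \<bar>c\<bar> + 1" using norm_triangle_ineq2[of x "of_real c"] x by simp
      have ix: "\<bar>Im x\<bar> \<le> 1" using abs_Im_le_cmod[of "x - of_real c"] x by simp
      have rx: "\<bar>Re x\<bar> \<le> \<bar>c\<bar> + 1" using abs_Re_le_cmod[of x] nx by linarith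
      have i2: "(Im x)\<^sup>2 \<le> 1" using ix by (simp add: abs_square_le_1)
      have "norm (F x) * (Im x)\<^sup>2 \<le> (m * (1 + norm x) * exp (2 * pi * \<bar>Re x\<bar>) * (2 + 1 / (Im x)\<^sup>2)) * (Im x)\<^sup>2"
        by (intro mult_right_mono Fb x) auto
      also have "\<dots> = (m * (1 + norm x) * exp (2 * pi * \<bar>Re x\<bar>)) * (2 * (Im x)\<^sup>2 + 1)"
        using x by (simp add: distrib_right)
      also have "\<dots> \<le> (m * (2 + \<bar>c\<bar>) * exp (2 * pi * (\<bar>c\<bar> + 1))) * 3"
        using nx rx i2 m by (intro mult_mono) auto
      also have "\<dots> = K" by (simp add: K_def)
      finally show "norm (F x) * (Im x)\<^sup>2 \<le> K" .
    qed (use True in \<open>auto simp: c_def\<close>)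
    also have "4 * K / 1\<^sup>2 = (m * 12 * exp (2 * pi) * exp (2 * pi * \<bar>c\<bar>)) * (2 + \<bar>c\<bar>)"
    proof -
      have "exp (2 * pi * (\<bar>c\<bar> + 1)) = exp (2 * pi) * exp (2 * pi * \<bar>c\<bar>)" by (simp add: distrib_left exp_add)
      then show ?thesis unfolding K_def by (simp add: algebra_simps)
    qed
    also have "\<dots> \<le> (m * 12 * exp (2 * pi) * exp (2 * pi * \<bar>c\<bar>)) * (2 * (1 + norm w))"
      using m abs_Re_le_cmod[of w] by (intro mult_left_mono) (auto simp: c_def)
    also have "\<dots> = m * (24 * exp (2 * pi) * (1 + norm w) * exp (2 * pi * \<bar>c\<bar>))" by (simp add: algebra_simps)
    finally show ?thesis unfolding c_def .
  qed
  from this[of "- \<i> * z"] show ?thesis by (simp add: F_def \<Psi>_def m_def norm_mult mult.assoc[symmetric])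
qed

section \<open>Symmetric partial sums, dominated uniformly in the parameter\<close>

lemma sum_inverse_squares_le: "(\<Sum>n=1..N. 1 / (real n)\<^sup>2) \<le> 2"
proof -
  have step: "1 / (x + 1)\<^sup>2 \<le> 1 / x - 1 / (x + 1)" if "x > 0" for x :: real
  proof -
    have "1 / x - 1 / (x + 1) = 1 / (x * (x + 1))" using that by (simp add: field_simps)
    also have "\<dots> \<ge> 1 / ((x + 1) * (x + 1))" using that by (intro divide_left_mono mult_right_mono) auto
    finally show ?thesis by (simp add: power2_eq_square)
  qed
  have "(\<Sum>n=1..Suc N. 1 / (real n)\<^sup>2) \<le> 2 - 1 / real (Suc N)" for N
  proof (induction N)
    case (Suc N)
    have "(\<Sum>n=1..Suc (Suc N). 1 / (real n)\<^sup>2) = (\<Sum>n=1..Suc N. 1 / (real n)\<^sup>2) + 1 / (real (Suc N) + 1)\<^sup>2" by simp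
    also have "\<dots> \<le> (2 - 1 / real (Suc N)) + (1 / real (Suc N) - 1 / (real (Suc N) + 1))"
      by (intro add_mono Suc.IH step) simp
    finally show ?case by simp
  qed simp
  then have *: "(\<Sum>n=1..Suc N. 1 / (real n)\<^sup>2) \<le> 2" for N
    by (rule order_trans) simp
  show ?thesis using *[of "N - 1"] by (cases N) auto
qed

text \<open>Each of the two parts of the sum alone is only of order \<open>lam * ln (1 / lam)\<close>, which is not
  integrable against the measure; together they are the derivative of \<open>- g n / n\<close> in \<open>n\<close>, so the sum
  essentially telescopes.\<close>

lemma symmetric_sum_bound:
  fixes lam :: real
  assumes lam: "lam > 0"
  defines "g \<equiv> (\<lambda>n::nat. exp (- lam * real n) - exp (- lam))"
  shows "n \<ge> 1 \<Longrightarrow> \<bar>g n\<bar> \<le> 4 * min 1 lam * real n"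
    and "n \<ge> 1 \<Longrightarrow> lam * exp (- lam * real n) \<le> min 1 lam"
    and "\<bar>\<Sum>n=1..N. g n / (real n)\<^sup>2 + lam * exp (- lam * real n) / real n\<bar> \<le> 19 * min 1 lam"
proof -
  define m where "m = min 1 lam"
  define p where "p = exp (- lam)"
  define e where "e = (\<lambda>n::nat. exp (- lam * real n))"
  have m: "m > 0" using lam by (simp add: m_def)
  have ge: "g n = e n - p" for n by (simp add: g_def e_def p_def)
  have g: "\<bar>g n\<bar> \<le> 4 * m * real n" if n: "n \<ge> 1" for n
  proof -
    have "exp (- complex_of_real lam * of_nat n) - of_real (exp (- lam)) = of_real (g n)"
      by (simp add: g_def exp_of_real[symmetric])
    then have "\<bar>g n\<bar> \<le> 2 * m * (1 + real n)"
      using exp_neg_mult_diff_le[OF lam, of "of_nat n"] by (simp add: m_def)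
    also have "\<dots> \<le> 2 * m * (2 * real n)" using n m by (intro mult_left_mono) auto
    finally show ?thesis by simp
  qed
  then show "n \<ge> 1 \<Longrightarrow> \<bar>g n\<bar> \<le> 4 * min 1 lam * real n" by (simp add: m_def)
  have le: "lam * e n \<le> m" if n: "n \<ge> 1" for n
  proof -
    have "lam \<le> lam * real n" using n lam by simp
    then have "e n \<le> exp (- lam)" by (simp add: e_def)
    then have "lam * e n \<le> lam * exp (- lam)" using lam by (intro mult_left_mono) auto
    also have "lam * exp (- lam) \<le> m"
    proof -
      have "lam \<le> exp lam" using exp_ge_add_one_self[of lam] by linarith
      then have "lam * exp (- lam) \<le> exp lam * exp (- lam)" by (intro mult_right_mono) auto
      then have "lam * exp (- lam) \<le> 1" by (simp add: exp_minus_inverse)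
      moreover have "lam * exp (- lam) \<le> lam * 1" using lam by (intro mult_left_mono) auto
      ultimately show ?thesis by (simp add: m_def)
    qed
    finally show ?thesis .
  qed
  then show "n \<ge> 1 \<Longrightarrow> lam * exp (- lam * real n) \<le> min 1 lam" by (simp add: m_def e_def)
  \<comment> \<open>\<open>r * e n\<close> is the error committed when the difference
    \<open>e n - e (Suc n)\<close> is replaced by its first order approximation
    \<open>lam * e n\<close>.\<close>
  define r where "r = lam - 1 + p"
  have r0: "r \<ge> 0" using exp_ge_add_one_self[of "- lam"] by (simp add: r_def p_def)
  have el: "lam \<le> exp lam - 1" using exp_ge_add_one_self[of lam] by linarith
  \<comment> \<open>The sum of the \<open>e n\<close> is at most \<open>1 / (exp lam - 1)\<close>,
    so this is the inequality that makes the accumulated error at most \<open>m\<close>, whatever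
    the number of terms.\<close>
  have rm: "r \<le> m * (exp lam - 1)"
  proof (cases "lam < 1")
    case True
    have "p \<le> 1 / (1 + lam)" using exp_ge_add_one_self[of lam] lam by (simp add: p_def exp_minus field_simps)
    then have "r \<le> lam - 1 + 1 / (1 + lam)" by (simp add: r_def)
    also have "\<dots> = lam * lam / (1 + lam)" using lam by (simp add: field_simps)
    also have "\<dots> \<le> lam * lam" using lam by (simp add: divide_le_eq mult_le_cancel_left1)
    also have "\<dots> \<le> lam * (exp lam - 1)" using el lam by (intro mult_left_mono) auto
    finally show ?thesis using True by (simp add: m_def)
  next
    case False
    have "p \<le> 1" using lam by (simp add: p_def)
    then show ?thesis using el False by (simp add: r_def m_def)
  qed
  have geo: "(exp lam - 1) * (\<Sum>n=1..N. e n) = 1 - e N" for N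
  proof (induction N)
    case (Suc N)
    have "e N = exp lam * e (Suc N)" by (simp add: e_def algebra_simps flip: exp_add)
    then show ?case using Suc by (simp add: distrib_left left_diff_distrib)
  qed (simp add: e_def)
  have e0: "e n > 0" for n by (simp add: e_def)
  have rs: "r * (\<Sum>n=1..N. e n) \<le> m" for N
  proof -
    have "r * (\<Sum>n=1..N. e n) \<le> (m * (exp lam - 1)) * (\<Sum>n=1..N. e n)"
      by (intro mult_right_mono rm sum_nonneg) (simp add: e0 less_imp_le)
    also have "\<dots> = m * (1 - e N)" using geo[of N] by (simp add: mult.assoc)
    also have "\<dots> \<le> m * 1" using m e0[of N] by (intro mult_left_mono) auto
    finally show ?thesis by simp
  qed
  define v where "v = (\<lambda>n. g n / real n)"
  have v: "\<bar>v n\<bar> \<le> 4 * m" if "n \<ge> 1" for n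
    using g[OF that] that by (simp add: v_def abs_divide divide_le_eq)
  define a b c where "a = (\<lambda>n. g n / ((real n)\<^sup>2 * (real n + 1)))"
    and "b = (\<lambda>n. lam * e n * (1 / real n - 1 / (real n + 1)))" and "c = (\<lambda>n. r * e n / (real n + 1))"
  \<comment> \<open>Discrete version of differentiating \<open>- g n / n\<close>. The remainders are
    \<open>a\<close> and \<open>b\<close>, from replacing \<open>n\<close> by \<open>n + 1\<close>
    in a denominator, and \<open>c\<close>, from discretising the exponential.\<close>
  have term_eq: "g n / (real n)\<^sup>2 + lam * e n / real n = v n - v (Suc n) + (a n + b n + c n)" if n: "n \<ge> 1" for n
  proof -
    have id: "(E - p) / x\<^sup>2 + lam * E / x = (E - p) / x - (E * p - p) / (x + 1) +
        ((E - p) / (x\<^sup>2 * (x + 1)) + lam * E * (1 / x - 1 / (x + 1)) + (lam - 1 + p) * E / (x + 1))" if "x > 0" for x E :: real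
    proof -
      have "x + 1 \<noteq> 0" "x \<noteq> 0" using that by auto
      then show ?thesis by (simp add: divide_simps power2_eq_square) (simp add: algebra_simps)
    qed
    have "e (Suc n) = e n * p" by (simp add: e_def p_def algebra_simps flip: exp_add)
    then show ?thesis using id[of "real n" "e n"] n
      by (simp add: v_def a_def b_def c_def r_def ge add.commute[of 1])
  qed
  have sa: "\<bar>a n\<bar> \<le> 4 * m * (1 / (real n)\<^sup>2)" if n: "n \<ge> 1" for n
  proof -
    have "\<bar>a n\<bar> = \<bar>g n\<bar> / ((real n)\<^sup>2 * (real n + 1))" by (simp add: a_def abs_divide abs_mult)
    also have "\<dots> \<le> (4 * m * (real n + 1)) / ((real n)\<^sup>2 * (real n + 1))"
      using g[OF n] m by (intro divide_right_mono) (auto simp: distrib_left)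
    also have "\<dots> = 4 * m * (1 / (real n)\<^sup>2)"
    proof -
      have "real n + 1 \<noteq> 0" by simp
      then show ?thesis by simp
    qed
    finally show ?thesis .
  qed
  have sb: "\<bar>b n\<bar> \<le> m * (1 / (real n)\<^sup>2)" if n: "n \<ge> 1" for n
  proof -
    have d: "1 / real n - 1 / (real n + 1) = 1 / (real n * (real n + 1))" using n by (simp add: field_simps)
    have "\<bar>b n\<bar> = lam * e n * (1 / (real n * (real n + 1)))" unfolding b_def d using lam e0[of n] by simp
    also have "\<dots> \<le> m * (1 / (real n * real n))"
      using n m le[OF n] by (intro mult_mono divide_left_mono mult_left_mono) auto
    finally show ?thesis by (simp add: power2_eq_square)
  qed
  have sc: "\<bar>c n\<bar> \<le> r * e n" for n
  proof -
    have re: "r * e n \<ge> 0" using r0 e0[of n] by simp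
    then have "\<bar>c n\<bar> = r * e n / (real n + 1)" unfolding c_def by (intro abs_of_nonneg) simp
    also have "\<dots> \<le> r * e n / 1" using re by (intro divide_left_mono) auto
    finally show ?thesis by simp
  qed
  have "(\<Sum>n=1..N. g n / (real n)\<^sup>2 + lam * e n / real n) = (\<Sum>n=1..N. v n - v (Suc n)) + (\<Sum>n=1..N. a n + b n + c n)"
    unfolding sum.distrib[symmetric] by (intro sum.cong refl term_eq) auto
  also have "(\<Sum>n=1..N. v n - v (Suc n)) = v 1 - v (Suc N)"
    by (induction N) auto
  finally have "\<bar>\<Sum>n=1..N. g n / (real n)\<^sup>2 + lam * e n / real n\<bar> \<le> \<bar>v 1\<bar> + \<bar>v (Suc N)\<bar> + \<bar>\<Sum>n=1..N. a n + b n + c n\<bar>"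
    by linarith
  also have "\<bar>\<Sum>n=1..N. a n + b n + c n\<bar> \<le> (\<Sum>n=1..N. 5 * m * (1 / (real n)\<^sup>2) + r * e n)"
  proof (rule order_trans[OF sum_abs], rule sum_mono)
    fix n assume "n \<in> {1..N}"
    then show "\<bar>a n + b n + c n\<bar> \<le> 5 * m * (1 / (real n)\<^sup>2) + r * e n"
      using sa[of n] sb[of n] sc[of n] by simp
  qed
  also have "\<dots> = 5 * m * (\<Sum>n=1..N. 1 / (real n)\<^sup>2) + r * (\<Sum>n=1..N. e n)"
    by (simp add: sum.distrib sum_distrib_left)
  also have "\<dots> \<le> 5 * m * 2 + m" using m by (intro add_mono mult_left_mono sum_inverse_squares_le rs) auto
  also have "\<bar>v 1\<bar> \<le> 4 * m" by (rule v) simp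
  also have "\<bar>v (Suc N)\<bar> \<le> 4 * m" by (rule v) simp
  \<comment> \<open>The constant is 4 + 4 for the two ends of the telescoping sum, 5 * 2 for
    \<open>a\<close> and \<open>b\<close>, and 1 for \<open>c\<close>.\<close>
  finally show "\<bar>\<Sum>n=1..N. g n / (real n)\<^sup>2 + lam * exp (- lam * real n) / real n\<bar> \<le> 19 * min 1 lam"
    by (simp add: e_def m_def)
qed

text \<open>A truncation of the majorant minus \<open>exp (- lam)\<close>, in which the constant is
  distributed over the nodes by the partition of unity. Each node then carries a difference of
  exponentials that is integrable in \<open>lam\<close>, and integration over the measure gives the
  partial sums defining \<open>H_mu\<close>.\<close>

definition gap_sum :: "nat \<Rightarrow> real \<Rightarrow> complex \<Rightarrow> complex" where
  "gap_sum N lam z = (\<Sum>k\<in>{- int N..int N}. majorant_term lam z k - of_real (exp (- lam)) * (csinc (z - of_int k))\<^sup>2)"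

lemma gap_sum_tendsto:
  assumes "lam > 0"
  shows "(\<lambda>N. gap_sum N lam z) \<longlonglongrightarrow> majorant lam z - of_real (exp (- lam))"
proof -
  have "(\<lambda>N. (\<Sum>k\<in>{- int N..int N}. majorant_term lam z k) - of_real (exp (- lam)) * (\<Sum>k\<in>{- int N..int N}. (csinc (z - of_int k))\<^sup>2))
    \<longlonglongrightarrow> majorant lam z - of_real (exp (- lam)) * 1"
    unfolding majorant_def by (intro tendsto_intros sum_int_tendsto integrable_majorant_term assms csinc_square_sum)
  then show ?thesis by (simp add: gap_sum_def sum_subtractf sum_distrib_left)
qed

lemma gap_sum_bound:
  assumes z: "z \<notin> \<int>"
  shows "\<exists>C. \<forall>lam>0. \<forall>N. norm (gap_sum N lam z) \<le> C * min 1 lam"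
proof -
  define s where "s = (sin (of_real pi * z) / of_real pi)\<^sup>2"
  define cc where "cc = (\<lambda>n::nat. 1 / (z\<^sup>2 * (of_real (1 / real n))\<^sup>2 - 1))"
  have "(\<lambda>n. 1 / real n) \<longlonglongrightarrow> 0" by real_asymp
  then have l: "(\<lambda>n. complex_of_real (1 / real n)) \<longlonglongrightarrow> of_real 0" by (rule tendsto_of_real)
  have "cc \<longlonglongrightarrow> 1 / (z\<^sup>2 * (of_real 0)\<^sup>2 - 1)" unfolding cc_def
    by (rule tendsto_divide[OF tendsto_const tendsto_diff[OF tendsto_mult[OF tendsto_const tendsto_power[OF l]] tendsto_const]]) simp
  then have "Bseq cc" by (intro convergent_imp_Bseq) (auto simp: convergent_def)
  then obtain B where B: "B > 0" "\<And>n. norm (cc n) \<le> B" by (auto elim: BseqE)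
  define w where "w = norm z"
  define A where "A = 2 * w\<^sup>2 * B + (6 * w\<^sup>2 + 2 * w^4) * B\<^sup>2"
  have A0: "A \<ge> 0" using B by (auto simp: A_def w_def intro!: add_nonneg_nonneg)
  define a where "a = (\<lambda>n::nat. 1 / (z - of_nat n)\<^sup>2 + 1 / (z + of_nat n)\<^sup>2 - 2 / (of_nat n)\<^sup>2)"
  define b where "b = (\<lambda>n::nat. 1 / (z - of_nat n) - 1 / (z + of_nat n) + 2 / of_nat n)"
  have ab: "norm (a n) \<le> A / real n ^ 3" "norm (b n) \<le> A / (real n)\<^sup>2" if n: "n \<ge> 1" for n
  proof -
    define x where "x = complex_of_nat n"
    have x: "x \<noteq> 0" using n by (simp add: x_def)
    have zx: "z - x \<noteq> 0" "z + x \<noteq> 0"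
    proof -
      show "z - x \<noteq> 0" using z by (auto simp: x_def)
      show "z + x \<noteq> 0"
      proof
        assume "z + x = 0"
        then have "z = of_int (- int n)" by (simp add: x_def eq_neg_iff_add_eq_0)
        then show False using z by simp
      qed
    qed
    have c: "cc n = x\<^sup>2 / ((z - x) * (z + x))"
    proof -
      have "z\<^sup>2 * (of_real (1 / real n))\<^sup>2 - 1 = (z - x) * (z + x) / x\<^sup>2"
        using x by (simp add: x_def field_simps power2_eq_square)
      then show ?thesis by (simp add: cc_def)
    qed
    have b': "b n = 2 * z\<^sup>2 * cc n / x ^ 3" unfolding c b_def x_def[symmetric] using x zx
      by (simp add: divide_simps power2_eq_square power3_eq_cube) (simp add: algebra_simps)
    have a': "a n = (6 * z\<^sup>2 - 2 * z ^ 4 / x\<^sup>2) * (cc n)\<^sup>2 / x ^ 4" unfolding c a_def x_def[symmetric] using x zx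
      by (simp add: divide_simps power2_eq_square power4_eq_xxxx) (simp add: algebra_simps)
    have nx: "norm x = real n" by (simp add: x_def)
    have rn: "real n \<ge> 1" using n by simp
    have "norm (b n) = 2 * w\<^sup>2 * norm (cc n) / real n ^ 3" unfolding b' by (simp add: norm_mult norm_divide norm_power nx w_def)
    also have "\<dots> \<le> 2 * w\<^sup>2 * B / (real n)\<^sup>2"
      using B rn by (intro frac_le mult_left_mono power_increasing) (auto simp: mult_nonneg_nonneg)
    also have "\<dots> \<le> A / (real n)\<^sup>2" unfolding A_def by (intro divide_right_mono) auto
    finally show "norm (b n) \<le> A / (real n)\<^sup>2" .
    have "norm (6 * z\<^sup>2 - 2 * z ^ 4 / x\<^sup>2) \<le> norm (6 * z\<^sup>2) + norm (2 * z ^ 4 / x\<^sup>2)" by (rule norm_triangle_ineq4)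
    also have "\<dots> = 6 * w\<^sup>2 + 2 * w^4 / (real n)\<^sup>2" by (simp add: norm_mult norm_divide norm_power nx w_def)
    also have "\<dots> \<le> 6 * w\<^sup>2 + 2 * w^4 / 1" using rn by (intro add_left_mono divide_left_mono) auto
    finally have q: "norm (6 * z\<^sup>2 - 2 * z ^ 4 / x\<^sup>2) \<le> 6 * w\<^sup>2 + 2 * w^4" by simp
    have "norm (a n) = norm (6 * z\<^sup>2 - 2 * z ^ 4 / x\<^sup>2) * (norm (cc n))\<^sup>2 / real n ^ 4"
      unfolding a' norm_mult norm_divide norm_power nx ..
    also have "\<dots> \<le> (6 * w\<^sup>2 + 2 * w^4) * B\<^sup>2 / real n ^ 3"
      using B rn q by (intro frac_le mult_mono power_mono power_increasing) auto
    also have "\<dots> \<le> A / real n ^ 3" unfolding A_def using B by (intro divide_right_mono) (auto simp: w_def)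
    finally show "norm (a n) \<le> A / real n ^ 3" .
  qed
  have main: "norm (gap_sum N lam z) \<le> norm s * (1 / w\<^sup>2 + 38 + 10 * A) * min 1 lam" if lam: "lam > 0" for lam N
  proof -
    define m where "m = min 1 lam"
    have m: "m > 0" using lam by (simp add: m_def)
    define p where "p = exp (- lam)"
    define e where "e = (\<lambda>n::nat. exp (- lam * real n))"
    define g where "g = (\<lambda>n::nat. exp (- lam * real n) - exp (- lam))"
    note S = symmetric_sum_bound[OF lam, folded g_def m_def]
    define f where "f = (\<lambda>k. majorant_term lam z k - of_real p * (csinc (z - of_int k))\<^sup>2)"
    have f: "f k = s * (of_real (exp (- lam * \<bar>of_int k\<bar>) - p) / (z - of_int k)\<^sup>2
       - of_real lam * of_int (sgn k) * of_real (exp (- lam * \<bar>of_int k\<bar>)) / (z - of_int k))" for k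
      unfolding f_def majorant_term_def csinc_shift_int(2)[OF z] unfolding csinc_shift_int(1)[OF z] s_def[symmetric]
      by (simp add: right_diff_distrib left_diff_distrib diff_divide_distrib mult_ac)
    have pair: "f (int n) + f (- int n) = s * (2 * of_real (g n / (real n)\<^sup>2 + lam * e n / real n) + of_real (g n) * a n - of_real (lam * e n) * b n)"
      if n: "n \<ge> 1" for n
    proof -
      have "f (int n) + f (- int n) = s * (of_real (g n) * (1 / (z - of_nat n)\<^sup>2 + 1 / (z + of_nat n)\<^sup>2)
         - of_real (lam * e n) * (1 / (z - of_nat n) - 1 / (z + of_nat n)))"
        using n unfolding f by (simp add: g_def e_def p_def distrib_left right_diff_distrib sgn_minus sgn_if) 
      also have "1 / (z - of_nat n)\<^sup>2 + 1 / (z + of_nat n)\<^sup>2 = 2 / (of_nat n)\<^sup>2 + a n" by (simp add: a_def)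
      also have "1 / (z - of_nat n) - 1 / (z + of_nat n) = b n - 2 / of_nat n" by (simp add: b_def)
      finally show ?thesis by (simp add: distrib_left right_diff_distrib mult_ac)
    qed
    have "gap_sum N lam z = f 0 + (\<Sum>n=1..N. f (int n) + f (- int n))"
      unfolding gap_sum_def f_def p_def by (rule sum_int_symmetric)
    also have "\<dots> = s * (of_real (1 - p) / z\<^sup>2) + (\<Sum>n=1..N. s * (2 * of_real (g n / (real n)\<^sup>2 + lam * e n / real n) + of_real (g n) * a n - of_real (lam * e n) * b n))"
      by (intro arg_cong2[of _ _ _ _ "(+)"] sum.cong refl pair) (auto simp: f)
    also have "\<dots> = s * (of_real (1 - p) / z\<^sup>2 + 2 * of_real (\<Sum>n=1..N. g n / (real n)\<^sup>2 + lam * e n / real n)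
        + (\<Sum>n=1..N. of_real (g n) * a n - of_real (lam * e n) * b n))"
      by (simp add: sum_distrib_left sum.distrib sum_subtractf distrib_left right_diff_distrib of_real_sum)
    finally have gs: "norm (gap_sum N lam z) = norm s * norm (of_real (1 - p) / z\<^sup>2 + 2 * of_real (\<Sum>n=1..N. g n / (real n)\<^sup>2 + lam * e n / real n)
        + (\<Sum>n=1..N. of_real (g n) * a n - of_real (lam * e n) * b n))" by (simp only: norm_mult)
    have "norm (of_real (1 - p) / z\<^sup>2 + 2 * of_real (\<Sum>n=1..N. g n / (real n)\<^sup>2 + lam * e n / real n)
        + (\<Sum>n=1..N. of_real (g n) * a n - of_real (lam * e n) * b n)) \<le> m / w\<^sup>2 + 2 * (19 * m) + 10 * A * m"
    proof (intro norm_triangle_le add_mono)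
      have "0 \<le> 1 - p" "1 - p \<le> m" using lam exp_ge_add_one_self[of "- lam"] by (auto simp: p_def m_def)
      then show "norm (of_real (1 - p) / z\<^sup>2) \<le> m / w\<^sup>2"
        unfolding norm_divide norm_of_real norm_power w_def by (intro divide_right_mono) auto
      show "norm (2 * complex_of_real (\<Sum>n=1..N. g n / (real n)\<^sup>2 + lam * e n / real n)) \<le> 2 * (19 * m)"
        unfolding norm_mult norm_of_real using S(3)[of N] by (simp add: e_def g_def)
      have "norm (of_real (g n) * a n - of_real (lam * e n) * b n) \<le> 5 * A * m * (1 / (real n)\<^sup>2)" if n: "n \<in> {1..N}" for n
      proof -
        have n: "n \<ge> 1" using n by simp
        have "norm (of_real (g n) * a n) \<le> (4 * m * real n) * (A / real n ^ 3)"
          unfolding norm_mult norm_of_real using S(1)[OF n] ab[OF n] m by (intro mult_mono) (auto simp: g_def)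
        also have "\<dots> = 4 * A * m * (1 / (real n)\<^sup>2)" using n by (simp add: power2_eq_square power3_eq_cube)
        finally have 1: "norm (of_real (g n) * a n) \<le> 4 * A * m * (1 / (real n)\<^sup>2)" .
        have "norm (of_real (lam * e n) * b n) \<le> m * (A / (real n)\<^sup>2)"
          unfolding norm_mult[of "of_real (lam * e n)"] norm_of_real using S(2)[OF n] ab[OF n] m lam
          by (intro mult_mono) (auto simp: e_def)
        with 1 norm_triangle_ineq4[of "of_real (g n) * a n" "of_real (lam * e n) * b n"]
        have "norm (of_real (g n) * a n - of_real (lam * e n) * b n) \<le> 4 * A * m * (1 / (real n)\<^sup>2) + m * (A / (real n)\<^sup>2)"
          by linarith
        also have "\<dots> = 5 * A * m * (1 / (real n)\<^sup>2)"
          by (simp add: mult.commute[of m] flip: add_divide_distrib)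
        finally show ?thesis .
      qed
      then have "norm (\<Sum>n=1..N. of_real (g n) * a n - of_real (lam * e n) * b n) \<le> (\<Sum>n=1..N. 5 * A * m * (1 / (real n)\<^sup>2))"
        by (rule sum_norm_le)
      also have "\<dots> = 5 * A * m * (\<Sum>n=1..N. 1 / (real n)\<^sup>2)" by (simp add: sum_distrib_left)
      also have "\<dots> \<le> 5 * A * m * 2" using A0 m by (intro mult_left_mono sum_inverse_squares_le) auto
      finally show "norm (\<Sum>n=1..N. of_real (g n) * a n - of_real (lam * e n) * b n) \<le> 10 * A * m" by simp
    qed
    then have "norm (gap_sum N lam z) \<le> norm s * (m / w\<^sup>2 + 2 * (19 * m) + 10 * A * m)"
      unfolding gs by (intro mult_left_mono) auto
    also have "\<dots> = norm s * (1 / w\<^sup>2 + 38 + 10 * A) * m" by (simp add: algebra_simps)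
    finally show ?thesis by (simp add: m_def)
  qed
  then show ?thesis by blast
qed

section \<open>Integration against the measure\<close>

lemma has_real_derivative_Re:
  assumes "(F has_field_derivative d) (at (of_real x))"
  shows "((\<lambda>x. Re (F (of_real x))) has_real_derivative Re d) (at x)"
    "((\<lambda>x. Im (F (of_real x))) has_real_derivative Im d) (at x)"
proof -
  have v: "((\<lambda>x. F (of_real x)) has_vector_derivative d) (at x)"
    by (rule has_vector_derivative_real_field[OF assms])
  show "((\<lambda>x. Re (F (of_real x))) has_real_derivative Re d) (at x)"
    using bounded_linear.has_vector_derivative[OF bounded_linear_Re v]
    by (simp add: has_real_derivative_iff_has_vector_derivative)
  show "((\<lambda>x. Im (F (of_real x))) has_real_derivative Im d) (at x)"
    using bounded_linear.has_vector_derivative[OF bounded_linear_Im v]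
    by (simp add: has_real_derivative_iff_has_vector_derivative)
qed

lemma csinc_measurable [measurable]: "csinc \<in> borel_measurable borel"
  by (intro borel_measurable_continuous_onI holomorphic_on_imp_continuous_on csinc_holomorphic)

lemma borel_measurable_gap_sum [measurable (raw)]:
  assumes [measurable]: "f \<in> borel_measurable N" "g \<in> borel_measurable N"
  shows "(\<lambda>x. gap_sum n (f x) (g x)) \<in> borel_measurable N"
  unfolding gap_sum_def majorant_term_def by measurable

locale subordination_measure =
  fixes \<mu> :: "real measure"
  assumes sets_\<mu>: "sets \<mu> = sets (restrict_space borel {0<..})"
    and fin: "(\<integral>\<^sup>+ lam. ennreal (lam / (lam + 1)) \<partial>\<mu>) < \<infinity>"
begin

lemma space_\<mu>: "space \<mu> = {0<..}"
  using sets_eq_imp_space_eq[OF sets_\<mu>] by (simp add: space_restrict_space)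

lemma measurable_\<mu>I: "f \<in> measurable borel N \<Longrightarrow> f \<in> measurable \<mu> N"
  using measurable_cong_sets[OF sets_\<mu> refl] measurable_restrict_space1 by blast

lemma id_measurable [measurable]: "(\<lambda>x. x) \<in> borel_measurable \<mu>"
  by (rule measurable_\<mu>I) simp

lemma integrable_quot: "integrable \<mu> (\<lambda>lam. lam / (lam + 1))"
proof (rule integrableI_nonneg)
  show "(\<lambda>lam. lam / (lam + 1)) \<in> borel_measurable \<mu>" by measurable
  show "AE lam in \<mu>. 0 \<le> lam / (lam + 1)" by (rule AE_I2) (simp add: space_\<mu>)
qed (rule fin)

lemma integrable_min: "integrable \<mu> (\<lambda>lam. min 1 lam)"
proof (rule Bochner_Integration.integrable_bound[OF integrable_mult_right[OF integrable_quot, of 2]])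
  show "(\<lambda>lam. min 1 lam) \<in> borel_measurable \<mu>" by measurable
  show "AE lam in \<mu>. norm (min 1 lam) \<le> norm (2 * (lam / (lam + 1)))"
    by (rule AE_I2) (auto simp: space_\<mu> min_def field_simps mult_le_cancel_left1)
qed

lemma integrable_by_min:
  fixes f :: "real \<Rightarrow> 'a::{banach, second_countable_topology}"
  assumes "f \<in> borel_measurable \<mu>" "\<And>lam. lam > 0 \<Longrightarrow> norm (f lam) \<le> C * min 1 lam"
  shows "integrable \<mu> f"
proof (rule Bochner_Integration.integrable_bound[OF integrable_mult_right[OF integrable_min, of C] assms(1)])
  show "AE lam in \<mu>. norm (f lam) \<le> norm (C * min 1 lam)"
  proof (rule AE_I2)
    fix lam assume "lam \<in> space \<mu>"
    then have "norm (f lam) \<le> C * min 1 lam" by (intro assms) (simp add: space_\<mu>)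
    then show "norm (f lam) \<le> norm (C * min 1 lam)" by simp
  qed
qed

text \<open>Markov's inequality bounds the measure of each level set of the positive integrable
  function \<open>lam / (lam + 1)\<close>. Fubini's theorem rests on this, as the measure itself may
  be infinite.\<close>

lemma sigma_finite_\<mu>: "sigma_finite_measure \<mu>"
proof
  define A where "A = (\<lambda>n::nat. {lam \<in> space \<mu>. lam / (lam + 1) \<ge> 1 / real (Suc n)})"
  have "A n \<in> sets \<mu>" for n unfolding A_def by measurable
  moreover have "\<Union> (range A) = space \<mu>"
  proof -
    have "\<exists>n. lam \<in> A n" if "lam \<in> space \<mu>" for lam
    proof -
      have "lam / (lam + 1) > 0" using that by (simp add: space_\<mu>)
      then obtain n where "inverse (real (Suc n)) < lam / (lam + 1)" using reals_Archimedean by blast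
      then show ?thesis using that by (auto simp: A_def inverse_eq_divide intro!: exI[of _ n])
    qed
    then show ?thesis by (auto simp: A_def)
  qed
  moreover have "emeasure \<mu> (A n) \<noteq> \<infinity>" for n
  proof -
    have "emeasure \<mu> (A n) \<le> (1 / (1 / real (Suc n))) * (LINT lam|\<mu>. lam / (lam + 1))"
      unfolding A_def by (rule integral_Markov_inequality[OF integrable_quot]) (auto simp: space_\<mu>)
    then show ?thesis using ennreal_less_top le_less_trans by (metis infinity_ennreal_def less_irrefl)
  qed
  ultimately show "\<exists>A. countable A \<and> A \<subseteq> sets \<mu> \<and> \<Union> A = space \<mu> \<and> (\<forall>a\<in>A. emeasure \<mu> a \<noteq> \<infinity>)"
    by (intro exI[of _ "range A"]) auto
qed

text \<open>A finite sum such as \<open>gap_sum\<close> is visibly measurable in \<open>lam\<close>,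
  and its limit inherits this; the joint measurability of the gap is obtained in the same
  way.\<close>

lemma majorant_measurable: "(\<lambda>lam. majorant lam z - of_real (exp (- lam))) \<in> borel_measurable \<mu>"
proof (rule borel_measurable_LIMSEQ_metric[where f = "\<lambda>N lam. gap_sum N lam z"])
  show "(\<lambda>lam. gap_sum N lam z) \<in> borel_measurable \<mu>" for N by measurable
qed (auto simp: space_\<mu> intro: gap_sum_tendsto)

lemma majorant_integrable: "integrable \<mu> (\<lambda>lam. majorant lam z - of_real (exp (- lam)))"
  by (rule integrable_by_min[OF majorant_measurable, where C = "24 * exp (2 * pi) * (1 + norm z) * exp (2 * pi * \<bar>Im z\<bar>)"])
    (use norm_majorant_minus_le[of _ z] in \<open>simp add: mult_ac\<close>)

text \<open>The superposition of the majorants, shown below to coincide with \<open>H_mu\<close>.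
  Holomorphy, growth and the gap formula are easier to reach from this integral than from the limit
  of partial sums.\<close>

definition "H z = (LINT lam|\<mu>. majorant lam z - of_real (exp (- lam)))"

lemma H_holomorphic: "H holomorphic_on UNIV"
  unfolding H_def
proof (rule holomorphic_parametric_integral)
  show "(\<lambda>z. majorant lam z - of_real (exp (- lam))) holomorphic_on UNIV" if "lam \<in> space \<mu>" for lam
    using that by (intro holomorphic_intros majorant_holomorphic) (simp add: space_\<mu>)
  fix z :: complex
  show "\<exists>r>0. \<exists>g. integrable \<mu> g \<and> (\<forall>w\<in>UNIV. dist z w < r \<longrightarrow> (\<forall>lam\<in>space \<mu>. norm (majorant lam w - of_real (exp (- lam))) \<le> g lam))"
  proof (intro exI[of _ 1] conjI exI[of _ "\<lambda>lam. min 1 lam * (24 * exp (2 * pi) * (2 + norm z) * exp (2 * pi * (\<bar>Im z\<bar> + 1)))"] ballI impI)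
    show "integrable \<mu> (\<lambda>lam. min 1 lam * (24 * exp (2 * pi) * (2 + norm z) * exp (2 * pi * (\<bar>Im z\<bar> + 1))))"
      by (rule integrable_mult_left[OF integrable_min])
    fix w lam assume w: "dist z w < 1" and lam: "lam \<in> space \<mu>"
    have 1: "norm w \<le> norm z + 1" using w norm_triangle_ineq2[of w z] by (simp add: dist_norm norm_minus_commute)
    have 2: "\<bar>Im w\<bar> \<le> \<bar>Im z\<bar> + 1" using w abs_Im_le_cmod[of "z - w"] by (simp add: dist_norm)
    have "norm (majorant lam w - of_real (exp (- lam))) \<le> min 1 lam * (24 * exp (2 * pi) * (1 + norm w) * exp (2 * pi * \<bar>Im w\<bar>))"
      using lam by (intro norm_majorant_minus_le) (simp add: space_\<mu>)
    also have "\<dots> \<le> min 1 lam * (24 * exp (2 * pi) * (2 + norm z) * exp (2 * pi * (\<bar>Im z\<bar> + 1)))"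
      using 1 2 lam by (intro mult_left_mono mult_mono) (auto simp: space_\<mu>)
    finally show "norm (majorant lam w - of_real (exp (- lam))) \<le> min 1 lam * (24 * exp (2 * pi) * (2 + norm z) * exp (2 * pi * (\<bar>Im z\<bar> + 1)))" .
  qed auto
qed (use majorant_measurable in auto)

lemma H_bound: "norm (H z) \<le> (LINT lam|\<mu>. min 1 lam) * (24 * exp (2 * pi)) * (1 + norm z) * exp (2 * pi * \<bar>Im z\<bar>)"
proof -
  have "norm (H z) \<le> (LINT lam|\<mu>. norm (majorant lam z - of_real (exp (- lam))))"
    unfolding H_def by (rule integral_norm_bound)
  also have "\<dots> \<le> (LINT lam|\<mu>. min 1 lam * (24 * exp (2 * pi) * (1 + norm z) * exp (2 * pi * \<bar>Im z\<bar>)))"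
    using norm_majorant_minus_le
    by (intro integral_mono integrable_norm majorant_integrable integrable_mult_left integrable_min) (simp add: space_\<mu>)
  also have "\<dots> = (LINT lam|\<mu>. min 1 lam) * (24 * exp (2 * pi)) * (1 + norm z) * exp (2 * pi * \<bar>Im z\<bar>)" by simp
  finally show ?thesis .
qed

text \<open>The bound on \<open>H\<close> carries a factor linear in the modulus, which the slack
  \<epsilon> absorbs through 1 + r \<le> (1 + 1/\<epsilon>) exp(\<epsilon> r).\<close>

lemma H_type: "exp_type_at_most (2 * pi) H"
  unfolding exp_type_at_most_def
proof (intro allI impI exI)
  fix \<epsilon> :: real and z :: complex assume \<epsilon>: "\<epsilon> > 0"
  define C where "C = (LINT lam|\<mu>. min 1 lam) * (24 * exp (2 * pi))"
  have C: "C \<ge> 0" unfolding C_def by (intro mult_nonneg_nonneg integral_nonneg_AE AE_I2) (auto simp: space_\<mu>)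
  have a: "1 + norm z \<le> (1 + 1 / \<epsilon>) * exp (\<epsilon> * norm z)"
  proof -
    have "1 \<le> exp (\<epsilon> * norm z)" "\<epsilon> * norm z \<le> exp (\<epsilon> * norm z)"
      using \<epsilon> exp_ge_add_one_self[of "\<epsilon> * norm z"] by (simp, linarith)
    then have "1 + norm z \<le> exp (\<epsilon> * norm z) + exp (\<epsilon> * norm z) / \<epsilon>"
      using \<epsilon> by (intro add_mono) (auto simp: pos_le_divide_eq mult.commute)
    then show ?thesis by (simp add: distrib_right)
  qed
  have "norm (H z) \<le> C * (1 + norm z) * exp (2 * pi * \<bar>Im z\<bar>)" using H_bound[of z] by (simp add: C_def)
  also have "\<dots> \<le> C * ((1 + 1 / \<epsilon>) * exp (\<epsilon> * norm z)) * exp (2 * pi * norm z)"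
    using C \<epsilon> abs_Im_le_cmod[of z] by (intro mult_mono mult_left_mono a) auto
  also have "\<dots> = C * (1 + 1 / \<epsilon>) * exp ((2 * pi + \<epsilon>) * norm z)"
    by (simp add: distrib_right mult.assoc flip: exp_add) (simp add: add.commute)
  finally show "norm (H z) \<le> C * (1 + 1 / \<epsilon>) * exp ((2 * pi + \<epsilon>) * norm z)" .
qed

section \<open>Differentiability of \<open>f_mu\<close> away from the origin\<close>

lemma f_mu_integrable: "integrable \<mu> (\<lambda>lam. exp (- lam * \<bar>x\<bar>) - exp (- lam))"
proof (rule integrable_by_min[where C = "2 * (1 + \<bar>x\<bar>)"])
  show "(\<lambda>lam. exp (- lam * \<bar>x\<bar>) - exp (- lam)) \<in> borel_measurable \<mu>" by measurable
  fix lam :: real assume lam: "lam > 0"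
  have e: "exp (- complex_of_real lam * of_real \<bar>x\<bar>) - of_real (exp (- lam)) = of_real (exp (- lam * \<bar>x\<bar>) - exp (- lam))"
    by (simp add: exp_of_real[symmetric])
  have "norm (complex_of_real (exp (- lam * \<bar>x\<bar>) - exp (- lam))) \<le> 2 * min 1 lam * (1 + \<bar>x\<bar>)"
    using exp_neg_mult_diff_le[OF lam, of "of_real \<bar>x\<bar>"] unfolding e by simp
  then show "norm (exp (- lam * \<bar>x\<bar>) - exp (- lam)) \<le> 2 * (1 + \<bar>x\<bar>) * min 1 lam"
    by (simp only: norm_of_real real_norm_def mult_ac)
qed

definition "L x = (LINT lam|\<mu>. lam * exp (- lam * x))"

text \<open>The integrand extends holomorphically to the right half-plane, where it is dominated by
  a multiple of \<open>min 1 lam\<close>. Complex differentiation under the integral then gives the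
  real derivative by restriction.\<close>

lemma f_mu_deriv_pos:
  assumes x: "x > 0"
  shows "(f_mu \<mu> has_real_derivative - L x) (at x)"
proof -
  define \<phi> where "\<phi> = (\<lambda>lam z. exp (- of_real lam * z) - complex_of_real (exp (- lam)))"
  define S where "S = {z::complex. Re z > 0}"
  have dphi: "deriv (\<phi> lam) z = - of_real lam * exp (- of_real lam * z)" for lam z
    unfolding \<phi>_def by (rule DERIV_imp_deriv) (auto intro!: derivative_eq_intros)
  have "((\<lambda>w. LINT lam|\<mu>. \<phi> lam w) has_field_derivative (LINT lam|\<mu>. deriv (\<phi> lam) (of_real x))) (at (of_real x))"
  proof (rule has_field_derivative_parametric_integral[where S = S and r = 1 and g = "\<lambda>lam. 2 * min 1 lam * (2 + norm (complex_of_real x))"])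
    show "open S" unfolding S_def by (rule open_halfspace_Re_gt)
    show "of_real x \<in> S" using x by (simp add: S_def)
    show "\<phi> lam holomorphic_on S" for lam unfolding \<phi>_def by (intro holomorphic_intros)
    show "(\<lambda>lam. \<phi> lam w) \<in> borel_measurable \<mu>" for w unfolding \<phi>_def by measurable
    show "integrable \<mu> (\<lambda>lam. 2 * min 1 lam * (2 + norm (complex_of_real x)))"
      by (intro integrable_mult_left integrable_mult_right integrable_min)
    fix w lam assume w: "w \<in> S" "dist (of_real x) w < 1" and lam: "lam \<in> space \<mu>"
    have n: "norm w \<le> norm (complex_of_real x) + 1" using w norm_triangle_ineq2[of w "of_real x"] by (simp add: dist_norm norm_minus_commute)
    have "norm (\<phi> lam w) \<le> 2 * min 1 lam * (1 + norm w)"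
      unfolding \<phi>_def using w lam by (intro exp_neg_mult_diff_le) (auto simp: S_def space_\<mu>)
    also have "\<dots> \<le> 2 * min 1 lam * (2 + norm (complex_of_real x))" using n lam by (intro mult_left_mono) (auto simp: space_\<mu>)
    finally show "norm (\<phi> lam w) \<le> 2 * min 1 lam * (2 + norm (complex_of_real x))" .
  qed simp
  from has_real_derivative_Re(1)[OF this]
  have "((\<lambda>y. Re (LINT lam|\<mu>. \<phi> lam (of_real y))) has_real_derivative Re (LINT lam|\<mu>. deriv (\<phi> lam) (of_real x))) (at x)" .
  moreover have "Re (LINT lam|\<mu>. deriv (\<phi> lam) (of_real x)) = - L x"
  proof -
    have "deriv (\<phi> lam) (of_real x) = of_real (- (lam * exp (- lam * x)))" for lam
      unfolding dphi by (simp add: exp_of_real[symmetric])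
    then have "(LINT lam|\<mu>. deriv (\<phi> lam) (of_real x)) = of_real (LINT lam|\<mu>. - (lam * exp (- lam * x)))"
      by (simp only: integral_complex_of_real)
    then show ?thesis by (simp add: L_def)
  qed
  ultimately have d: "((\<lambda>y. Re (LINT lam|\<mu>. \<phi> lam (of_real y))) has_real_derivative - L x) (at x)" by simp
  have e: "Re (LINT lam|\<mu>. \<phi> lam (of_real y)) = f_mu \<mu> y" if "y > 0" for y
  proof -
    have "\<phi> lam (of_real y) = of_real (exp (- lam * \<bar>y\<bar>) - exp (- lam))" for lam
      using that unfolding \<phi>_def by (simp add: exp_of_real[symmetric])
    then have "(LINT lam|\<mu>. \<phi> lam (of_real y)) = of_real (LINT lam|\<mu>. exp (- lam * \<bar>y\<bar>) - exp (- lam))"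
      by (simp only: integral_complex_of_real)
    then show ?thesis by (simp add: f_mu_def)
  qed
  show ?thesis
    by (rule has_field_derivative_transform_within_open[OF d, of "{0<..}"]) (use x e in auto)
qed

lemma f_mu_minus: "f_mu \<mu> (- x) = f_mu \<mu> x" by (simp add: f_mu_def)

lemma f_mu_deriv:
  assumes x: "x \<noteq> 0"
  shows "(f_mu \<mu> has_real_derivative - sgn x * L \<bar>x\<bar>) (at x)"
proof (cases "x > 0")
  case True
  then show ?thesis using f_mu_deriv_pos[OF True] by simp
next
  case False
  then have "(f_mu \<mu> has_real_derivative - L (- x)) (at (- x))" using x by (intro f_mu_deriv_pos) simp
  then have "((\<lambda>y. f_mu \<mu> (- y)) has_real_derivative - L (- x) * (- 1)) (at x)"
    by (intro DERIV_chain2[where f = "f_mu \<mu>" and g = uminus]) (auto intro!: derivative_eq_intros)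
  then show ?thesis using False x by (simp add: f_mu_minus sgn_if)
qed

lemma L_integrable:
  assumes n: "n \<ge> (1::nat)"
  shows "integrable \<mu> (\<lambda>lam. lam * exp (- lam * real n))"
proof (rule integrable_by_min[where C = 1])
  show "(\<lambda>lam. lam * exp (- lam * real n)) \<in> borel_measurable \<mu>" by measurable
  show "norm (lam * exp (- lam * real n)) \<le> 1 * min 1 lam" if "lam > 0" for lam
    using symmetric_sum_bound(2)[OF that n] that by simp
qed

text \<open>The partial sum defining \<open>H_mu\<close> with its singularities filled in. Since the
  slope of \<open>f_mu\<close> at a nonzero integer \<open>k\<close> is
  \<open>- sgn k * L \<bar>k\<bar>\<close>, the vanishing sign at 0 reproduces the omission of that
  node.\<close>

definition "hermite N z = (\<Sum>k\<in>{- int N..int N}. of_real (f_mu \<mu> (of_int k)) * (csinc (z - of_int k))\<^sup>2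
   - of_int (sgn k) * of_real (L \<bar>of_int k\<bar>) * ((z - of_int k) * (csinc (z - of_int k))\<^sup>2))"

lemma H_partial_eq_hermite: "H_partial \<mu> N z = hermite N z"
proof -
  define F where "F = (\<lambda>z::complex. (sin (of_real pi * z) / of_real pi)\<^sup>2 *
     ((\<Sum>n\<in>{- int N..int N}. of_real (f_mu \<mu> (of_int n)) / (z - of_int n)\<^sup>2)
      + (\<Sum>n\<in>{- int N..int N} - {0}. of_real (deriv (f_mu \<mu>) (of_int n)) / (z - of_int n))))"
  have F: "F w = hermite N w" if w: "w \<notin> \<int>" for w
  proof -
    define s where "s = (sin (of_real pi * w) / of_real pi)\<^sup>2"
    have "(\<Sum>n\<in>{- int N..int N} - {0}. of_real (deriv (f_mu \<mu>) (of_int n)) / (w - of_int n))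
       = (\<Sum>n\<in>{- int N..int N}. - (of_int (sgn n) * of_real (L \<bar>of_int n\<bar>)) / (w - of_int n))"
    proof (rule sum.mono_neutral_cong_left)
      show "of_real (deriv (f_mu \<mu>) (of_int n)) / (w - of_int n) = - (of_int (sgn n) * of_real (L \<bar>of_int n\<bar>)) / (w - of_int n)"
        if "n \<in> {- int N..int N} - {0}" for n
      proof -
        have "deriv (f_mu \<mu>) (of_int n) = - sgn (of_int n) * L \<bar>of_int n\<bar>"
          using that by (intro DERIV_imp_deriv f_mu_deriv) auto
        then show ?thesis by (simp add: sgn_if)
      qed
    qed auto
    then have "F w = (\<Sum>n\<in>{- int N..int N}. s * (of_real (f_mu \<mu> (of_int n)) / (w - of_int n)\<^sup>2) + s * (- (of_int (sgn n) * of_real (L \<bar>of_int n\<bar>)) / (w - of_int n)))"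
      unfolding F_def s_def[symmetric] by (simp add: sum.distrib sum_subtractf sum_negf sum_distrib_left distrib_left right_diff_distrib)
    also have "\<dots> = hermite N w" unfolding hermite_def csinc_shift_int(2)[OF w]
      unfolding csinc_shift_int(1)[OF w] s_def[symmetric] by (intro sum.cong refl) (simp add: mult_ac)
    finally show ?thesis .
  qed
  have "hermite N holomorphic_on UNIV" unfolding hermite_def
    by (intro holomorphic_intros holomorphic_on_compose[of "\<lambda>z. z - of_int _" UNIV csinc, unfolded o_def] csinc_holomorphic)
  then have "isCont (hermite N) z"
    using holomorphic_on_imp_continuous_on by (force simp: continuous_on_eq_continuous_at)
  then have "hermite N \<midarrow>z\<rightarrow> hermite N z" by (simp add: isCont_def)
  moreover have "\<forall>\<^sub>F w in at z. hermite N w = F w"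
    using eventually_at_not_Ints by eventually_elim (simp add: F)
  ultimately have "F \<midarrow>z\<rightarrow> hermite N z" by (rule Lim_transform_eventually)
  then show ?thesis unfolding H_partial_def F_def[symmetric] by (rule remove_sings_eqI)
qed

lemma hermite_eq_integral: "hermite N z = (LINT lam|\<mu>. gap_sum N lam z)"
proof -
  define t where "t = (\<lambda>lam k. of_real (exp (- lam * \<bar>of_int k\<bar>) - exp (- lam)) * (csinc (z - of_int k))\<^sup>2
     - of_real (lam * exp (- lam * \<bar>of_int k\<bar>)) * (of_int (sgn k) * ((z - of_int k) * (csinc (z - of_int k))\<^sup>2)))"
  have 1: "gap_sum N lam z = (\<Sum>k\<in>{- int N..int N}. t lam k)" for lam
    unfolding gap_sum_def majorant_term_def t_def by (intro sum.cong refl) (simp add: algebra_simps)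
  have ti: "integrable \<mu> (\<lambda>lam. t lam k) \<and> (LINT lam|\<mu>. t lam k) = of_real (f_mu \<mu> (of_int k)) * (csinc (z - of_int k))\<^sup>2
   - of_int (sgn k) * of_real (L \<bar>of_int k\<bar>) * ((z - of_int k) * (csinc (z - of_int k))\<^sup>2)" for k
  proof -
    have a: "integrable \<mu> (\<lambda>lam. of_real (exp (- lam * \<bar>of_int k\<bar>) - exp (- lam)) * (csinc (z - of_int k))\<^sup>2)"
      by (intro integrable_mult_left integrable_of_real f_mu_integrable)
    have a': "(LINT lam|\<mu>. of_real (exp (- lam * \<bar>of_int k\<bar>) - exp (- lam)) * (csinc (z - of_int k))\<^sup>2) = of_real (f_mu \<mu> (of_int k)) * (csinc (z - of_int k))\<^sup>2"
      by (simp only: integral_mult_left_zero integral_complex_of_real f_mu_def)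
    show ?thesis
    \<comment> \<open>At node 0 the slope integrand would be \<open>lam\<close> itself, which need
      not be integrable; there the factor \<open>sgn 0\<close> removes the term before any integral
      is split.\<close>
    proof (cases "k = 0")
      case True
      then show ?thesis using a a' by (simp add: t_def)
    next
      case False
      then have n: "nat \<bar>k\<bar> \<ge> 1" "real (nat \<bar>k\<bar>) = \<bar>of_int k\<bar>" by auto
      have b: "integrable \<mu> (\<lambda>lam. of_real (lam * exp (- lam * \<bar>of_int k\<bar>)) * (of_int (sgn k) * ((z - of_int k) * (csinc (z - of_int k))\<^sup>2)))"
        using L_integrable[OF n(1)] unfolding n(2) by (intro integrable_mult_left integrable_of_real)
      have b': "(LINT lam|\<mu>. of_real (lam * exp (- lam * \<bar>of_int k\<bar>)) * (of_int (sgn k) * ((z - of_int k) * (csinc (z - of_int k))\<^sup>2)))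
        = of_real (L \<bar>of_int k\<bar>) * (of_int (sgn k) * ((z - of_int k) * (csinc (z - of_int k))\<^sup>2))"
        by (simp only: integral_mult_left_zero integral_complex_of_real L_def)
      show ?thesis unfolding t_def using a b
        by (simp only: Bochner_Integration.integral_diff Bochner_Integration.integrable_diff a' b') (simp add: mult_ac)
    qed
  qed
  have "(LINT lam|\<mu>. gap_sum N lam z) = (\<Sum>k\<in>{- int N..int N}. LINT lam|\<mu>. t lam k)"
    unfolding 1 using ti by (intro Bochner_Integration.integral_sum) auto
  then show ?thesis unfolding hermite_def using ti by simp
qed

lemma H_of_int: "H (of_int m) = of_real (f_mu \<mu> (of_int m))"
proof -
  have "H (of_int m) = (LINT lam|\<mu>. of_real (exp (- lam * \<bar>of_int m\<bar>) - exp (- lam)))"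
    unfolding H_def majorant_of_int by simp
  then show ?thesis by (simp only: integral_complex_of_real f_mu_def)
qed

text \<open>Off the integers this is dominated convergence with the bound of
  \<open>gap_sum_bound\<close>. At an integer the sum consists of a single nonzero term at most and
  is eventually constant.\<close>

lemma hermite_tendsto: "(\<lambda>N. hermite N z) \<longlonglongrightarrow> H z"
proof (cases "z \<in> \<int>")
  case False
  obtain C where C: "\<And>lam N. lam > 0 \<Longrightarrow> norm (gap_sum N lam z) \<le> C * min 1 lam"
    using gap_sum_bound[OF False] by blast
  show ?thesis unfolding hermite_eq_integral H_def
  proof (rule integral_dominated_convergence[where w = "\<lambda>lam. C * min 1 lam"])
    show "(\<lambda>lam. gap_sum N lam z) \<in> borel_measurable \<mu>" for N by measurable
    show "integrable \<mu> (\<lambda>lam. C * min 1 lam)" by (intro integrable_mult_right integrable_min)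
  qed (auto simp: space_\<mu> intro!: AE_I2 gap_sum_tendsto C majorant_measurable)
next
  case True
  then obtain m :: int where m: "z = of_int m" by (auto elim: Ints_cases)
  have "hermite N z = H z" if "N \<ge> nat \<bar>m\<bar>" for N
  proof -
    have "hermite N z = (\<Sum>k\<in>{- int N..int N}. if k = m then of_real (f_mu \<mu> (of_int m)) else 0)"
      unfolding hermite_def m
    proof (intro sum.cong refl)
      fix k
      have "csinc (of_int m - of_int k) = (if k = m then 1 else 0)" using csinc_of_int[of "m - k"] by auto
      then show "of_real (f_mu \<mu> (of_int k)) * (csinc (of_int m - of_int k))\<^sup>2 - of_int (sgn k) * of_real (L \<bar>of_int k\<bar>) * ((of_int m - of_int k) * (csinc (of_int m - of_int k))\<^sup>2)
         = (if k = m then complex_of_real (f_mu \<mu> (of_int m)) else 0)" by auto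
    qed
    also have "\<dots> = of_real (f_mu \<mu> (of_int m))" using that by auto
    finally show ?thesis by (simp add: m H_of_int)
  qed
  then have "\<forall>\<^sub>F N in sequentially. H z = hermite N z"
    by (intro eventually_sequentiallyI[of "nat \<bar>m\<bar>"]) simp
  then show ?thesis by (rule Lim_transform_eventually[rotated]) simp
qed

lemma H_mu_eq: "H_mu \<mu> = H"
  unfolding H_mu_def H_partial_eq_hermite by (intro ext limI hermite_tendsto)

end

section \<open>Integrals of the majorant over the real line\<close>

lemma has_bochner_integral_exp_Ici_complex:
  fixes c :: complex
  assumes c: "Re c > 0"
  shows "has_bochner_integral lborel (\<lambda>w::real. indicator {0..} w *\<^sub>R exp (- c * of_real w)) (1 / c)"
proof -
  have c0: "c \<noteq> 0" using c by auto
  define f where "f = (\<lambda>w::real. exp (- c * of_real w))"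
  have nf: "norm (f w) = exp (- Re c * w)" for w by (simp add: f_def)
  have [measurable]: "f \<in> borel_measurable borel" unfolding f_def by measurable
  have I: "integrable lborel (\<lambda>w. indicator {0..} w * exp (- Re c * w))"
    using has_bochner_integral_exp_Ici(1)[OF c] by (simp add: has_bochner_integral_iff)
  have fi: "integrable lborel (\<lambda>w. indicator {0..} w *\<^sub>R f w)"
    by (rule Bochner_Integration.integrable_bound[OF I]) (auto simp: nf indicator_def)
  have "(\<lambda>n. LINT w|lborel. indicator {0..real n} w *\<^sub>R f w) \<longlonglongrightarrow> (LINT w|lborel. indicator {0..} w *\<^sub>R f w)"
  proof (rule integral_dominated_convergence[where w = "\<lambda>w. indicator {0..} w * exp (- Re c * w)"])
    show "AE w in lborel. (\<lambda>n. indicator {0..real n} w *\<^sub>R f w) \<longlonglongrightarrow> indicator {0..} w *\<^sub>R f w"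
    proof (rule AE_I2)
      fix w :: real
      have "\<forall>\<^sub>F n in sequentially. real n \<ge> w" using filterlim_real_sequentially by (auto simp: filterlim_at_top)
      then have "\<forall>\<^sub>F n in sequentially. indicator {0..} w *\<^sub>R f w = indicator {0..real n} w *\<^sub>R f w"
        by eventually_elim (auto simp: indicator_def)
      then show "(\<lambda>n. indicator {0..real n} w *\<^sub>R f w) \<longlonglongrightarrow> indicator {0..} w *\<^sub>R f w"
        by (rule Lim_transform_eventually[rotated]) simp
    qed
  qed (use I in \<open>auto simp: nf indicator_def\<close>)
  moreover have "(LINT w|lborel. indicator {0..real n} w *\<^sub>R f w) = - exp (- c * of_real (real n)) / c - (- exp (- c * of_real 0) / c)" for n
  proof (rule integral_FTC_Icc)
    show "((\<lambda>w. - exp (- c * of_real w) / c) has_vector_derivative f w) (at w within {0..real n})" for w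
      unfolding f_def using c0
      by (intro has_vector_derivative_real_field) (auto intro!: derivative_eq_intros)
    show "continuous_on {0..real n} f" unfolding f_def by (intro continuous_intros)
  qed simp
  moreover have "(\<lambda>n. - exp (- c * of_real (real n)) / c - (- exp (- c * of_real 0) / c)) \<longlonglongrightarrow> - 0 / c - (- exp (- c * of_real 0) / c)"
  proof -
    have "(\<lambda>n. exp (- Re c * real n)) \<longlonglongrightarrow> 0" using c by real_asymp
    then have "(\<lambda>n. norm (exp (- c * of_real (real n)))) \<longlonglongrightarrow> 0" by simp
    then have "(\<lambda>n. exp (- c * of_real (real n))) \<longlonglongrightarrow> 0" by (rule tendsto_norm_zero_cancel)
    then show ?thesis using c0 by (intro tendsto_diff tendsto_divide tendsto_minus tendsto_const)
  qed
  ultimately have "(LINT w|lborel. indicator {0..} w *\<^sub>R f w) = 1 / c"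
    using LIMSEQ_unique by (simp add: LIMSEQ_unique)
  then show ?thesis using fi by (simp add: has_bochner_integral_iff f_def)
qed

lemma fourier_exp_abs:
  assumes lam: "lam > 0"
  shows "has_bochner_integral lborel (\<lambda>x. of_real (exp (- lam * \<bar>x\<bar>)) * e2pi (of_real (- t * x)))
    (of_real (2 * lam / (lam\<^sup>2 + 4 * pi\<^sup>2 * t\<^sup>2)))"
proof -
  \<comment> \<open>The complex rates \<open>c 1\<close> and \<open>c (- 1)\<close> govern the right
    and the left half-line; they are conjugate, and their reciprocals add up to the real value
    claimed.\<close>
  define c where "c = (\<lambda>s::real. Complex lam (s * (2 * pi * t)))"
  have c: "Re (c s) > 0" "c s \<noteq> 0" for s using lam by (auto simp: c_def complex_eq_iff)
  have 1: "has_bochner_integral lborel (\<lambda>x. indicator {0..} x *\<^sub>R exp (- c 1 * of_real x)) (1 / c 1)"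
    by (rule has_bochner_integral_exp_Ici_complex[OF c(1)])
  have "has_bochner_integral lborel (\<lambda>x. indicator {0..} (0 + (- 1) * x) *\<^sub>R exp (- c (- 1) * of_real (0 + (- 1) * x))) ((1 / c (- 1)) /\<^sub>R \<bar>- 1\<bar>)"
    using has_bochner_integral_exp_Ici_complex[OF c(1)[of "- 1"]]
    by (subst (asm) lborel_has_bochner_integral_real_affine_iff[where c = "- 1" and t = 0]) simp_all
  then have 2: "has_bochner_integral lborel (\<lambda>x. indicator {..0} x *\<^sub>R exp (c (- 1) * of_real x)) (1 / c (- 1))"
    by (simp add: indicator_def)
  have s: "1 / c 1 + 1 / c (- 1) = of_real (2 * lam / (lam\<^sup>2 + 4 * pi\<^sup>2 * t\<^sup>2))"
  proof -
    have "c 1 * c (- 1) = of_real (lam\<^sup>2 + 4 * pi\<^sup>2 * t\<^sup>2)" "c 1 + c (- 1) = of_real (2 * lam)"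
      by (simp_all add: c_def complex_eq_iff power2_eq_square)
    moreover have "1 / c 1 + 1 / c (- 1) = (c 1 + c (- 1)) / (c 1 * c (- 1))" using c(2) by (simp add: field_simps)
    ultimately show ?thesis by simp
  qed
  define g where "g = (\<lambda>x. indicator {0..} x *\<^sub>R exp (- c 1 * of_real x) + indicator {..0} x *\<^sub>R exp (c (- 1) * of_real x))"
  have g: "has_bochner_integral lborel g (of_real (2 * lam / (lam\<^sup>2 + 4 * pi\<^sup>2 * t\<^sup>2)))"
    unfolding s[symmetric] g_def by (intro has_bochner_integral_add 1 2)
  define h where "h = (\<lambda>x::real. of_real (exp (- lam * \<bar>x\<bar>)) * e2pi (of_real (- t * x)))"
  have "g x = h x" if "x \<noteq> 0" for x
  proof -
    have "h x = exp (of_real (- lam * \<bar>x\<bar>) + 2 * of_real pi * \<i> * of_real (- t * x))"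
      by (simp add: h_def e2pi_def exp_of_real[symmetric] exp_add[symmetric])
    moreover have "of_real (- lam * \<bar>x\<bar>) + 2 * of_real pi * \<i> * of_real (- t * x) = (if x > 0 then - c 1 * of_real x else c (- 1) * of_real x)"
      using that by (auto simp: c_def complex_eq_iff)
    ultimately show ?thesis using that by (auto simp: g_def)
  qed
  then have ae: "AE x in lborel. g x = h x" using AE_lborel_singleton[of 0] by (auto elim: eventually_mono)
  have [measurable]: "e2pi \<in> borel_measurable borel" unfolding e2pi_def by measurable
  have m: "h \<in> borel_measurable lborel" unfolding h_def by measurable
  have "has_bochner_integral lborel h (of_real (2 * lam / (lam\<^sup>2 + 4 * pi\<^sup>2 * t\<^sup>2)))"
    using g integrable_cong_AE[OF _ m ae] integral_cong_AE[OF _ m ae]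
    by (auto simp: has_bochner_integral_iff dest: borel_measurable_integrable)
  then show ?thesis by (simp add: h_def)
qed

lemma has_bochner_integral_exp_abs:
  fixes lam :: real
  assumes lam: "lam > 0"
  shows "has_bochner_integral lborel (\<lambda>x. exp (- lam * \<bar>x\<bar>)) (2 / lam)"
proof -
  have "has_bochner_integral lborel (\<lambda>x. complex_of_real (exp (- lam * \<bar>x\<bar>))) (of_real (2 / lam))"
    using fourier_exp_abs[OF lam, of 0] lam by (simp add: e2pi_def power2_eq_square)
  from has_bochner_integral_Re[OF this] show ?thesis by simp
qed

definition gap :: "real \<Rightarrow> real \<Rightarrow> real" where
  "gap lam x = Re (majorant lam (of_real x)) - exp (- lam * \<bar>x\<bar>)"

lemma gap_bounds: "lam > 0 \<Longrightarrow> 0 \<le> gap lam x" "lam > 0 \<Longrightarrow> gap lam x \<le> min 1 lam * (norm (csinc (of_real x)))\<^sup>2"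
  unfolding gap_def by (rule majorant_gap_bounds; assumption)+

lemma majorant_eq_gap: "majorant lam (of_real x) = of_real (gap lam x) + of_real (exp (- lam * \<bar>x\<bar>))"
  unfolding gap_def by (subst majorant_real) simp

lemma csinc_square_integrable: "integrable lborel (\<lambda>x. (norm (csinc (of_real x)))\<^sup>2)"
  using integrable_norm[OF exp_type_L1.integrable_real[OF exp_type_L1_csinc_square]] by (simp add: norm_power)

lemma majorant_line_measurable:
  assumes "lam > 0"
  shows "(\<lambda>x. majorant lam (of_real x)) \<in> borel_measurable borel"
  by (intro borel_measurable_continuous_onI continuous_on_compose2[OF holomorphic_on_imp_continuous_on[OF majorant_holomorphic[OF assms]]] continuous_intros) auto

lemma gap_integrable:
  assumes lam: "lam > 0"
  shows "integrable lborel (gap lam)"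
proof (rule Bochner_Integration.integrable_bound[OF integrable_mult_right[OF csinc_square_integrable, of "min 1 lam"]])
  have [measurable]: "(\<lambda>x. majorant lam (of_real x)) \<in> borel_measurable borel" by (rule majorant_line_measurable[OF lam])
  show "gap lam \<in> borel_measurable lborel" unfolding gap_def[abs_def] by measurable
  show "AE x in lborel. norm (gap lam x) \<le> norm (min 1 lam * (norm (csinc (of_real x)))\<^sup>2)"
    by (intro AE_I2) (simp only: real_norm_def abs_of_nonneg gap_bounds(1)[OF lam],
      rule order_trans[OF gap_bounds(2)[OF lam] abs_ge_self])
qed

text \<open>Poisson summation evaluates the integral of the majorant from its values at the
  integers, a two-sided geometric series with sum \<open>coth (lam / 2)\<close>. The exponential
  itself accounts for \<open>2 / lam\<close>.\<close>

lemma gap_integral: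
  assumes lam: "lam > 0"
  shows "(LINT x|lborel. gap lam x) = coth (lam / 2) - 2 / lam"
proof -
  note E = has_bochner_integral_exp_abs[OF lam, unfolded has_bochner_integral_iff]
  have mi: "integrable lborel (\<lambda>x. majorant lam (of_real x))"
    unfolding majorant_eq_gap
    by (intro Bochner_Integration.integrable_add integrable_of_real gap_integrable lam) (use E in simp)
  interpret exp_type_L1 "majorant lam" "2 * pi"
  proof
    obtain C where C: "\<And>z. norm (majorant lam z) \<le> C * exp (2 * pi * \<bar>Im z\<bar>)" using norm_majorant_le[OF lam] by blast
    show "exp_type_at_most (2 * pi) (majorant lam)" by (rule exp_type_at_mostI[OF _ C]) simp
  qed (use mi majorant_holomorphic[OF lam] in auto)
  define q where "q = exp (- lam)"
  have q: "0 < q" "q < 1" using lam by (auto simp: q_def)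
  have pw: "exp (- lam * real n) = q ^ n" for n by (simp add: q_def exp_of_nat_mult[symmetric] mult.commute)
  have "(\<lambda>N. \<Sum>k\<in>{- int N..int N}. exp (- lam * \<bar>of_int k\<bar>)) \<longlonglongrightarrow> 1 / (1 - q) + q * (1 / (1 - q))"
  proof (rule sum_int_sums)
    show "(\<lambda>n. exp (- lam * \<bar>real_of_int (- int n)\<bar>)) sums (1 / (1 - q))"
      using geometric_sums[of q] q by (simp add: pw[simplified])
    have "(\<lambda>n. q * q ^ n) sums (q * (1 / (1 - q)))"
      using geometric_sums[of q] q by (intro sums_mult) auto
    then show "(\<lambda>j. exp (- lam * \<bar>real_of_int (int (Suc j))\<bar>)) sums (q * (1 / (1 - q)))"
      using pw[of "Suc _"] by (simp del: of_nat_Suc)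
  qed
  from tendsto_of_real[OF this, where 'a = complex]
  have "(\<lambda>N. \<Sum>k\<in>{- int N..int N}. majorant lam (of_int k)) \<longlonglongrightarrow> of_real (1 / (1 - q) + q * (1 / (1 - q)))"
    by (simp only: of_real_sum majorant_of_int)
  then have "(LINT x|lborel. majorant lam (of_real x)) = of_real (1 / (1 - q) + q * (1 / (1 - q)))"
    using poisson_summation[OF refl] LIMSEQ_unique by blast
  also have "(LINT x|lborel. majorant lam (of_real x)) = of_real ((LINT x|lborel. gap lam x) + 2 / lam)"
    unfolding majorant_eq_gap using gap_integrable[OF lam] E
    by (subst Bochner_Integration.integral_add) auto
  finally have "(LINT x|lborel. gap lam x) + 2 / lam = 1 / (1 - q) + q * (1 / (1 - q))" by (simp only: of_real_eq_iff)
  also have "\<dots> = coth (lam / 2)"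
  proof -
    define p where "p = exp (lam / 2)"
    have p: "p > 1" using lam by (simp add: p_def)
    have pq: "q = 1 / (p * p)" by (simp add: q_def p_def exp_minus inverse_eq_divide flip: exp_add)
    have "p * p \<noteq> 1" using p by (metis less_1_mult less_irrefl)
    then show ?thesis using p unfolding coth_def cosh_def sinh_def p_def[symmetric] exp_minus pq
      by (simp add: field_simps)
  qed
  finally show ?thesis by simp
qed

section \<open>The extremal problem\<close>

lemma exp_type_diff:
  assumes "exp_type_at_most \<tau> F" "exp_type_at_most \<tau> F'"
  shows "exp_type_at_most \<tau> (\<lambda>z. F z - F' z)"
  unfolding exp_type_at_most_def
proof (intro allI impI)
  fix \<epsilon> :: real assume \<epsilon>: "\<epsilon> > 0"
  obtain C C' where "\<And>z. norm (F z) \<le> C * exp ((\<tau> + \<epsilon>) * norm z)" "\<And>z. norm (F' z) \<le> C' * exp ((\<tau> + \<epsilon>) * norm z)"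
    using assms \<epsilon> unfolding exp_type_at_most_def by meson
  then have "norm (F z - F' z) \<le> (C + C') * exp ((\<tau> + \<epsilon>) * norm z)" for z
    unfolding distrib_right by (meson add_mono norm_triangle_ineq4 order_trans)
  then show "\<exists>C. \<forall>z. norm (F z - F' z) \<le> C * exp ((\<tau> + \<epsilon>) * norm z)" by blast
qed

section \<open>Fubini's theorem for the gap and the comparison with competitors\<close>

context subordination_measure
begin

lemma gap_\<mu>_measurable: "(\<lambda>(x, lam). gap lam x) \<in> borel_measurable (lborel \<Otimes>\<^sub>M \<mu>)"
proof -
  have [measurable]: "(\<lambda>p. snd p) \<in> borel_measurable (lborel \<Otimes>\<^sub>M \<mu>)"
    using measurable_compose[OF measurable_snd id_measurable] by simp
  have [measurable]: "(\<lambda>p. fst p) \<in> borel_measurable (lborel \<Otimes>\<^sub>M \<mu>)"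
    using measurable_fst[of lborel \<mu>] by simp
  have "(\<lambda>p. majorant (snd p) (of_real (fst p)) - of_real (exp (- snd p))) \<in> borel_measurable (lborel \<Otimes>\<^sub>M \<mu>)"
  proof (rule borel_measurable_LIMSEQ_metric[where f = "\<lambda>N p. gap_sum N (snd p) (of_real (fst p))"])
    show "(\<lambda>p. gap_sum N (snd p) (complex_of_real (fst p))) \<in> borel_measurable (lborel \<Otimes>\<^sub>M \<mu>)" for N by measurable
  qed (auto simp: space_\<mu> space_pair_measure intro: gap_sum_tendsto)
  then have "(\<lambda>p. Re (majorant (snd p) (of_real (fst p)) - of_real (exp (- snd p))) + exp (- snd p) - exp (- snd p * \<bar>fst p\<bar>)) \<in> borel_measurable (lborel \<Otimes>\<^sub>M \<mu>)"
    by measurable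
  then show ?thesis by (simp add: gap_def case_prod_beta)
qed

lemma gap_\<mu>_integrable: "integrable \<mu> (\<lambda>lam. gap lam x)"
proof (rule integrable_by_min[where C = "(norm (csinc (of_real x)))\<^sup>2"])
  have "(\<lambda>lam. (\<lambda>(x, lam). gap lam x) (x, lam)) \<in> borel_measurable \<mu>"
    by (rule measurable_compose[OF measurable_Pair1' gap_\<mu>_measurable]) simp
  then show "(\<lambda>lam. gap lam x) \<in> borel_measurable \<mu>" by simp
  show "norm (gap lam x) \<le> (norm (csinc (of_real x)))\<^sup>2 * min 1 lam" if "lam > 0" for lam
    using gap_bounds[OF that, of x] by (simp add: mult.commute)
qed

definition "total_gap x = (LINT lam|\<mu>. gap lam x)"

lemma H_minus_f_mu: "Re (H (of_real x)) - f_mu \<mu> x = total_gap x"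
proof -
  have "Re (H (of_real x)) = (LINT lam|\<mu>. Re (majorant lam (of_real x) - of_real (exp (- lam))))"
    unfolding H_def using majorant_integrable by (rule integral_Re[symmetric])
  moreover have "integrable \<mu> (\<lambda>lam. Re (majorant lam (of_real x) - of_real (exp (- lam))))"
    using majorant_integrable by (rule integrable_Re)
  ultimately have "Re (H (of_real x)) - f_mu \<mu> x = (LINT lam|\<mu>. Re (majorant lam (of_real x) - of_real (exp (- lam))) - (exp (- lam * \<bar>x\<bar>) - exp (- lam)))"
    using f_mu_integrable[of x] by (simp only: f_mu_def Bochner_Integration.integral_diff)
  then show ?thesis by (simp add: total_gap_def gap_def)
qed

lemma H_real: "H (of_real x) = of_real (Re (H (of_real x)))"
proof -
  have "majorant lam (of_real x) - of_real (exp (- lam)) = of_real (Re (majorant lam (of_real x)) - exp (- lam))" for lam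
    by (subst majorant_real) simp
  then have "H (of_real x) = of_real (LINT lam|\<mu>. Re (majorant lam (of_real x)) - exp (- lam))"
    unfolding H_def by (simp only: integral_complex_of_real)
  then show ?thesis by simp
qed

lemma real_entire_H: "real_entire H"
  unfolding real_entire_def using H_holomorphic H_real by (metis Reals_of_real)

lemma total_gap_nonneg: "total_gap x \<ge> 0"
  unfolding total_gap_def using gap_bounds by (intro integral_nonneg_AE AE_I2) (auto simp: space_\<mu>)

lemma total_gap_of_int: "total_gap (of_int n) = 0"
  using H_minus_f_mu[of "of_int n"] H_of_int[of n] by simp

sublocale pair_sigma_finite lborel \<mu>
  by (intro pair_sigma_finite.intro sigma_finite_lborel sigma_finite_\<mu>)

text \<open>The gap is dominated by the product of the squared sinc function in \<open>x\<close> and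
  \<open>min 1 lam\<close> in the parameter, both integrable. The majorant and the exponential taken
  separately have no such bound.\<close>

lemma gap_product_integrable: "integrable (lborel \<Otimes>\<^sub>M \<mu>) (\<lambda>(x, lam). gap lam x)"
proof (rule Fubini_integrable)
  show "(\<lambda>(x, lam). gap lam x) \<in> borel_measurable (lborel \<Otimes>\<^sub>M \<mu>)" by (rule gap_\<mu>_measurable)
  show "AE x in lborel. integrable \<mu> (\<lambda>lam. case (x, lam) of (x, lam) \<Rightarrow> gap lam x)"
    using gap_\<mu>_integrable by simp
  have m: "(\<lambda>x. LINT lam|\<mu>. norm (gap lam x)) \<in> borel_measurable lborel"
    using gap_\<mu>_measurable by (intro M2.borel_measurable_lebesgue_integral) (simp add: case_prod_beta)
  show "integrable lborel (\<lambda>x. LINT lam|\<mu>. norm (case (x, lam) of (x, lam) \<Rightarrow> gap lam x))"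
  proof (rule Bochner_Integration.integrable_bound[OF integrable_mult_left[OF csinc_square_integrable, of "LINT lam|\<mu>. min 1 lam"]])
    show "AE x in lborel. norm (LINT lam|\<mu>. norm (case (x, lam) of (x, lam) \<Rightarrow> gap lam x)) \<le> norm ((norm (csinc (of_real x)))\<^sup>2 * (LINT lam|\<mu>. min 1 lam))"
    proof (rule AE_I2)
      fix x :: real
      have "(LINT lam|\<mu>. norm (gap lam x)) \<le> (LINT lam|\<mu>. (norm (csinc (of_real x)))\<^sup>2 * min 1 lam)"
        using gap_bounds by (intro integral_mono integrable_norm gap_\<mu>_integrable integrable_mult_right integrable_min)
          (auto simp: space_\<mu> mult.commute)
      moreover have "0 \<le> (LINT lam|\<mu>. norm (gap lam x))" by (intro integral_nonneg_AE) auto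
      ultimately show "norm (LINT lam|\<mu>. norm (case (x, lam) of (x, lam) \<Rightarrow> gap lam x)) \<le> norm ((norm (csinc (of_real x)))\<^sup>2 * (LINT lam|\<mu>. min 1 lam))"
        by simp
    qed
  qed (use m in simp)
qed

lemma total_gap_integrable: "integrable lborel total_gap"
  using integrable_fst[OF gap_product_integrable] by (simp add: total_gap_def[abs_def])

lemma coth_integrable: "integrable \<mu> (\<lambda>lam. coth (lam / 2) - 2 / lam)"
  and total_gap_integral: "(LINT x|lborel. total_gap x) = (LINT lam|\<mu>. coth (lam / 2) - 2 / lam)"
proof -
  have c: "(LINT x|lborel. gap lam x) = coth (lam / 2) - 2 / lam" if "lam \<in> space \<mu>" for lam
    using that gap_integral by (simp add: space_\<mu>)
  have "integrable \<mu> (\<lambda>lam. LINT x|lborel. gap lam x)" by (rule integrable_snd[OF gap_product_integrable])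
  then show "integrable \<mu> (\<lambda>lam. coth (lam / 2) - 2 / lam)"
    using c by (simp cong: Bochner_Integration.integrable_cong)
  have "(LINT x|lborel. total_gap x) = (LINT lam|\<mu>. LINT x|lborel. gap lam x)"
    unfolding total_gap_def using Fubini_integral[OF gap_product_integrable] by simp
  also have "\<dots> = (LINT lam|\<mu>. coth (lam / 2) - 2 / lam)"
    by (rule Bochner_Integration.integral_cong) (use c in auto)
  finally show "(LINT x|lborel. total_gap x) = (LINT lam|\<mu>. coth (lam / 2) - 2 / lam)" .
qed

lemma norm_e2pi_real: "norm (e2pi (of_real x)) = 1" by (simp add: e2pi_def)

text \<open>Fubini's theorem is applied to the gap, and only then is the inner transform split into
  that of the majorant and that of the exponential. For nonzero \<open>t\<close> the latter is of
  order \<open>lam\<close> at 0 and thus integrable, which justifies the splitting.\<close>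

lemma fourier_total_gap:
  assumes t: "t \<noteq> 0"
  shows "integrable \<mu> (\<lambda>lam. M_hat lam t)"
    and "integrable \<mu> (\<lambda>lam. 2 * lam / (lam\<^sup>2 + 4 * pi\<^sup>2 * t\<^sup>2))"
    and "(LINT x|lborel. of_real (total_gap x) * e2pi (of_real (- t * x)))
      = (LINT lam|\<mu>. M_hat lam t) - of_real (LINT lam|\<mu>. 2 * lam / (lam\<^sup>2 + 4 * pi\<^sup>2 * t\<^sup>2))"
proof -
  define r where "r = (\<lambda>lam. 2 * lam / (lam\<^sup>2 + 4 * pi\<^sup>2 * t\<^sup>2))"
  define e where "e = (\<lambda>x. e2pi (of_real (- t * x)))"
  have [measurable]: "e2pi \<in> borel_measurable borel" unfolding e2pi_def by measurable
  have em[measurable]: "e \<in> borel_measurable borel" unfolding e_def by measurable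
  have ne: "norm (e x) = 1" for x unfolding e_def by (rule norm_e2pi_real)
  show ri: "integrable \<mu> (\<lambda>lam. 2 * lam / (lam\<^sup>2 + 4 * pi\<^sup>2 * t\<^sup>2))"
  \<comment> \<open>The quotient is at most 2 lam / d for small \<open>lam\<close>, with d the
    second summand of its denominator, and at most 2 / lam \<le> 2 for \<open>lam\<close> at least
    1; the constant covers both.\<close>
  proof (rule integrable_by_min[where C = "2 + 2 / (4 * pi\<^sup>2 * t\<^sup>2)"])
    show "(\<lambda>lam. 2 * lam / (lam\<^sup>2 + 4 * pi\<^sup>2 * t\<^sup>2)) \<in> borel_measurable \<mu>" by measurable
    fix lam :: real assume lam: "lam > 0"
    define d where "d = 4 * pi\<^sup>2 * t\<^sup>2"
    have d: "d > 0" using t by (simp add: d_def)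
    have l2: "lam\<^sup>2 > 0" using lam by simp
    have "2 * lam / (lam\<^sup>2 + d) \<le> (2 + 2 / d) * min 1 lam"
    proof (cases "lam < 1")
      case True
      have "2 * lam / (lam\<^sup>2 + d) \<le> 2 * lam / d" using lam d by (intro divide_left_mono) (auto intro!: mult_pos_pos add_pos_pos)
      also have "\<dots> \<le> (2 + 2 / d) * lam" using lam d by (simp add: distrib_right)
      finally show ?thesis using True by simp
    next
      case False
      have "2 * lam / (lam\<^sup>2 + d) \<le> 2 * lam / lam\<^sup>2" using lam d l2 by (intro divide_left_mono) (auto intro!: mult_pos_pos add_pos_pos)
      also have "\<dots> = 2 / lam" using lam by (simp add: power2_eq_square)
      also have "\<dots> \<le> 2 / 1" using False by (intro divide_left_mono) auto
      also have "\<dots> \<le> 2 + 2 / d" using d by simp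
      finally show ?thesis using False by simp
    qed
    moreover have "2 * lam / (lam\<^sup>2 + d) \<ge> 0" using lam d by simp
    ultimately show "norm (2 * lam / (lam\<^sup>2 + 4 * pi\<^sup>2 * t\<^sup>2)) \<le> (2 + 2 / (4 * pi\<^sup>2 * t\<^sup>2)) * min 1 lam"
      by (simp add: d_def)
  qed
  have prod: "integrable (lborel \<Otimes>\<^sub>M \<mu>) (\<lambda>(x, lam). of_real (gap lam x) * e x)"
  proof (rule Bochner_Integration.integrable_bound[OF gap_product_integrable])
    have "(\<lambda>p. complex_of_real (gap (snd p) (fst p))) \<in> borel_measurable (lborel \<Otimes>\<^sub>M \<mu>)"
    proof (rule measurable_compose[where f = "\<lambda>p. gap (snd p) (fst p)" and g = complex_of_real and N = borel])
      show "(\<lambda>p. gap (snd p) (fst p)) \<in> borel_measurable (lborel \<Otimes>\<^sub>M \<mu>)"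
        using gap_\<mu>_measurable by (simp add: case_prod_beta)
      show "complex_of_real \<in> borel_measurable borel"
        by (intro borel_measurable_continuous_onI continuous_intros)
    qed
    moreover have "(\<lambda>p. e (fst p)) \<in> borel_measurable (lborel \<Otimes>\<^sub>M \<mu>)"
      by (rule measurable_compose[OF measurable_fst]) (simp add: em)
    ultimately show "(\<lambda>(x, lam). of_real (gap lam x) * e x) \<in> borel_measurable (lborel \<Otimes>\<^sub>M \<mu>)"
      unfolding case_prod_beta by (rule borel_measurable_times)
    show "AE p in lborel \<Otimes>\<^sub>M \<mu>. norm (case p of (x, lam) \<Rightarrow> of_real (gap lam x) * e x) \<le> norm (case p of (x, lam) \<Rightarrow> gap lam x)"
      by (intro AE_I2) (auto simp: norm_mult ne)
  qed
  have Mh: "M_hat lam t = (LINT x|lborel. of_real (gap lam x) * e x) + of_real (r lam)" if "lam \<in> space \<mu>" for lam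
  proof -
    have lam: "lam > 0" using that by (simp add: space_\<mu>)
    have gi: "integrable lborel (\<lambda>x. of_real (gap lam x) * e x)"
    proof (rule Bochner_Integration.integrable_bound[OF gap_integrable[OF lam]])
      show "(\<lambda>x. of_real (gap lam x) * e x) \<in> borel_measurable lborel"
      proof (rule borel_measurable_times)
        show "(\<lambda>x. complex_of_real (gap lam x)) \<in> borel_measurable lborel"
          by (intro borel_measurable_integrable integrable_of_real gap_integrable lam)
      qed (simp add: em)
    qed (simp add: norm_mult ne)
    note F = fourier_exp_abs[OF lam, of t, folded e_def, unfolded has_bochner_integral_iff]
    have "M_hat lam t = (LINT x|lborel. of_real (gap lam x) * e x + of_real (exp (- lam * \<bar>x\<bar>)) * e x)"
      unfolding M_hat_def M_eq_majorant[OF lam] majorant_eq_gap e_def distrib_right ..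
    also have "\<dots> = (LINT x|lborel. of_real (gap lam x) * e x) + (LINT x|lborel. of_real (exp (- lam * \<bar>x\<bar>)) * e x)"
      using F by (intro Bochner_Integration.integral_add gi) (simp add: e_def)
    also have "(LINT x|lborel. of_real (exp (- lam * \<bar>x\<bar>)) * e x) = of_real (r lam)"
      using F by (simp add: r_def e_def)
    finally show ?thesis .
  qed
  have si: "integrable \<mu> (\<lambda>lam. LINT x|lborel. of_real (gap lam x) * e x)" by (rule integrable_snd[OF prod])
  have ri': "integrable \<mu> (\<lambda>lam. complex_of_real (r lam))" unfolding r_def by (intro integrable_of_real ri)
  have "integrable \<mu> (\<lambda>lam. (LINT x|lborel. of_real (gap lam x) * e x) + of_real (r lam))"
    by (intro Bochner_Integration.integrable_add si ri')
  then show "integrable \<mu> (\<lambda>lam. M_hat lam t)" using Mh by (simp cong: Bochner_Integration.integrable_cong)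
  have "(LINT lam|\<mu>. M_hat lam t) = (LINT lam|\<mu>. (LINT x|lborel. of_real (gap lam x) * e x) + of_real (r lam))"
    by (rule Bochner_Integration.integral_cong) (use Mh in auto)
  also have "\<dots> = (LINT lam|\<mu>. LINT x|lborel. of_real (gap lam x) * e x) + of_real (LINT lam|\<mu>. r lam)"
    using si ri' by (simp add: Bochner_Integration.integral_add integral_complex_of_real)
  also have "(LINT lam|\<mu>. LINT x|lborel. of_real (gap lam x) * e x) = (LINT x|lborel. LINT lam|\<mu>. of_real (gap lam x) * e x)"
    by (rule Fubini_integral[OF prod])
  also have "\<dots> = (LINT x|lborel. of_real (total_gap x) * e x)"
    by (simp only: integral_mult_left_zero integral_complex_of_real total_gap_def)
  finally show "(LINT x|lborel. of_real (total_gap x) * e2pi (of_real (- t * x)))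
      = (LINT lam|\<mu>. M_hat lam t) - of_real (LINT lam|\<mu>. 2 * lam / (lam\<^sup>2 + 4 * pi\<^sup>2 * t\<^sup>2))"
    by (simp add: e_def r_def)
qed

text \<open>A point of contact is a minimum of the difference, so the real parts of the slopes agree
  wherever \<open>f_mu\<close> is differentiable. The imaginary part of the derivative vanishes
  because the function is real on the real axis.\<close>

lemma deriv_of_touching_majorant:
  assumes Ht: "real_entire Ht" and maj: "\<And>x. f_mu \<mu> x \<le> Re (Ht (of_real x))"
    and touch: "Re (Ht (of_real x)) = f_mu \<mu> x" and x: "x \<noteq> 0"
  shows "deriv Ht (of_real x) = of_real (- sgn x * L \<bar>x\<bar>)"
proof -
  have d: "(Ht has_field_derivative deriv Ht (of_real x)) (at (of_real x))"
    using Ht by (intro holomorphic_derivI[of _ UNIV]) (auto simp: real_entire_def)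
  have "((\<lambda>y. Re (Ht (of_real y)) - f_mu \<mu> y) has_real_derivative Re (deriv Ht (of_real x)) - (- sgn x * L \<bar>x\<bar>)) (at x)"
    by (intro DERIV_diff has_real_derivative_Re(1)[OF d] f_mu_deriv x)
  then have "Re (deriv Ht (of_real x)) - (- sgn x * L \<bar>x\<bar>) = 0"
    by (rule DERIV_local_min[of _ _ _ 1]) (use maj touch in auto)
  moreover have "Im (deriv Ht (of_real x)) = 0"
  proof -
    have "Im (Ht (of_real y)) = 0" for y using Ht by (auto simp: real_entire_def complex_is_Real_iff)
    then have "((\<lambda>y. 0) has_real_derivative Im (deriv Ht (of_real x))) (at x)"
      using has_real_derivative_Re(2)[OF d] by simp
    then show ?thesis using DERIV_unique DERIV_const by blast
  qed
  ultimately show ?thesis by (simp add: complex_eq_iff)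
qed

lemma extremal:
  assumes Ht: "real_entire Ht" "exp_type_at_most (2 * pi) Ht" and maj: "\<And>x. f_mu \<mu> x \<le> Re (Ht (of_real x))"
  defines "P \<equiv> (\<lambda>x. Re (Ht (of_real x)) - f_mu \<mu> x)"
  shows "(\<integral>\<^sup>+ x. ennreal (total_gap x) \<partial>lborel) \<le> (\<integral>\<^sup>+ x. ennreal (P x) \<partial>lborel)"
    and "(\<integral>\<^sup>+ x. ennreal (total_gap x) \<partial>lborel) = (\<integral>\<^sup>+ x. ennreal (P x) \<partial>lborel) \<longleftrightarrow> Ht = H"
proof -
  have Q: "(\<integral>\<^sup>+ x. ennreal (total_gap x) \<partial>lborel) = ennreal (LINT x|lborel. total_gap x)"
    by (rule nn_integral_eq_integral[OF total_gap_integrable]) (simp add: total_gap_nonneg)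
  have P0: "P x \<ge> 0" for x using maj[of x] by (simp add: P_def)
  have eqH: "(\<integral>\<^sup>+ x. ennreal (total_gap x) \<partial>lborel) = (\<integral>\<^sup>+ x. ennreal (P x) \<partial>lborel)" if "Ht = H"
    using that H_minus_f_mu by (simp add: P_def)
  have "(\<integral>\<^sup>+ x. ennreal (total_gap x) \<partial>lborel) \<le> (\<integral>\<^sup>+ x. ennreal (P x) \<partial>lborel) \<and>
    ((\<integral>\<^sup>+ x. ennreal (total_gap x) \<partial>lborel) = (\<integral>\<^sup>+ x. ennreal (P x) \<partial>lborel) \<longrightarrow> Ht = H)"
  \<comment> \<open>A competitor may have infinite excess. The integral of the gap is finite, so the
    inequality is then strict and equality cannot occur.\<close>
  proof (cases "(\<integral>\<^sup>+ x. ennreal (P x) \<partial>lborel) = \<infinity>")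
    case True
    then show ?thesis unfolding Q by simp
  next
    case False
    define G where "G = (\<lambda>z. Ht z - H z)"
    have Hthol: "Ht holomorphic_on UNIV" using Ht by (simp add: real_entire_def)
    have Ghol: "G holomorphic_on UNIV" unfolding G_def by (intro holomorphic_intros Hthol H_holomorphic)
    have Htreal: "Ht (of_real x) = of_real (Re (Ht (of_real x)))" for x
      using Ht by (simp add: real_entire_def)
    have Greal: "G (of_real x) = of_real (P x - total_gap x)" for x
    proof -
      have "G (of_real x) = of_real (Re (Ht (of_real x)) - Re (H (of_real x)))"
        unfolding G_def by (subst Htreal, subst H_real) simp
      moreover have "Re (H (of_real x)) = f_mu \<mu> x + total_gap x" using H_minus_f_mu[of x] by simp
      ultimately show ?thesis by (simp add: P_def)
    qed
    have Pm: "P \<in> borel_measurable lborel"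
    proof -
      have "(\<lambda>x. G (of_real x)) \<in> borel_measurable borel"
        by (intro borel_measurable_continuous_onI continuous_on_compose2[OF holomorphic_on_imp_continuous_on[OF Ghol]] continuous_intros) auto
      then have "(\<lambda>x. Re (G (of_real x))) \<in> borel_measurable lborel"
        using measurable_compose[OF _ borel_measurable_Re] by simp
      then have "(\<lambda>x. Re (G (of_real x)) + total_gap x) \<in> borel_measurable lborel"
        by (rule borel_measurable_add[OF _ borel_measurable_integrable[OF total_gap_integrable]])
      then show ?thesis by (simp add: Greal)
    qed
    have Pi: "integrable lborel P"
      by (rule integrableI_nonneg[OF Pm]) (use P0 False in \<open>auto simp: less_top\<close>)
    have Pn: "(\<integral>\<^sup>+ x. ennreal (P x) \<partial>lborel) = ennreal (LINT x|lborel. P x)"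
      by (rule nn_integral_eq_integral[OF Pi]) (simp add: P0)
    interpret exp_type_L1 G "2 * pi"
    proof
      show "exp_type_at_most (2 * pi) G" unfolding G_def by (intro exp_type_diff Ht H_type)
      show "integrable lborel (\<lambda>x. G (of_real x))" unfolding Greal
        by (intro integrable_of_real Bochner_Integration.integrable_diff Pi total_gap_integrable)
    qed (use Ghol in auto)
    have Gint: "G (of_int k) = of_real (P (of_int k))" for k
      using Greal[of "of_int k"] by (simp add: total_gap_of_int)
    have "(LINT x|lborel. G (of_real x)) = of_real ((LINT x|lborel. P x) - (LINT x|lborel. total_gap x))"
      unfolding Greal using Pi total_gap_integrable by (simp add: integral_complex_of_real del: of_real_diff)
    with poisson_summation[OF refl]
    have "(\<lambda>N. of_real (\<Sum>k\<in>{- int N..int N}. P (of_int k))) \<longlonglongrightarrow> complex_of_real ((LINT x|lborel. P x) - (LINT x|lborel. total_gap x))"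
      by (simp only: Gint of_real_sum)
    then have lim: "(\<lambda>N. \<Sum>k\<in>{- int N..int N}. P (of_int k)) \<longlonglongrightarrow> (LINT x|lborel. P x) - (LINT x|lborel. total_gap x)"
      unfolding tendsto_of_real_iff .
    \<comment> \<open>All terms of the Poisson sum are nonnegative, so each one is at most the
      difference of the integrals. This gives the inequality, and in the case of equality it forces
      contact at every integer.\<close>
    have pk: "P (of_int k) \<le> (LINT x|lborel. P x) - (LINT x|lborel. total_gap x)" for k
    proof (rule LIMSEQ_le_const[OF lim], intro exI allI impI)
      fix N assume "nat \<bar>k\<bar> \<le> N"
      then have "k \<in> {- int N..int N}" by auto
      then show "P (of_int k) \<le> (\<Sum>k\<in>{- int N..int N}. P (of_int k))"
        by (intro member_le_sum) (auto simp: P0)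
    qed
    have le: "(LINT x|lborel. total_gap x) \<le> (LINT x|lborel. P x)" using pk[of 0] P0[of 0] by simp
    have tg0: "(LINT x|lborel. total_gap x) \<ge> 0" by (intro integral_nonneg_AE AE_I2 total_gap_nonneg)
    have "Ht = H" if eq: "(LINT x|lborel. total_gap x) = (LINT x|lborel. P x)"
    proof
      fix z
      have Pk: "P (of_int k) = 0" for k using pk[of k] P0[of "of_int k"] eq by simp
      have "G z = 0"
      proof (rule eq_zero_of_double_zeros[OF refl])
        show "G (of_int n) = 0" for n using Gint[of n] Pk[of n] by simp
        fix n :: int assume n: "n \<noteq> 0"
        have "deriv G (of_real (of_int n)) = deriv Ht (of_real (of_int n)) - deriv H (of_real (of_int n))"
          unfolding G_def using Hthol H_holomorphic
          by (intro deriv_diff) (auto simp: holomorphic_on_imp_differentiable_at)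
        also have "\<dots> = 0"
        proof -
          have x: "real_of_int n \<noteq> 0" using n by simp
          have "Re (Ht (of_real (of_int n))) = f_mu \<mu> (of_int n)" using Pk[of n] by (simp add: P_def)
          note 1 = deriv_of_touching_majorant[OF Ht(1) maj this x]
          \<comment> \<open>\<open>H\<close> is itself a majorant that touches \<open>f_mu\<close>
            at the integers, so the contact lemma determines its derivative as well and the two
            derivatives cancel.\<close>
          have "f_mu \<mu> y \<le> Re (H (of_real y))" for y using H_minus_f_mu[of y] total_gap_nonneg[of y] by linarith
          moreover have "Re (H (of_real (of_int n))) = f_mu \<mu> (of_int n)"
            using H_minus_f_mu[of "of_int n"] total_gap_of_int[of n] by linarith
          ultimately have "deriv H (of_real (of_int n)) = of_real (- sgn (of_int n) * L \<bar>of_int n\<bar>)"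
            using deriv_of_touching_majorant[OF real_entire_H _ _ x] by blast
          then show ?thesis unfolding 1 by simp
        qed
        finally show "deriv G (of_int n) = 0" by simp
      qed
      then show "Ht z = H z" by (simp add: G_def)
    qed
    then show ?thesis unfolding Q Pn using le tg0 by (auto simp: ennreal_inj intro: ennreal_leI)
  qed
  then show "(\<integral>\<^sup>+ x. ennreal (total_gap x) \<partial>lborel) \<le> (\<integral>\<^sup>+ x. ennreal (P x) \<partial>lborel)"
    and "(\<integral>\<^sup>+ x. ennreal (total_gap x) \<partial>lborel) = (\<integral>\<^sup>+ x. ennreal (P x) \<partial>lborel) \<longleftrightarrow> Ht = H"
    using eqH by auto
qed

end

theorem theorem1p2:
  fixes \<mu> :: "real measure"
  assumes sets_\<mu>: "sets \<mu> = sets (restrict_space borel {0<..})"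
    and pos: "0 < (\<integral>\<^sup>+ lam. ennreal (lam / (lam + 1)) \<partial>\<mu>)"
    and fin: "(\<integral>\<^sup>+ lam. ennreal (lam / (lam + 1)) \<partial>\<mu>) < \<infinity>"
  shows
    \<comment> \<open>(i)\<close>
    "(real_entire (H_mu \<mu>) \<and> exp_type_at_most (2 * pi) (H_mu \<mu>))
    \<and> \<comment> \<open>(ii)\<close>
     (\<forall>x::real. (\<forall>lam>0. 0 \<le> Re (M lam (of_real x)) - exp (- lam * \<bar>x\<bar>))
        \<and> integrable \<mu> (\<lambda>lam. Re (M lam (of_real x)) - exp (- lam * \<bar>x\<bar>)))
    \<and> \<comment> \<open>(iii)\<close>
     (\<forall>x::real. 0 \<le> Re (H_mu \<mu> (of_real x)) - f_mu \<mu> x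
        \<and> Re (H_mu \<mu> (of_real x)) - f_mu \<mu> x
            = (LINT lam|\<mu>. Re (M lam (of_real x)) - exp (- lam * \<bar>x\<bar>)))
    \<and> \<comment> \<open>(iv)\<close>
     (integrable lborel (\<lambda>x. Re (H_mu \<mu> (of_real x)) - f_mu \<mu> x)
        \<and> integrable \<mu> (\<lambda>lam. coth (lam / 2) - 2 / lam)
        \<and> (LINT x|lborel. Re (H_mu \<mu> (of_real x)) - f_mu \<mu> x)
            = (LINT lam|\<mu>. coth (lam / 2) - 2 / lam))
    \<and> \<comment> \<open>(v)\<close>
     (\<forall>t::real. t \<noteq> 0 \<longrightarrow>
        integrable \<mu> (\<lambda>lam. M_hat lam t)
        \<and> integrable \<mu> (\<lambda>lam. 2 * lam / (lam\<^sup>2 + 4 * pi\<^sup>2 * t\<^sup>2))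
        \<and> (LINT x|lborel. of_real (Re (H_mu \<mu> (of_real x)) - f_mu \<mu> x) * e2pi (of_real (- t * x)))
            = (LINT lam|\<mu>. M_hat lam t)
              - of_real (LINT lam|\<mu>. 2 * lam / (lam\<^sup>2 + 4 * pi\<^sup>2 * t\<^sup>2)))
    \<and> \<comment> \<open>(vi) and (vii)\<close>
     (\<forall>Ht :: complex \<Rightarrow> complex.
        real_entire Ht \<and> exp_type_at_most (2 * pi) Ht
          \<and> (\<forall>x::real. f_mu \<mu> x \<le> Re (Ht (of_real x))) \<longrightarrow>
        (\<integral>\<^sup>+ x. ennreal (Re (H_mu \<mu> (of_real x)) - f_mu \<mu> x) \<partial>lborel)
          \<le> (\<integral>\<^sup>+ x. ennreal (Re (Ht (of_real x)) - f_mu \<mu> x) \<partial>lborel)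
        \<and> ((\<integral>\<^sup>+ x. ennreal (Re (H_mu \<mu> (of_real x)) - f_mu \<mu> x) \<partial>lborel)
            = (\<integral>\<^sup>+ x. ennreal (Re (Ht (of_real x)) - f_mu \<mu> x) \<partial>lborel)
           \<longleftrightarrow> Ht = H_mu \<mu>))"
proof -
  interpret subordination_measure \<mu> by unfold_locales (rule sets_\<mu>, rule fin)
  have gap_M: "Re (M lam (of_real x)) - exp (- lam * \<bar>x\<bar>) = gap lam x" if "lam > 0" for lam x
    by (simp add: gap_def M_eq_majorant[OF that])
  have gap_M_\<mu>: "Re (M lam (of_real x)) - exp (- lam * \<bar>x\<bar>) = gap lam x" if "lam \<in> space \<mu>" for lam x
    using that by (intro gap_M) (simp add: space_\<mu>)
  have int: "integrable \<mu> (\<lambda>lam. Re (M lam (of_real x)) - exp (- lam * \<bar>x\<bar>))" for x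
    by (subst Bochner_Integration.integrable_cong[OF refl gap_M_\<mu>]) (auto intro: gap_\<mu>_integrable)
  have val: "(LINT lam|\<mu>. Re (M lam (of_real x)) - exp (- lam * \<bar>x\<bar>)) = total_gap x" for x
    unfolding total_gap_def by (rule Bochner_Integration.integral_cong) (use gap_M_\<mu> in auto)
  have 2: "\<forall>x::real. (\<forall>lam>0. 0 \<le> Re (M lam (of_real x)) - exp (- lam * \<bar>x\<bar>))
        \<and> integrable \<mu> (\<lambda>lam. Re (M lam (of_real x)) - exp (- lam * \<bar>x\<bar>))"
  proof (intro allI conjI impI int)
    fix x lam :: real assume "lam > 0"
    then show "0 \<le> Re (M lam (of_real x)) - exp (- lam * \<bar>x\<bar>)"
      unfolding gap_M[OF \<open>lam > 0\<close>] by (rule gap_bounds(1))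
  qed
  have 1: "real_entire H \<and> exp_type_at_most (2 * pi) H" using real_entire_H H_type by blast
  have 3: "\<forall>x::real. 0 \<le> total_gap x \<and> total_gap x = total_gap x" using total_gap_nonneg by simp
  have 4: "integrable lborel (\<lambda>x. total_gap x) \<and> integrable \<mu> (\<lambda>lam. coth (lam / 2) - 2 / lam)
      \<and> (LINT x|lborel. total_gap x) = (LINT lam|\<mu>. coth (lam / 2) - 2 / lam)"
    by (intro conjI total_gap_integrable coth_integrable total_gap_integral)
  have 5: "\<forall>t::real. t \<noteq> 0 \<longrightarrow> integrable \<mu> (\<lambda>lam. M_hat lam t)
        \<and> integrable \<mu> (\<lambda>lam. 2 * lam / (lam\<^sup>2 + 4 * pi\<^sup>2 * t\<^sup>2))
        \<and> (LINT x|lborel. of_real (total_gap x) * e2pi (of_real (- t * x)))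
            = (LINT lam|\<mu>. M_hat lam t) - of_real (LINT lam|\<mu>. 2 * lam / (lam\<^sup>2 + 4 * pi\<^sup>2 * t\<^sup>2))"
    by (intro allI impI conjI fourier_total_gap)
  have 6: "\<forall>Ht. real_entire Ht \<and> exp_type_at_most (2 * pi) Ht \<and> (\<forall>x::real. f_mu \<mu> x \<le> Re (Ht (of_real x))) \<longrightarrow>
        (\<integral>\<^sup>+ x. ennreal (total_gap x) \<partial>lborel) \<le> (\<integral>\<^sup>+ x. ennreal (Re (Ht (of_real x)) - f_mu \<mu> x) \<partial>lborel)
        \<and> ((\<integral>\<^sup>+ x. ennreal (total_gap x) \<partial>lborel) = (\<integral>\<^sup>+ x. ennreal (Re (Ht (of_real x)) - f_mu \<mu> x) \<partial>lborel) \<longleftrightarrow> Ht = H)"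
    by (intro allI impI conjI extremal; elim conjE; (assumption | erule spec))
  show ?thesis
    unfolding H_mu_eq H_minus_f_mu val by (rule conjI[OF 1 conjI[OF 2 conjI[OF 3 conjI[OF 4 conjI[OF 5 6]]]]])
qed

end
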